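(* Let $\lambda\in\mathbb C$ with $\lambda^2\notin\mathbb R$. Then the Lie algebra $\mathfrak{gl}(\lambda)$ has no involutive anti-linear automorphisms, i.e., there is no $\mathbb R$-linear map $\omega:\mathfrak{gl}(\lambda)\to\mathfrak{gl}(\lambda)$ with $\omega(\alpha x)=\bar\alpha\,\omega(x)$, $\omega([x,y])=[\omega(x),\omega(y)]$ and $\omega^2=\mathrm{id}$ for all $\alpha\in\mathbb C$, $x,y\in\mathfrak{gl}(\lambda)$.
   Context: For $\lambda\in\mathbb C\setminus\mathbb Z$, let $\mathfrak A_\lambda=U(\mathfrak{sl}(2))/I_\lambda$, where $\mathfrak{sl}(2)$ has basis $X,H,Y$ with $[X,Y]=H$, $[H,X]=2X$, $[H,Y]=-2Y$, and $I_\lambda$ is the two-sided ideal generated by $2YX+\frac12H^2+H-\frac12(\lambda^2-1)$. $\mathfrak{gl}(\lambda)$ denotes $\mathfrak A_\lambda$ regarded as a Lie algebra with bracket $[a,b]=ab-ba$. *)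

theory Defs
  imports Complex_Main
begin

datatype gen = GX | GH | GY

text \<open>The free associative complex algebra on X, H, Y: finitely supported
  functions from words to complex coefficients (noncommutative polynomials).\<close>
type_synonym fa = "gen list \<Rightarrow> complex"

definition FA :: "fa set" where
  "FA = {f. finite {w. f w \<noteq> 0}}"

definition fzero :: fa where "fzero = (\<lambda>w. 0)"
definition fadd :: "fa \<Rightarrow> fa \<Rightarrow> fa" where "fadd f g = (\<lambda>w. f w + g w)"
definition fsc :: "complex \<Rightarrow> fa \<Rightarrow> fa" where "fsc c f = (\<lambda>w. c * f w)"
definition fsub :: "fa \<Rightarrow> fa \<Rightarrow> fa" where "fsub f g = (\<lambda>w. f w - g w)"
definition fmul :: "fa \<Rightarrow> fa \<Rightarrow> fa" where
  "fmul f g = (\<lambda>w. \<Sum>k\<le>length w. f (take k w) * g (drop k w))"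
definition fone :: fa where "fone = (\<lambda>w. if w = [] then 1 else 0)"
definition fgen :: "gen \<Rightarrow> fa" where "fgen a = (\<lambda>w. if w = [a] then 1 else 0)"

definition fX :: fa where "fX = fgen GX"
definition fH :: fa where "fH = fgen GH"
definition fY :: fa where "fY = fgen GY"

definition fcomm :: "fa \<Rightarrow> fa \<Rightarrow> fa" where "fcomm f g = fsub (fmul f g) (fmul g f)"

text \<open>Defining relations: those of U(sl(2)) ([X,Y]=H, [H,X]=2X, [H,Y]=-2Y)
  together with the generator of I_lambda.\<close>
definition casimir_rel :: "complex \<Rightarrow> fa" where
  "casimir_rel lam =
     fsub (fadd (fadd (fsc 2 (fmul fY fX)) (fsc (1/2) (fmul fH fH))) fH)
          (fsc ((lam^2 - 1) / 2) fone)"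

definition rels :: "complex \<Rightarrow> fa set" where
  "rels lam = { fsub (fcomm fX fY) fH,
                fsub (fcomm fH fX) (fsc 2 fX),
                fadd (fcomm fH fY) (fsc 2 fY),
                casimir_rel lam }"

inductive_set ideal_gen :: "complex \<Rightarrow> fa set" for lam where
  gen: "r \<in> rels lam \<Longrightarrow> r \<in> ideal_gen lam"
| zero: "fzero \<in> ideal_gen lam"
| add: "p \<in> ideal_gen lam \<Longrightarrow> q \<in> ideal_gen lam \<Longrightarrow> fadd p q \<in> ideal_gen lam"
| sc: "p \<in> ideal_gen lam \<Longrightarrow> fsc c p \<in> ideal_gen lam"
| lmul: "a \<in> FA \<Longrightarrow> p \<in> ideal_gen lam \<Longrightarrow> fmul a p \<in> ideal_gen lam"
| rmul: "a \<in> FA \<Longrightarrow> p \<in> ideal_gen lam \<Longrightarrow> fmul p a \<in> ideal_gen lam"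

definition cls :: "complex \<Rightarrow> fa \<Rightarrow> fa set" where
  "cls lam p = {q \<in> FA. fsub q p \<in> ideal_gen lam}"

definition Alg :: "complex \<Rightarrow> fa set set" where
  "Alg lam = {cls lam p | p. p \<in> FA}"

definition rep :: "fa set \<Rightarrow> fa" where "rep a = (SOME p. p \<in> a)"

definition A_add :: "complex \<Rightarrow> fa set \<Rightarrow> fa set \<Rightarrow> fa set" where
  "A_add lam a b = cls lam (fadd (rep a) (rep b))"
definition A_sc :: "complex \<Rightarrow> complex \<Rightarrow> fa set \<Rightarrow> fa set" where
  "A_sc lam c a = cls lam (fsc c (rep a))"
definition A_mul :: "complex \<Rightarrow> fa set \<Rightarrow> fa set \<Rightarrow> fa set" where
  "A_mul lam a b = cls lam (fmul (rep a) (rep b))"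

definition A_bracket :: "complex \<Rightarrow> fa set \<Rightarrow> fa set \<Rightarrow> fa set" where
  "A_bracket lam a b = cls lam (fcomm (rep a) (rep b))"

end

theory Submission
  imports Defs "HOL-Computational_Algebra.Fundamental_Theorem_Algebra"
begin

text \<open>
  Sending X to T, H to 2 theta and Y to T^{-1} q(theta) embeds the quotient algebra in the skew Laurent
  ring C[theta][T, 1/T] with theta T = T (theta + 1); call the image B. An antilinear Lie automorphism
  omega turns the standard triple (X, H, Y) into another triple (x, h, y) in B with x locally
  ad-nilpotent, and the point is that such a triple is conjugate to the standard one.

  Weigh T^k theta^j by alpha k + j. The leading form of a commutator is a Poisson bracket, which after
  setting T = 1 reads (e P' Q - d P Q') / alpha for leading forms P, Q of weights d, e. If x is
  locally ad-nilpotent and its Newton polygon is not a segment on one of the two boundary rays, then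
  following the order of vanishing of the iterated brackets at a root of the edge polynomial
  P shows that this root has multiplicity larger than d. Hence P is a power of a single linear factor, a
  substitution theta -> theta + c T^t shortens the polygon, and by induction (using the symmetry
  exchanging X and Y) x becomes a polynomial in T. The relations of the triple then force x, h, y to be
  X, H, Y up to a further automorphism.

  So one may assume that omega fixes X, H, Y, whence it scales each X^n by some c_n. Decomposing the
  brackets of X^2 with (ad Y)^3 X^2 and (ad Y)^3 X^3 under the adjoint action of the triple gives
  c_2^2 (4 - lam^2) = cnj (4 - lam^2) and c_2^2 (9 - lam^2) = cnj (9 - lam^2), so c_2^2 = 1 and lam^2
  is real.
\<close>

section \<open>The skew Laurent ring\<close>

text \<open>Since omega respects only brackets, its triple need not satisfy the Casimir relation and
  does not by itself extend to an algebra map. That relation is recovered last: in B the coefficient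
  at T^(-n) is divisible by q(theta) q(theta - 1) ... q(theta - n + 1), and the case n = 1 pins down
  y.

  The same divisibility puts the exponents (k, j) of B into the cone j >= -2k, which is what makes
  the reduction work. An edge from (m, 0) to (-nu, 2 nu) with nu <= m has degree 2 nu <= 2 d, so two
  roots of multiplicity above d cannot coexist. If the polygon reaches further on the negative side,
  exchanging X and Y restores nu <= m.

  Two bracket identities are needed because c^2 (4 - lam^2) = cnj (4 - lam^2) alone is solvable in c
  for every lam. Under the adjoint action the algebra is a sum of irreducible modules, one for each
  power X^n. The factors 4 - lam^2 and 9 - lam^2 are the structure constants of the second component
  of a bracket: X inside X^2 with X^2, and X^2 inside X^2 with X^3.\<close>

definition shift :: "int \<Rightarrow> complex poly \<Rightarrow> complex poly" where
  "shift l p = pcompose p [:of_int l, 1:]"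

lemma shift_0 [simp]: "shift l 0 = 0"
  and shift_1 [simp]: "shift l 1 = 1"
  and shift_const [simp]: "shift l [:c:] = [:c:]"
  and shift_add: "shift l (p + q) = shift l p + shift l q"
  and shift_mult: "shift l (p * q) = shift l p * shift l q"
  and shift_zero [simp]: "shift 0 p = p"
  by (simp_all add: shift_def pcompose_add pcompose_mult pcompose_1)

lemma shift_shift: "shift l (shift k p) = shift (k + l) p"
  by (simp add: shift_def pcompose_pCons add.commute flip: pcompose_assoc)

lemma poly_shift [simp]: "poly (shift l p) z = poly p (z + of_int l)"
  by (simp add: shift_def poly_pcompose add.commute)

lemma degree_shift [simp]: "degree (shift l p) = degree p"
  by (simp add: shift_def degree_pcompose)

text \<open>An element is a finite sum of terms T^k p(theta) with the power of T on the left and p =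
  \<open>coef a k\<close>. Moving T^l leftwards past p(theta) produces p(theta + l), which is the
  \<open>shift\<close> in the product.\<close>

typedef skew = "{f :: int \<Rightarrow> complex poly. finite {k. f k \<noteq> 0}}"
  morphisms coef Abs_skew
  by (intro exI[of _ "\<lambda>_. 0"]) simp

lemma finite_coef [simp]: "finite {k. coef a k \<noteq> 0}"
  using coef[of a] by simp

lemma skew_eqI: "(\<And>k. coef a k = coef b k) \<Longrightarrow> a = b"
  by (metis coef_inject ext)

lemma coef_Abs_skew: "finite {k. f k \<noteq> 0} \<Longrightarrow> coef (Abs_skew f) = f"
  by (simp add: Abs_skew_inverse)

instantiation skew :: ab_group_add
begin

definition zero_skew :: skew where "0 = Abs_skew (\<lambda>_. 0)"
definition plus_skew :: "skew \<Rightarrow> skew \<Rightarrow> skew" where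
  "a + b = Abs_skew (\<lambda>k. coef a k + coef b k)"
definition minus_skew :: "skew \<Rightarrow> skew \<Rightarrow> skew" where
  "a - b = Abs_skew (\<lambda>k. coef a k - coef b k)"
definition uminus_skew :: "skew \<Rightarrow> skew" where
  "- a = Abs_skew (\<lambda>k. - coef a k)"

lemma coef_0 [simp]: "coef 0 k = 0"
  by (simp add: zero_skew_def coef_Abs_skew)

lemma coef_add [simp]: "coef (a + b) k = coef a k + coef b k"
proof -
  have "finite {k. coef a k + coef b k \<noteq> 0}"
    by (rule finite_subset[of _ "{k. coef a k \<noteq> 0} \<union> {k. coef b k \<noteq> 0}"]) auto
  then show ?thesis by (simp add: plus_skew_def coef_Abs_skew)
qed

lemma coef_minus [simp]: "coef (a - b) k = coef a k - coef b k"
proof -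
  have "finite {k. coef a k - coef b k \<noteq> 0}"
    by (rule finite_subset[of _ "{k. coef a k \<noteq> 0} \<union> {k. coef b k \<noteq> 0}"]) auto
  then show ?thesis by (simp add: minus_skew_def coef_Abs_skew)
qed

lemma coef_uminus [simp]: "coef (- a) k = - coef a k"
  by (simp add: uminus_skew_def coef_Abs_skew)

instance
  by standard (auto intro!: skew_eqI)

end

lemma coef_sum: "coef (sum f A) k = (\<Sum>x\<in>A. coef (f x) k)"
  by (induction A rule: infinite_finite_induct) auto

definition tmon :: "int \<Rightarrow> complex poly \<Rightarrow> skew" where
  "tmon k p = Abs_skew (\<lambda>n. if n = k then p else 0)"

lemma coef_tmon: "coef (tmon k p) n = (if n = k then p else 0)"
  by (simp add: tmon_def coef_Abs_skew)

lemma tmon_0 [simp]: "tmon k 0 = 0"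
  by (rule skew_eqI) (simp add: coef_tmon)

lemma tmon_add: "tmon k (p + q) = tmon k p + tmon k q"
  and tmon_diff: "tmon k (p - q) = tmon k p - tmon k q"
  and tmon_uminus: "tmon k (- p) = - tmon k p"
  by (rule skew_eqI; simp add: coef_tmon)+

lemma tmon_eq_iff: "tmon k p = tmon k q \<longleftrightarrow> p = q"
  by (metis coef_tmon)

lemma tmon_eq_0_iff: "tmon k p = 0 \<longleftrightarrow> p = 0"
  by (metis tmon_0 tmon_eq_iff)

lemma skew_expand: "a = (\<Sum>k | coef a k \<noteq> 0. tmon k (coef a k))"
proof (rule skew_eqI)
  fix n
  have "coef (\<Sum>k | coef a k \<noteq> 0. tmon k (coef a k)) n
    = (\<Sum>k | coef a k \<noteq> 0. if k = n then coef a k else 0)"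
    unfolding coef_sum by (rule sum.cong) (auto simp: coef_tmon)
  also have "\<dots> = coef a n" by (simp add: sum.delta)
  finally show "coef a n = coef (\<Sum>k | coef a k \<noteq> 0. tmon k (coef a k)) n" by simp
qed

lemma skew_induct [case_names tmon add]:
  assumes "\<And>k p. P (tmon k p)" and "\<And>a b. P a \<Longrightarrow> P b \<Longrightarrow> P (a + b)"
  shows "P a"
proof -
  have "P (\<Sum>k\<in>A. tmon k (coef a k))" if "finite A" for A
    using that
  proof induction
    case empty
    show ?case using assms(1)[of 0 0] by simp
  next
    case (insert x F)
    then show ?case using assms by simp
  qed
  then show ?thesis using skew_expand[of a] finite_coef[of a] by metis
qed

instantiation skew :: ring_1
begin

definition one_skew :: skew where "1 = tmon 0 1"

definition times_skew :: "skew \<Rightarrow> skew \<Rightarrow> skew" where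
  "a * b = (\<Sum>k | coef a k \<noteq> 0. \<Sum>l | coef b l \<noteq> 0. tmon (k + l) (shift l (coef a k) * coef b l))"

text \<open>Allows products with different supports to be expanded over a common index set, so that
  distributivity becomes termwise.\<close>

lemma times_superset:
  assumes "finite A" "{k. coef a k \<noteq> 0} \<subseteq> A" "finite B" "{k. coef b k \<noteq> 0} \<subseteq> B"
  shows "a * b = (\<Sum>k\<in>A. \<Sum>l\<in>B. tmon (k + l) (shift l (coef a k) * coef b l))"
proof -
  have "(\<Sum>l | coef b l \<noteq> 0. tmon (k + l) (shift l (coef a k) * coef b l))
      = (\<Sum>l\<in>B. tmon (k + l) (shift l (coef a k) * coef b l))" for k
    by (rule sum.mono_neutral_left) (use assms in auto)
  then have "a * b = (\<Sum>k | coef a k \<noteq> 0. \<Sum>l\<in>B. tmon (k + l) (shift l (coef a k) * coef b l))"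
    by (simp add: times_skew_def)
  also have "\<dots> = (\<Sum>k\<in>A. \<Sum>l\<in>B. tmon (k + l) (shift l (coef a k) * coef b l))"
    by (rule sum.mono_neutral_left) (use assms in auto)
  finally show ?thesis .
qed

lemma tmon_mult: "tmon k p * tmon l q = tmon (k + l) (shift l p * q)"
  by (subst times_superset[of "{k}" _ "{l}"]) (auto simp: coef_tmon)

lemma skew_distrib_right: "(a + b) * c = a * c + b * (c :: skew)"
proof -
  let ?A = "{k. coef a k \<noteq> 0} \<union> {k. coef b k \<noteq> 0}"
  let ?C = "{k. coef c k \<noteq> 0}"
  have "(a + b) * c = (\<Sum>k\<in>?A. \<Sum>l\<in>?C. tmon (k + l) (shift l (coef (a + b) k) * coef c l))"
    by (rule times_superset) auto
  moreover have "a * c = (\<Sum>k\<in>?A. \<Sum>l\<in>?C. tmon (k + l) (shift l (coef a k) * coef c l))"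
    by (rule times_superset) auto
  moreover have "b * c = (\<Sum>k\<in>?A. \<Sum>l\<in>?C. tmon (k + l) (shift l (coef b k) * coef c l))"
    by (rule times_superset) auto
  ultimately show ?thesis
    by (simp add: shift_add tmon_add sum.distrib algebra_simps)
qed

lemma skew_distrib_left: "c * (a + b) = c * a + c * (b :: skew)"
proof -
  let ?A = "{k. coef a k \<noteq> 0} \<union> {k. coef b k \<noteq> 0}"
  let ?C = "{k. coef c k \<noteq> 0}"
  have "c * (a + b) = (\<Sum>k\<in>?C. \<Sum>l\<in>?A. tmon (k + l) (shift l (coef c k) * coef (a + b) l))"
    by (rule times_superset) auto
  moreover have "c * a = (\<Sum>k\<in>?C. \<Sum>l\<in>?A. tmon (k + l) (shift l (coef c k) * coef a l))"
    by (rule times_superset) auto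
  moreover have "c * b = (\<Sum>k\<in>?C. \<Sum>l\<in>?A. tmon (k + l) (shift l (coef c k) * coef b l))"
    by (rule times_superset) auto
  ultimately show ?thesis
    by (simp add: tmon_add sum.distrib algebra_simps)
qed

instance
proof
  fix a b c :: skew
  show "a * b * c = a * (b * c)"
  proof (induction a rule: skew_induct)
    case (tmon k p)
    show ?case
    proof (induction b rule: skew_induct)
      case (tmon l q)
      show ?case
        by (induction c rule: skew_induct)
          (simp_all add: tmon_mult shift_mult shift_shift skew_distrib_left ac_simps)
    qed (simp add: skew_distrib_left skew_distrib_right)
  qed (simp add: skew_distrib_right)
  show "1 * a = a"
    by (induction a rule: skew_induct) (simp_all add: one_skew_def tmon_mult skew_distrib_left)
  show "a * 1 = a"
    by (induction a rule: skew_induct) (simp_all add: one_skew_def tmon_mult skew_distrib_right)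
  show "(0 :: skew) \<noteq> 1"
    by (metis one_skew_def tmon_eq_0_iff zero_neq_one)
qed (rule skew_distrib_right skew_distrib_left)+

end

lemma coef_mult_tmon_left: "coef (tmon k p * a) n = shift (n - k) p * coef a (n - k)"
  by (induction a rule: skew_induct) (auto simp: tmon_mult coef_tmon algebra_simps)

lemma coef_mult_tmon_right: "coef (a * tmon l q) n = shift l (coef a (n - l)) * q"
  by (induction a rule: skew_induct) (auto simp: tmon_mult coef_tmon shift_add algebra_simps)

definition cst :: "complex \<Rightarrow> skew" where "cst c = tmon 0 [:c:]"

lemma coef_cst_mult [simp]: "coef (cst c * a) n = smult c (coef a n)"
  by (simp add: cst_def coef_mult_tmon_left)

lemma cst_commute: "a * cst c = cst c * a"
  by (rule skew_eqI) (simp add: cst_def coef_mult_tmon_left coef_mult_tmon_right mult.commute)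

lemma cst_0 [simp]: "cst 0 = 0" and cst_1 [simp]: "cst 1 = 1"
  by (simp_all add: cst_def one_skew_def pCons_one)

lemma cst_add: "cst (c + d) = cst c + cst d"
  and cst_uminus: "cst (- c) = - cst c"
  and cst_mult: "cst (c * d) = cst c * cst d"
  by (simp_all add: cst_def tmon_mult mult.commute flip: tmon_add tmon_uminus)

lemma cst_tmon: "cst c * tmon k p = tmon k (smult c p)"
  by (rule skew_eqI) (simp add: coef_tmon)

lemma cst_left_commute: "a * (cst c * b) = cst c * (a * b)"
  by (metis cst_commute mult.assoc)

lemma cst_numeral: "cst (numeral n) = numeral n"
  by (induction n) (simp_all only: numeral.simps cst_add cst_1)

definition com :: "'a::ring_1 \<Rightarrow> 'a \<Rightarrow> 'a" where "com a b = a * b - b * a"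

lemma com_tmon: "com (tmon k p) (tmon l q) = tmon (k + l) (shift l p * q - shift k q * p)"
  by (simp add: com_def tmon_mult tmon_diff add.commute)

lemma com_add_left: "com (a + b) c = com a c + com b c"
  and com_add_right: "com c (a + b) = com c a + com c b"
  and com_0_left [simp]: "com 0 a = 0" and com_0_right [simp]: "com a 0 = 0"
  by (simp_all add: com_def algebra_simps)

lemma com_cst_left: "com (cst c * a) b = cst c * com a b"
  and com_cst_right: "com a (cst c * b) = cst c * com a b"
  by (simp_all add: com_def right_diff_distrib cst_left_commute mult.assoc)

lemma coef_com_tmon_left:
  "coef (com (tmon k p) a) n = shift (n - k) p * coef a (n - k) - shift k (coef a (n - k)) * p"
  by (simp add: com_def coef_mult_tmon_left coef_mult_tmon_right)

section \<open>Weight filtrations and symbols\<close>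

definition wle :: "real \<Rightarrow> real \<Rightarrow> skew \<Rightarrow> bool" where
  "wle \<alpha> d a \<longleftrightarrow> (\<forall>k j. coeff (coef a k) j \<noteq> 0 \<longrightarrow> \<alpha> * of_int k + of_nat j \<le> d)"

text \<open>For \<alpha> nonzero the equation \<alpha> k + j = d determines k from j, so setting T =
  1 loses nothing. A non-integral solution k contributes the coefficient 0.\<close>

definition symb :: "real \<Rightarrow> real \<Rightarrow> skew \<Rightarrow> complex poly" where
  "symb \<alpha> d a = Abs_poly (\<lambda>j. let z = (d - of_nat j) / \<alpha> in
     if z \<in> \<int> then coeff (coef a \<lfloor>z\<rfloor>) j else 0)"

lemma degree_coef_bounded: "\<exists>N. \<forall>k. degree (coef a k) \<le> N"
proof -
  have "finite ((\<lambda>k. degree (coef a k)) ` {k. coef a k \<noteq> 0})" by simp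
  then obtain N where "\<forall>n\<in>(\<lambda>k. degree (coef a k)) ` {k. coef a k \<noteq> 0}. n \<le> N"
    using finite_nat_set_iff_bounded_le by blast
  then have "degree (coef a k) \<le> N" for k
    by (cases "coef a k = 0") auto
  then show ?thesis by blast
qed

lemma coeff_symb_raw:
  "coeff (symb \<alpha> d a) j = (let z = (d - of_nat j) / \<alpha> in
     if z \<in> \<int> then coeff (coef a \<lfloor>z\<rfloor>) j else 0)"
proof -
  obtain N where N: "\<And>k. degree (coef a k) \<le> N" using degree_coef_bounded by blast
  have "coeff (symb \<alpha> d a) = (\<lambda>j. let z = (d - of_nat j) / \<alpha> in
     if z \<in> \<int> then coeff (coef a \<lfloor>z\<rfloor>) j else 0)"
    unfolding symb_def
  proof (rule coeff_Abs_poly)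
    fix i assume "i > N"
    then have "coeff (coef a k) i = 0" for k using N[of k] by (intro coeff_eq_0) linarith
    then show "(let z = (d - of_nat i) / \<alpha> in
      if z \<in> \<int> then coeff (coef a \<lfloor>z\<rfloor>) i else 0) = 0" by (simp add: Let_def)
  qed
  then show ?thesis by simp
qed

lemma coeff_symb:
  assumes "\<alpha> \<noteq> 0" "\<alpha> * of_int k + of_nat j = d"
  shows "coeff (symb \<alpha> d a) j = coeff (coef a k) j"
proof -
  have "(d - of_nat j) / \<alpha> = of_int k" using assms by (auto simp: field_simps)
  then show ?thesis by (simp add: coeff_symb_raw Let_def)
qed

lemma coeff_symb_nonzeroD:
  assumes "\<alpha> \<noteq> 0" "coeff (symb \<alpha> d a) j \<noteq> 0"
  obtains k where "\<alpha> * of_int k + of_nat j = d" "coeff (coef a k) j \<noteq> 0"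
proof -
  let ?z = "(d - of_nat j) / \<alpha>"
  have z: "?z \<in> \<int>" "coeff (coef a \<lfloor>?z\<rfloor>) j \<noteq> 0"
    using assms(2) by (auto simp: coeff_symb_raw Let_def split: if_splits)
  from z(1) obtain n where n: "?z = of_int n" by (rule Ints_cases)
  then have "d - of_nat j = \<alpha> * of_int n" using assms(1) by (simp add: field_simps)
  then show ?thesis using that[of n] z(2) n by simp
qed

lemma symb_0 [simp]: "symb \<alpha> d 0 = 0"
  by (rule poly_eqI) (simp add: coeff_symb_raw Let_def)

lemma symb_add: "symb \<alpha> d (a + b) = symb \<alpha> d a + symb \<alpha> d b"
  by (rule poly_eqI) (simp add: coeff_symb_raw Let_def)

lemma wle_0 [simp]: "wle \<alpha> d 0"
  by (simp add: wle_def)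

lemma wle_add: "wle \<alpha> d a \<Longrightarrow> wle \<alpha> d b \<Longrightarrow> wle \<alpha> d (a + b)"
  unfolding wle_def by (metis add_0 coef_add coeff_add)

lemma wle_tmon_monom: "wle \<alpha> d (tmon k (monom c i)) \<longleftrightarrow> c = 0 \<or> \<alpha> * of_int k + of_nat i \<le> d"
  by (auto simp: wle_def coef_tmon)

lemma coeff_symb_tmon:
  assumes "\<alpha> \<noteq> 0"
  shows "coeff (symb \<alpha> d (tmon k p)) j = (if \<alpha> * of_int k + of_nat j = d then coeff p j else 0)"
proof (cases "\<alpha> * of_int k + of_nat j = d")
  case True
  then show ?thesis by (simp add: coeff_symb[OF assms True] coef_tmon)
next
  case False
  have "coeff (symb \<alpha> d (tmon k p)) j = 0"
  proof (rule ccontr)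
    assume "coeff (symb \<alpha> d (tmon k p)) j \<noteq> 0"
    then obtain l where "\<alpha> * of_int l + of_nat j = d" "coeff (coef (tmon k p) l) j \<noteq> 0"
      using coeff_symb_nonzeroD assms by blast
    then show False using False by (auto simp: coef_tmon split: if_splits)
  qed
  then show ?thesis using False by simp
qed

lemma symb_tmon_monom:
  assumes "\<alpha> \<noteq> 0"
  shows "symb \<alpha> d (tmon k (monom c i)) = (if \<alpha> * of_int k + of_nat i = d then monom c i else 0)"
  by (rule poly_eqI) (auto simp: coeff_symb_tmon[OF assms])

text \<open>Reduces additive statements about filtered elements to monomials that already satisfy
  the weight bound.\<close>

lemma wle_induct [consumes 1, case_names monom add]:
  assumes "wle \<alpha> d a"
    and tmon: "\<And>k i c. \<alpha> * of_int k + of_nat i \<le> d \<Longrightarrow> P (tmon k (monom c i))"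
    and add: "\<And>a b. P a \<Longrightarrow> P b \<Longrightarrow> P (a + b)"
    and zero: "P 0"
  shows "P a"
proof -
  have sums: "P (sum f A)" if "\<And>x. x \<in> A \<Longrightarrow> P (f x)" for f and A :: "'b set"
    using that by (induction A rule: infinite_finite_induct) (auto intro: add zero)
  have tsum: "tmon k (sum g A) = (\<Sum>i\<in>A. tmon k (g i))" for k g and A :: "nat set"
    by (induction A rule: infinite_finite_induct) (auto simp: tmon_add)
  have "P (tmon k (coef a k))" for k
  proof -
    have "tmon k (coef a k) = (\<Sum>i\<le>degree (coef a k). tmon k (monom (coeff (coef a k) i) i))"
      by (metis poly_as_sum_of_monoms tsum)
    moreover have "P (tmon k (monom (coeff (coef a k) i) i))" for i
      using assms(1) by (cases "coeff (coef a k) i = 0") (auto simp: wle_def zero intro: tmon)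
    ultimately show ?thesis using sums[of "{..degree (coef a k)}"] by simp
  qed
  then have "P (\<Sum>k | coef a k \<noteq> 0. tmon k (coef a k))" by (intro sums)
  then show ?thesis unfolding skew_expand[of a, symmetric] .
qed

lemma coeff_shift_monom:
  "n > i \<Longrightarrow> coeff (shift l (monom c i)) n = 0"
  "coeff (shift l (monom c i)) i = c"
  "Suc n = i \<Longrightarrow> coeff (shift l (monom c i)) n = c * of_nat i * of_int l"
proof -
  have "pcompose ([:0, 1:] ^ i) [:of_int l, 1:] = [:of_int l, 1 :: complex:] ^ i"
    by (induction i) (simp_all add: pcompose_mult pcompose_pCons pcompose_1)
  then have *: "shift l (monom c i) = smult c ([:of_int l, 1:] ^ i)"
    by (simp add: shift_def monom_altdef pcompose_smult)
  show "n > i \<Longrightarrow> coeff (shift l (monom c i)) n = 0"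
    "coeff (shift l (monom c i)) i = c"
    "Suc n = i \<Longrightarrow> coeff (shift l (monom c i)) n = c * of_nat i * of_int l"
    unfolding * by (auto simp: coeff_linear_poly_power coeff_eq_0 degree_linear_power)
qed

text \<open>The terms theta^(i+j) of the two products cancel. The next coefficient comes from the
  linear terms in the shifts: (theta + l)^i contributes i l and (theta + k)^j contributes j
  k.\<close>

lemma coeff_com_monom:
  defines "R \<equiv> \<lambda>k l c i c' j. shift l (monom c i) * monom c' j - shift k (monom c' j) * monom c i"
  shows "n \<ge> i + j \<Longrightarrow> coeff (R k l c i c' j) n = 0"
    and "Suc n = i + j \<Longrightarrow> coeff (R k l c i c' j) n = c * c' * (of_int l * of_nat i - of_int k * of_nat j)"
proof -
  have R: "coeff (R k l c i c' j) n = (if n < j then 0 else c' * coeff (shift l (monom c i)) (n - j))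
      - (if n < i then 0 else c * coeff (shift k (monom c' j)) (n - i))" for n
    unfolding R_def by (simp add: coeff_monom_mult mult.commute[of "shift _ _"])
  show "coeff (R k l c i c' j) n = 0" if "n \<ge> i + j"
    using that by (cases "n = i + j") (simp_all add: R coeff_shift_monom)
  show "coeff (R k l c i c' j) n = c * c' * (of_int l * of_nat i - of_int k * of_nat j)" if "Suc n = i + j"
  proof -
    have 1: "(if n < j then 0 else c' * coeff (shift l (monom c i)) (n - j)) = c * c' * of_int l * of_nat i"
    proof (cases i)
      case 0
      then show ?thesis using that by simp
    next
      case (Suc i')
      then show ?thesis using that coeff_shift_monom(3)[of "n - j" i l c] by simp
    qed
    have 2: "(if n < i then 0 else c * coeff (shift k (monom c' j)) (n - i)) = c * c' * of_int k * of_nat j"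
    proof (cases j)
      case 0
      then show ?thesis using that by simp
    next
      case (Suc j')
      then show ?thesis using that coeff_shift_monom(3)[of "n - i" j k c'] by simp
    qed
    show ?thesis unfolding R 1 2 by (simp add: algebra_simps)
  qed
qed

text \<open>For monomials of exact weights d and e, inserting \<alpha> k = d - i and \<alpha> l = e
  - j into l i - k j gives (e i - d j) / \<alpha>. The exponents of T have disappeared, so the
  result depends on the symbols alone.\<close>

lemma com_symbol:
  assumes "\<alpha> \<noteq> 0" "wle \<alpha> d a" "wle \<alpha> e b"
  shows "wle \<alpha> (d + e - 1) (com a b) \<and>
    symb \<alpha> (d + e - 1) (com a b) = smult (of_real (1 / \<alpha>))
      (smult (of_real e) (pderiv (symb \<alpha> d a) * symb \<alpha> e b)
        - smult (of_real d) (symb \<alpha> d a * pderiv (symb \<alpha> e b)))"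
    (is "?P a b")
  using assms(2)
proof (induction a rule: wle_induct)
  case (monom k i c)
  note ki = this
  from assms(3) show ?case
  proof (induction b rule: wle_induct)
    case (monom l j c')
    note lj = this
    let ?R = "shift l (monom c i) * monom c' j - shift k (monom c' j) * monom c i"
    have com: "com (tmon k (monom c i)) (tmon l (monom c' j)) = tmon (k + l) ?R"
      by (simp add: com_tmon)
    have le: "Suc n \<le> i + j" if "coeff ?R n \<noteq> 0" for n
      using coeff_com_monom(1)[of i j n l c c' k] that by linarith
    have wle: "wle \<alpha> (d + e - 1) (tmon (k + l) ?R)"
      unfolding wle_def
    proof (intro allI impI)
      fix k' n assume "coeff (coef (tmon (k + l) ?R) k') n \<noteq> 0"
      then have "k' = k + l" "Suc n \<le> i + j" using le by (auto simp: coef_tmon split: if_splits)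
      then have "real n + 1 \<le> real i + real j" "real_of_int k' = real_of_int k + real_of_int l" by linarith+
      then show "\<alpha> * of_int k' + of_nat n \<le> d + e - 1"
        using ki lj by (simp add: algebra_simps)
    qed
    have sym: "symb \<alpha> (d + e - 1) (tmon (k + l) ?R) = (if \<alpha> * of_int k + of_nat i = d \<and> \<alpha> * of_int l + of_nat j = e
         then monom (c * c' * (of_int l * of_nat i - of_int k * of_nat j)) (i + j - 1) else 0)"
    proof (rule poly_eqI)
      fix n
      let ?s = "symb \<alpha> (d + e - 1) (tmon (k + l) ?R)"
      have coeffs: "coeff ?s n = (if \<alpha> * of_int (k + l) + of_nat n = d + e - 1 then coeff ?R n else 0)"
        by (rule coeff_symb_tmon[OF assms(1)])
      show "coeff ?s n = coeff (if \<alpha> * of_int k + of_nat i = d \<and> \<alpha> * of_int l + of_nat j = e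
         then monom (c * c' * (of_int l * of_nat i - of_int k * of_nat j)) (i + j - 1) else 0) n"
      proof (cases "coeff ?R n = 0")
        case True
        then have "c * c' * (of_int l * of_nat i - of_int k * of_nat j) = 0" if "Suc n = i + j"
          using coeff_com_monom(2)[OF that, of l c c' k] by simp
        moreover have "of_int l * of_nat i - of_int k * of_nat j = (0::complex)" if "i + j = 0"
          using that by simp
        ultimately show ?thesis using True unfolding coeffs
          by (cases "i + j") auto
      next
        case False
        have n: "Suc n \<le> i + j" using le False by blast
        show ?thesis
        proof (cases "Suc n = i + j")
          case True
          \<comment> \<open>Each weight is at most its bound, so the sum attains d + e only if both
            do.\<close>
          have "(\<alpha> * of_int (k + l) + of_nat n = d + e - 1) \<longleftrightarrow> \<alpha> * of_int k + of_nat i = d \<and> \<alpha> * of_int l + of_nat j = e"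
          proof -
            have "real n = real i + real j - 1" using True by linarith
            then show ?thesis using ki lj by (auto simp: algebra_simps)
          qed
          then show ?thesis unfolding coeffs
            using coeff_com_monom(2)[OF True, of l c c' k] True by auto
        next
          case False
          then have "real n < real i + real j - 1" using n by linarith
          then have "\<alpha> * of_int (k + l) + of_nat n < d + e - 1" using ki lj by (simp add: algebra_simps)
          moreover have "n \<noteq> i + j - 1" using False n by linarith
          ultimately show ?thesis unfolding coeffs by auto
        qed
      qed
    qed
    have "symb \<alpha> (d + e - 1) (tmon (k + l) ?R) = smult (of_real (1 / \<alpha>))
      (smult (of_real e) (pderiv (symb \<alpha> d (tmon k (monom c i))) * symb \<alpha> e (tmon l (monom c' j)))
        - smult (of_real d) (symb \<alpha> d (tmon k (monom c i)) * pderiv (symb \<alpha> e (tmon l (monom c' j)))))"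
    proof (cases "\<alpha> * of_int k + of_nat i = d \<and> \<alpha> * of_int l + of_nat j = e")
      case True
      then have de: "complex_of_real d = of_real \<alpha> * of_int k + of_nat i" "complex_of_real e = of_real \<alpha> * of_int l + of_nat j"
        by (metis of_real_add of_real_mult of_real_of_int_eq of_real_of_nat_eq)+
      have "monom (c * c' * (of_int l * of_nat i - of_int k * of_nat j)) (i + j - 1) =
        smult (of_real (1 / \<alpha>)) (smult (of_real e) (pderiv (monom c i) * monom c' j)
        - smult (of_real d) (monom c i * pderiv (monom c' j)))"
      proof -
        have "smult (of_real e) (pderiv (monom c i) * monom c' j) = monom (of_real e * of_nat i * c * c') (i + j - 1)"
          by (cases i) (simp_all add: pderiv_monom mult_monom smult_monom algebra_simps)
        moreover have "smult (of_real d) (monom c i * pderiv (monom c' j)) = monom (of_real d * of_nat j * c * c') (i + j - 1)"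
          by (cases j) (simp_all add: pderiv_monom mult_monom smult_monom algebra_simps)
        ultimately show ?thesis using assms(1) unfolding de
          by (simp only: diff_monom smult_monom) (simp add: field_simps)
      qed
      then show ?thesis unfolding sym using True by (simp add: symb_tmon_monom[OF assms(1)])
    next
      case False
      then show ?thesis unfolding sym by (auto simp: symb_tmon_monom[OF assms(1)])
    qed
    then show ?case using wle by (simp add: com)
  next
    case (add a b)
    then show ?case
      by (simp add: com_add_right symb_add wle_add pderiv_add distrib_left smult_add_right smult_diff_right)
  qed simp
next
  case (add a b)
  then show ?case
    by (simp add: com_add_left symb_add wle_add pderiv_add distrib_right smult_add_right smult_diff_right)
qed simp

text \<open>Moving T^l past theta^i changes only lower powers of theta, so leading forms multiply as
  in a commutative ring.\<close>

lemma mult_symbol: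
  assumes "\<alpha> \<noteq> 0" "wle \<alpha> d a" "wle \<alpha> e b"
  shows "wle \<alpha> (d + e) (a * b) \<and> symb \<alpha> (d + e) (a * b) = symb \<alpha> d a * symb \<alpha> e b"
  using assms(2)
proof (induction a rule: wle_induct)
  case (monom k i c)
  note ki = this
  from assms(3) show ?case
  proof (induction b rule: wle_induct)
    case (monom l j c')
    note lj = this
    let ?R = "shift l (monom c i) * monom c' j"
    have R: "coeff ?R n = (if n < j then 0 else c' * coeff (shift l (monom c i)) (n - j))" for n
      by (simp add: coeff_monom_mult mult.commute[of "shift _ _"])
    have le: "n \<le> i + j" if "coeff ?R n \<noteq> 0" for n
    proof (rule ccontr)
      assume "\<not> n \<le> i + j"
      then have "i < n - j" by linarith
      then show False using that by (simp add: R coeff_shift_monom split: if_splits)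
    qed
    have top: "coeff ?R (i + j) = c * c'"
      by (simp add: R coeff_shift_monom)
    have wle: "wle \<alpha> (d + e) (tmon (k + l) ?R)"
      unfolding wle_def
    proof (intro allI impI)
      fix k' n assume "coeff (coef (tmon (k + l) ?R) k') n \<noteq> 0"
      then have "k' = k + l" "n \<le> i + j" using le by (auto simp: coef_tmon split: if_splits)
      then have "real n \<le> real i + real j" "real_of_int k' = real_of_int k + real_of_int l" by linarith+
      then show "\<alpha> * of_int k' + of_nat n \<le> d + e"
        using ki lj by (simp add: algebra_simps)
    qed
    have "symb \<alpha> (d + e) (tmon (k + l) ?R) = (if \<alpha> * of_int k + of_nat i = d \<and> \<alpha> * of_int l + of_nat j = e
         then monom (c * c') (i + j) else 0)"
    proof (rule poly_eqI)
      fix n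
      show "coeff (symb \<alpha> (d + e) (tmon (k + l) ?R)) n
        = coeff (if \<alpha> * of_int k + of_nat i = d \<and> \<alpha> * of_int l + of_nat j = e
         then monom (c * c') (i + j) else 0) n"
      proof (cases "n = i + j")
        case True
        have "(\<alpha> * of_int (k + l) + of_nat n = d + e) \<longleftrightarrow> \<alpha> * of_int k + of_nat i = d \<and> \<alpha> * of_int l + of_nat j = e"
          using ki lj True by (auto simp: algebra_simps)
        then show ?thesis using top True by (auto simp: coeff_symb_tmon[OF assms(1)])
      next
        case False
        have "\<alpha> * of_int (k + l) + of_nat n < d + e" if "coeff ?R n \<noteq> 0"
        proof -
          have "real n < real i + real j" using le[OF that] False by linarith
          then show ?thesis using ki lj by (simp add: algebra_simps)
        qed
        then show ?thesis using False
          by (cases "coeff ?R n = 0") (auto simp: coeff_symb_tmon[OF assms(1)])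
      qed
    qed
    then show ?case using wle by (simp add: tmon_mult symb_tmon_monom[OF assms(1)] mult_monom)
  next
    case (add a b)
    then show ?case by (simp add: distrib_left symb_add wle_add)
  qed simp
next
  case (add a b)
  then show ?case by (simp add: distrib_right symb_add wle_add)
qed simp

section \<open>Non-vanishing of iterated brackets detected on symbols\<close>

lemma com_iterates_nonzero:
  assumes "\<alpha> \<noteq> 0" "wle \<alpha> d a" "wle \<alpha> e b"
    and step: "\<And>n Q. I n Q \<Longrightarrow> I (Suc n) (smult (of_real (1 / \<alpha>))
        (smult (of_real (e + real n * (d - 1))) (pderiv (symb \<alpha> d a) * Q)
        - smult (of_real d) (symb \<alpha> d a * pderiv Q)))"
    and init: "I 0 (symb \<alpha> e b)"
    and nonzero: "\<And>n Q. I n Q \<Longrightarrow> Q \<noteq> 0"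
  shows "(com a ^^ n) b \<noteq> 0"
proof -
  \<comment> \<open>Every bracket raises the weight bound by d - 1. The invariant \<open>I\<close>
    guarantees that the symbol at this bound is nonzero.\<close>
  have "wle \<alpha> (e + real n * (d - 1)) ((com a ^^ n) b) \<and>
    I n (symb \<alpha> (e + real n * (d - 1)) ((com a ^^ n) b))"
  proof (induction n)
    case 0
    then show ?case using assms by simp
  next
    case (Suc n)
    have "d + (e + real n * (d - 1)) - 1 = e + real (Suc n) * (d - 1)" by (simp add: algebra_simps)
    note com = com_symbol[OF assms(1,2), of "e + real n * (d - 1)" "(com a ^^ n) b", unfolded this]
    have "(com a ^^ Suc n) b = com a ((com a ^^ n) b)" by simp
    then show ?case using com Suc step[of n] by metis
  qed
  then show ?thesis using nonzero by fastforce
qed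

text \<open>Starting from X, every bracket raises the order of the symbol at z by exactly
  \<open>e'\<close>, one less than the order of the symbol of \<open>a\<close>. The new lowest
  coefficient carries the factor w (e' + 1) - d n e' = \<alpha> (e' + 1) + n (d - e' - 1), positive
  as long as the order is at most d.\<close>

lemma com_iterates_nonzero_root:
  assumes \<alpha>: "\<alpha> > 0" and a: "wle \<alpha> d a" and P: "symb \<alpha> d a \<noteq> 0"
    and e: "order z (symb \<alpha> d a) \<noteq> 0" "real (order z (symb \<alpha> d a)) \<le> d"
  shows "(com a ^^ n) (tmon 1 1) \<noteq> 0"
proof -
  define L where "L = [:- z, 1:]"
  define P where "P = symb \<alpha> d a"
  obtain e' where e': "order z P = Suc e'" using e(1) not0_implies_Suc P_def by metis
  obtain U where U: "P = L ^ Suc e' * U" "\<not> L dvd U"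
    using order_decomp[of P z] P e' unfolding L_def P_def by metis
  have Uz: "poly U z \<noteq> 0" using U(2) by (simp add: L_def poly_eq_0_iff_dvd)
  have L': "pderiv L = 1" by (simp add: L_def pderiv_pCons pCons_one)
  \<comment> \<open>The extra factor \<open>L\<close> avoids the exponent i - 1, so that i = 0 is no
    exception.\<close>
  have LL: "L * pderiv (L ^ i) = smult (of_nat i) (L ^ i)" for i
    by (cases i) (simp_all add: pderiv_power_Suc L' del: power_Suc, simp)
  define I where "I n Q \<longleftrightarrow> (\<exists>R. Q = L ^ (n * e') * R \<and> poly R z \<noteq> 0)" for n Q
  show ?thesis
  proof (rule com_iterates_nonzero[where I = I and \<alpha> = \<alpha> and d = d and e = \<alpha>])
    show "wle \<alpha> \<alpha> (tmon 1 1)" by (auto simp: wle_def coef_tmon split: if_splits)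
    have "symb \<alpha> \<alpha> (tmon 1 1) = 1"
      using symb_tmon_monom[of \<alpha> \<alpha> 1 1 0] \<alpha> by (simp add: monom_0 pCons_one)
    then show "I 0 (symb \<alpha> \<alpha> (tmon 1 1))" by (auto simp: I_def)
    show "Q \<noteq> 0" if "I n Q" for n Q using that by (auto simp: I_def L_def)
    fix n Q assume "I n Q"
    then obtain R where R: "Q = L ^ (n * e') * R" "poly R z \<noteq> 0" by (auto simp: I_def)
    define w where "w = \<alpha> + real n * (d - 1)"
    define c where "c = complex_of_real (w * real (Suc e') - d * real (n * e'))"
    have pos: "w * real (Suc e') - d * real (n * e') > 0"
    proof -
      have "w * real (Suc e') - d * real (n * e') = \<alpha> * real (Suc e') + real n * (d - real (Suc e'))"
        by (simp add: w_def algebra_simps)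
      moreover have "\<alpha> * real (Suc e') > 0" using \<alpha> by simp
      moreover have "real n * (d - real (Suc e')) \<ge> 0" using e(2) e' by (simp add: P_def)
      ultimately show ?thesis by linarith
    qed
    have "pderiv P * Q = L ^ (Suc n * e') * (smult (of_nat (Suc e')) (U * R) + L * (pderiv U * R))"
    proof -
      have "pderiv P = smult (of_nat (Suc e')) (L ^ e') * U + L ^ Suc e' * pderiv U"
        unfolding U(1) by (simp add: pderiv_mult pderiv_power_Suc L' mult.commute del: power_Suc)
      then show ?thesis unfolding R(1)
        by (simp add: power_add algebra_simps)
    qed
    moreover have "P * pderiv Q = L ^ (Suc n * e') * (smult (of_nat (n * e')) (U * R) + L * (U * pderiv R))"
    proof -
      have "P * pderiv Q = L ^ e' * U * (L * pderiv Q)" unfolding U(1) by (simp add: algebra_simps)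
      also have "L * pderiv Q = L * pderiv (L ^ (n * e')) * R + L * L ^ (n * e') * pderiv R"
        unfolding R(1) by (simp add: pderiv_mult algebra_simps)
      finally show ?thesis unfolding LL
        by (simp add: power_add algebra_simps)
    qed
    ultimately have eq: "smult (of_real (1 / \<alpha>)) (smult (of_real w) (pderiv P * Q) - smult (of_real d) (P * pderiv Q))
      = L ^ (Suc n * e') * smult (of_real (1 / \<alpha>)) (smult (of_real w) (smult (of_nat (Suc e')) (U * R) + L * (pderiv U * R))
         - smult (of_real d) (smult (of_nat (n * e')) (U * R) + L * (U * pderiv R)))"
      (is "_ = _ * ?R")
      by (simp only: mult_smult_right right_diff_distrib)
    have "poly ?R z = of_real (1 / \<alpha>) * (c * poly U z * poly R z)"
      by (simp add: L_def c_def algebra_simps)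
    moreover have "c \<noteq> 0" unfolding c_def of_real_eq_0_iff using pos by linarith
    then have "of_real (1 / \<alpha>) * (c * poly U z * poly R z) \<noteq> 0" using \<alpha> Uz R(2) by simp
    ultimately have "poly ?R z \<noteq> 0" by simp
    with eq show "I (Suc n) (smult (of_real (1 / \<alpha>))
        (smult (of_real (\<alpha> + real n * (d - 1))) (pderiv (symb \<alpha> d a) * Q)
        - smult (of_real d) (symb \<alpha> d a * pderiv Q)))"
      unfolding I_def w_def P_def by blast
  qed (use \<alpha> a in auto)
qed

text \<open>The starting element is modelled on Y. The degree of the symbol begins at 2 and grows by
  exactly J - 1, because the new top coefficient carries the factor w J - d i = -\<alpha> (J + 2k -
  n k). This is nonzero when k < 0 and (k, J) lies strictly above the ray j = -2k.\<close>

lemma com_iterates_nonzero_degree: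
  assumes \<alpha>: "\<alpha> \<noteq> 0" and a: "wle \<alpha> d a" and q: "degree q = 2"
    and J: "degree (symb \<alpha> d a) = J" "symb \<alpha> d a \<noteq> 0" "\<alpha> * of_int k + of_nat J = d"
    and k: "k < 0" "int J + 2 * k > 0"
  shows "(com a ^^ n) (tmon (- 1) q) \<noteq> 0"
proof -
  define P where "P = symb \<alpha> d a"
  have J1: "J \<ge> 1" using k by linarith
  define I where "I n Q \<longleftrightarrow> Q \<noteq> 0 \<and> degree Q = 2 + n * (J - 1)" for n and Q :: "complex poly"
  show ?thesis
  proof (rule com_iterates_nonzero[where I = I and \<alpha> = \<alpha> and d = d and e = "2 - \<alpha>"])
    have "j \<le> 2" if "coeff q j \<noteq> 0" for j using that le_degree q by metis
    then show "wle \<alpha> (2 - \<alpha>) (tmon (- 1) q)"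
      by (fastforce simp: wle_def coef_tmon split: if_splits)
    have "coeff q 2 \<noteq> 0" using q by (metis leading_coeff_0_iff degree_0 zero_neq_numeral)
    then have "symb \<alpha> (2 - \<alpha>) (tmon (- 1) q) = monom (coeff q 2) 2"
      by (intro poly_eqI) (auto simp: coeff_symb_tmon[OF \<alpha>])
    then show "I 0 (symb \<alpha> (2 - \<alpha>) (tmon (- 1) q))"
      using \<open>coeff q 2 \<noteq> 0\<close> by (simp add: I_def degree_monom_eq)
    show "Q \<noteq> 0" if "I n Q" for n Q using that by (simp add: I_def)
    fix n Q assume Q: "I n Q"
    define w where "w = 2 - \<alpha> + real n * (d - 1)"
    define i where "i = 2 + n * (J - 1)"
    let ?N = "smult (of_real (1 / \<alpha>)) (smult (of_real w) (pderiv P * Q) - smult (of_real d) (P * pderiv Q))"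
    have deg: "degree P = J" "degree Q = i" "Q \<noteq> 0" "P \<noteq> 0" using Q J by (auto simp: I_def i_def P_def)
    have "i \<ge> 1" by (simp add: i_def)
    have top1: "coeff (pderiv P * Q) (J - 1 + i) = of_nat J * lead_coeff P * lead_coeff Q"
    proof -
      have "degree (pderiv P) = J - 1" by (simp add: degree_pderiv deg)
      then show ?thesis using coeff_mult_degree_sum[of "pderiv P" Q] J1
        by (simp add: deg coeff_pderiv)
    qed
    have top2: "coeff (P * pderiv Q) (J - 1 + i) = of_nat i * lead_coeff P * lead_coeff Q"
    proof -
      have "coeff (P * pderiv Q) (J + (i - 1)) = coeff P J * coeff (pderiv Q) (i - 1)"
        using coeff_mult_degree_sum[of P "pderiv Q"] by (simp add: deg degree_pderiv)
      also have "coeff (pderiv Q) (i - 1) = of_nat i * coeff Q i"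
        using \<open>i \<ge> 1\<close> by (simp add: coeff_pderiv)
      also have "J + (i - 1) = J - 1 + i" using J1 \<open>i \<ge> 1\<close> by simp
      finally show ?thesis by (simp only: deg mult_ac)
    qed
    have "w * real J - d * real i = - \<alpha> * ((real J + 2 * of_int k) - real n * of_int k)"
    proof -
      have i: "real i = 2 + real n * (real J - 1)" using J1 by (simp add: i_def of_nat_diff)
      show ?thesis unfolding i w_def J(3)[symmetric] by (simp add: algebra_simps)
    qed
    moreover have "(real J + 2 * of_int k) - real n * of_int k > 0"
    proof -
      have "real J + 2 * of_int k > 0" using k(2) by linarith
      moreover have "real n * of_int k \<le> 0" using k(1) by (simp add: mult_nonneg_nonpos)
      ultimately show ?thesis by linarith
    qed
    ultimately have ne: "w * real J - d * real i \<noteq> 0" using \<alpha> by simp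
    define c where "c = complex_of_real (w * real J - d * real i)"
    have "coeff ?N (J - 1 + i) = of_real (1 / \<alpha>) * (c * lead_coeff P * lead_coeff Q)"
      unfolding coeff_smult coeff_diff top1 top2 c_def by (simp add: algebra_simps)
    moreover have "c \<noteq> 0" unfolding c_def of_real_eq_0_iff by (rule ne)
    then have "of_real (1 / \<alpha>) * (c * lead_coeff P * lead_coeff Q) \<noteq> 0" using \<alpha> deg(3,4) by simp
    ultimately have N: "coeff ?N (J - 1 + i) \<noteq> 0" by simp
    have "degree (pderiv P * Q) \<le> J - 1 + i"
      using degree_mult_le[of "pderiv P" Q] by (simp add: degree_pderiv deg)
    moreover have "degree (P * pderiv Q) \<le> J - 1 + i"
      using degree_mult_le[of P "pderiv Q"] J1 \<open>i \<ge> 1\<close> by (simp add: degree_pderiv deg)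
    ultimately have "degree ?N \<le> J - 1 + i"
      by (intro order_trans[OF degree_smult_le] degree_diff_le) auto
    then have "degree ?N = J - 1 + i" using N le_degree by (meson le_antisym)
    then show "I (Suc n) (smult (of_real (1 / \<alpha>))
        (smult (of_real (2 - \<alpha> + real n * (d - 1))) (pderiv (symb \<alpha> d a) * Q)
        - smult (of_real d) (symb \<alpha> d a * pderiv Q)))"
      using N unfolding I_def w_def P_def i_def by auto
  qed (use \<alpha> a in auto)
qed

section \<open>The free algebra\<close>

definition wd :: "gen list \<Rightarrow> fa" where "wd w = (\<lambda>v. if v = w then 1 else 0)"

lemma FA_fzero: "fzero \<in> FA" and FA_wd: "wd w \<in> FA"
  by (simp_all add: FA_def fzero_def wd_def)

lemma FA_fadd: "f \<in> FA \<Longrightarrow> g \<in> FA \<Longrightarrow> fadd f g \<in> FA"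
  unfolding FA_def fadd_def mem_Collect_eq
  by (rule finite_subset[of _ "{w. f w \<noteq> 0} \<union> {w. g w \<noteq> 0}"]) auto

lemma FA_fsc: "f \<in> FA \<Longrightarrow> fsc c f \<in> FA"
  unfolding FA_def fsc_def mem_Collect_eq
  by (rule finite_subset[of _ "{w. f w \<noteq> 0}"]) auto

lemma fsub_alt: "fsub f g = fadd f (fsc (-1) g)"
  by (simp add: fsub_def fadd_def fsc_def fun_eq_iff)

lemma FA_fsub: "f \<in> FA \<Longrightarrow> g \<in> FA \<Longrightarrow> fsub f g \<in> FA"
  by (simp add: fsub_alt FA_fadd FA_fsc)

lemma FA_induct [consumes 1, case_names zero wd add sc]:
  assumes "f \<in> FA" "P fzero" "\<And>w. P (wd w)"
    "\<And>f g. f \<in> FA \<Longrightarrow> g \<in> FA \<Longrightarrow> P f \<Longrightarrow> P g \<Longrightarrow> P (fadd f g)"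
    "\<And>c f. f \<in> FA \<Longrightarrow> P f \<Longrightarrow> P (fsc c f)"
  shows "P f"
proof -
  have "f \<in> FA \<and> P f" if "finite A" "\<And>w. w \<notin> A \<Longrightarrow> f w = 0" for A f
    using that
  proof (induction A arbitrary: f)
    case empty
    then have "f = fzero" by (auto simp: fzero_def)
    then show ?case using assms(2) FA_fzero by simp
  next
    case (insert w A)
    define g where "g = f(w := 0)"
    have "g \<in> FA \<and> P g" by (rule insert.IH) (use insert.prems in \<open>auto simp: g_def\<close>)
    moreover have "f = fadd (fsc (f w) (wd w)) g"
      by (auto simp: fadd_def fsc_def wd_def g_def)
    ultimately show ?case using assms(3-5) FA_fadd FA_fsc FA_wd by metis
  qed
  then show ?thesis using assms(1) unfolding FA_def by blast
qed

lemma fmul_fadd_left: "fmul (fadd f g) h = fadd (fmul f h) (fmul g h)"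
  and fmul_fadd_right: "fmul h (fadd f g) = fadd (fmul h f) (fmul h g)"
  and fmul_fsc_left: "fmul (fsc c f) h = fsc c (fmul f h)"
  and fmul_fsc_right: "fmul h (fsc c f) = fsc c (fmul h f)"
  and fmul_fzero_left: "fmul fzero h = fzero"
  and fmul_fzero_right: "fmul h fzero = fzero"
  by (simp_all add: fmul_def fadd_def fsc_def fzero_def algebra_simps sum.distrib sum_distrib_left)

lemma fmul_wd: "fmul (wd u) (wd v) = wd (u @ v)"
proof
  fix w
  have "fmul (wd u) (wd v) w = (\<Sum>k\<le>length w. if k = length u \<and> w = u @ v then 1 else 0)"
    unfolding fmul_def wd_def
  proof (rule sum.cong)
    fix k assume "k \<in> {..length w}"
    then have "take k w = u \<and> drop k w = v \<longleftrightarrow> k = length u \<and> w = u @ v"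
      by (metis append_eq_conv_conj append_take_drop_id atMost_iff length_take min.absorb2)
    then show "(if take k w = u then 1 else 0) * (if drop k w = v then 1 else 0)
        = (if k = length u \<and> w = u @ v then 1 else (0::complex))" by auto
  qed simp
  also have "\<dots> = wd (u @ v) w"
    by (cases "w = u @ v") (simp_all add: wd_def sum.delta)
  finally show "fmul (wd u) (wd v) w = wd (u @ v) w" .
qed

lemma FA_fmul: "f \<in> FA \<Longrightarrow> g \<in> FA \<Longrightarrow> fmul f g \<in> FA"
proof (induction f rule: FA_induct)
  case (wd u)
  then show ?case
    by (induction g rule: FA_induct)
      (simp_all add: fmul_wd FA_wd fmul_fadd_right fmul_fsc_right FA_fadd FA_fsc fmul_fzero_right FA_fzero)
qed (simp_all add: fmul_fadd_left fmul_fsc_left fmul_fzero_left FA_fzero FA_fadd FA_fsc)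

lemma fone_wd: "fone = wd []" and fgen_wd: "fgen a = wd [a]"
  by (auto simp: fone_def fgen_def wd_def)

lemma fmul_assoc: "f \<in> FA \<Longrightarrow> g \<in> FA \<Longrightarrow> h \<in> FA \<Longrightarrow> fmul (fmul f g) h = fmul f (fmul g h)"
proof (induction f rule: FA_induct)
  case (wd u)
  then show ?case
  proof (induction g rule: FA_induct)
    case (wd v)
    then show ?case
      by (induction h rule: FA_induct)
        (simp_all add: fmul_wd fmul_fadd_right fmul_fsc_right fmul_fzero_right)
  qed (simp_all add: fmul_fadd_right fmul_fsc_right fmul_fzero_right fmul_fadd_left fmul_fsc_left fmul_fzero_left)
qed (simp_all add: fmul_fadd_left fmul_fsc_left fmul_fzero_left)

text \<open>Bundling \<open>FA\<close> into a type makes it an instance of \<open>ring_1\<close>, so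
  that computations modulo the ideal become ring simplifications.\<close>

typedef ncpoly = FA morphisms nco Abs_nc
  using FA_fzero by blast

instantiation ncpoly :: ring_1
begin

definition "0 = Abs_nc fzero"
definition "1 = Abs_nc fone"
definition "x + y = Abs_nc (fadd (nco x) (nco y))"
definition "x - y = Abs_nc (fsub (nco x) (nco y))"
definition "- x = Abs_nc (fsc (-1) (nco x))"
definition "x * y = Abs_nc (fmul (nco x) (nco y))"

lemma nco_simps:
  "nco 0 = fzero" "nco 1 = fone" "nco (x + y) = fadd (nco x) (nco y)"
  "nco (x - y) = fsub (nco x) (nco y)" "nco (- x) = fsc (-1) (nco x)"
  "nco (x * y) = fmul (nco x) (nco y)"
  by (simp_all add: zero_ncpoly_def one_ncpoly_def plus_ncpoly_def minus_ncpoly_def uminus_ncpoly_def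
      times_ncpoly_def Abs_nc_inverse FA_fzero FA_wd fone_wd FA_fadd FA_fsub FA_fsc FA_fmul nco)

instance
proof
  fix a b c :: ncpoly
  show "a * b * c = a * (b * c)"
    by (simp add: nco_simps fmul_assoc nco flip: nco_inject)
  have "fmul fone f = f \<and> fmul f fone = f" if "f \<in> FA" for f
    using that
    by (induction f rule: FA_induct)
      (simp_all add: fone_wd fmul_wd fmul_fadd_left fmul_fadd_right fmul_fsc_left fmul_fsc_right fmul_fzero_left fmul_fzero_right)
  then show "1 * a = a" "a * 1 = a"
    by (simp_all add: nco_simps nco flip: nco_inject)
  show "(a + b) * c = a * c + b * c" "a * (b + c) = a * b + a * c"
    by (simp_all add: nco_simps fmul_fadd_left fmul_fadd_right flip: nco_inject)
  have "fzero [] \<noteq> fone []" by (simp add: fzero_def fone_def)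
  then show "(0 :: ncpoly) \<noteq> 1"
    by (auto simp: nco_simps simp flip: nco_inject)
qed (auto simp: nco_simps fadd_def fsub_def fsc_def fzero_def add_ac simp flip: nco_inject)

end

definition nsc :: "complex \<Rightarrow> ncpoly \<Rightarrow> ncpoly" where "nsc c x = Abs_nc (fsc c (nco x))"

lemma nco_nsc: "nco (nsc c x) = fsc c (nco x)"
  by (simp add: nsc_def Abs_nc_inverse FA_fsc nco)

lemma nsc_mult_left: "nsc c x * y = nsc c (x * y)"
  and nsc_mult_right: "x * nsc c y = nsc c (x * y)"
  by (simp_all add: nco_simps nco_nsc fmul_fsc_left fmul_fsc_right flip: nco_inject)

lemma nsc_add: "nsc c (x + y) = nsc c x + nsc c y"
  and nsc_diff: "nsc c (x - y) = nsc c x - nsc c y"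
  and nsc_plus: "nsc (c + d) x = nsc c x + nsc d x"
  and nsc_nsc: "nsc c (nsc d x) = nsc (c * d) x"
  and nsc_1 [simp]: "nsc 1 x = x" and nsc_0 [simp]: "nsc 0 x = 0" and nsc_zero [simp]: "nsc c 0 = 0"
  and nsc_uminus: "nsc (- c) x = - nsc c x"
  by (simp_all add: nco_simps nco_nsc fadd_def fsub_def fsc_def fzero_def algebra_simps flip: nco_inject)

definition ngen :: "gen \<Rightarrow> ncpoly" where "ngen g = Abs_nc (fgen g)"

lemma nco_ngen: "nco (ngen g) = fgen g"
  by (simp add: ngen_def Abs_nc_inverse fgen_wd FA_wd)

lemma ncpoly_induct [case_names one gen add sc]:
  assumes "P 1" "\<And>g x. P x \<Longrightarrow> P (ngen g * x)" "\<And>x y. P x \<Longrightarrow> P y \<Longrightarrow> P (x + y)" "\<And>c x. P x \<Longrightarrow> P (nsc c x)"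
  shows "P x"
proof -
  have "P (Abs_nc f)" if "f \<in> FA" for f
    using that
  proof (induction f rule: FA_induct)
    case zero
    have "Abs_nc fzero = nsc 0 1" by (simp flip: zero_ncpoly_def)
    then show ?case using assms by metis
  next
    case (wd w)
    show ?case
    proof (induction w)
      case Nil
      then show ?case using assms(1) by (simp add: one_ncpoly_def fone_wd)
    next
      case (Cons g w)
      have "Abs_nc (wd (g # w)) = ngen g * Abs_nc (wd w)"
        by (simp add: times_ncpoly_def nco_ngen Abs_nc_inverse FA_wd fgen_wd fmul_wd)
      then show ?case using Cons assms(2) by simp
    qed
  next
    case (add f g)
    then show ?case using assms(3)[of "Abs_nc f" "Abs_nc g"]
      by (simp add: plus_ncpoly_def Abs_nc_inverse)
  next
    case (sc c f)
    then show ?case using assms(4)[of "Abs_nc f" c]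
      by (simp add: nsc_def Abs_nc_inverse)
  qed
  then show ?thesis using nco nco_inverse by metis
qed

section \<open>Evaluation of noncommutative polynomials\<close>

text \<open>This is XY as a polynomial in theta, that is lam^2/4 - (theta - 1/2)^2. It satisfies
  q(theta) - q(theta + 1) = 2 theta, which is [X, Y] = H.\<close>

definition qpoly :: "complex \<Rightarrow> complex poly" where
  "qpoly lam = [:lam\<^sup>2 / 4 - 1 / 4, 1, -1:]"

definition sX :: skew where "sX = tmon 1 1"
definition sT :: skew where "sT = tmon 0 [:0, 1:]"
definition sY :: "complex \<Rightarrow> skew" where "sY lam = tmon (-1) (qpoly lam)"

text \<open>The Casimir relation is included, so this is exactly the condition for an algebra map
  out of the quotient, not merely for a Lie map out of sl(2).\<close>

definition sl2_rel :: "complex \<Rightarrow> skew \<Rightarrow> skew \<Rightarrow> skew \<Rightarrow> bool" where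
  "sl2_rel lam x h y \<longleftrightarrow> com x y = h \<and> com h x = cst 2 * x \<and> com h y = - (cst 2 * y) \<and>
     cst 2 * (y * x) + cst (1/2) * (h * h) + h = cst ((lam\<^sup>2 - 1) / 2)"

fun evw :: "(gen \<Rightarrow> skew) \<Rightarrow> gen list \<Rightarrow> skew" where
  "evw g [] = 1"
| "evw g (x # w) = g x * evw g w"

definition ev :: "(gen \<Rightarrow> skew) \<Rightarrow> ncpoly \<Rightarrow> skew" where
  "ev g x = (\<Sum>w | nco x w \<noteq> 0. cst (nco x w) * evw g w)"

lemma ev_superset:
  assumes "finite A" "{w. nco x w \<noteq> 0} \<subseteq> A"
  shows "ev g x = (\<Sum>w\<in>A. cst (nco x w) * evw g w)"
  unfolding ev_def by (rule sum.mono_neutral_left) (use assms in auto)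

lemma finite_nco [simp]: "finite {w. nco x w \<noteq> 0}"
  using nco[of x] by (simp add: FA_def)

lemma ev_add: "ev g (x + y) = ev g x + ev g y"
proof -
  let ?A = "{w. nco x w \<noteq> 0} \<union> {w. nco y w \<noteq> 0}"
  have "ev g (x + y) = (\<Sum>w\<in>?A. cst (nco (x + y) w) * evw g w)"
    by (rule ev_superset) (auto simp: nco_simps fadd_def)
  moreover have "ev g x = (\<Sum>w\<in>?A. cst (nco x w) * evw g w)"
    by (rule ev_superset) auto
  moreover have "ev g y = (\<Sum>w\<in>?A. cst (nco y w) * evw g w)"
    by (rule ev_superset) auto
  ultimately show ?thesis
    by (simp add: nco_simps fadd_def cst_add distrib_right sum.distrib)
qed

lemma ev_nsc: "ev g (nsc c x) = cst c * ev g x"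
proof -
  have "ev g (nsc c x) = (\<Sum>w | nco x w \<noteq> 0. cst (nco (nsc c x) w) * evw g w)"
    by (rule ev_superset) (auto simp: nco_nsc fsc_def)
  then show ?thesis
    by (simp add: ev_def nco_nsc fsc_def cst_mult sum_distrib_left mult.assoc)
qed

lemma ev_wd: "ev g (Abs_nc (wd w)) = evw g w"
proof -
  have "{v. wd w v \<noteq> 0} = {w}" by (auto simp: wd_def)
  then show ?thesis by (simp add: ev_def Abs_nc_inverse FA_wd) (simp add: wd_def)
qed

lemma ev_0 [simp]: "ev g 0 = 0"
  using ev_nsc[of g 0 0] by simp

lemma ev_uminus: "ev g (- x) = - ev g x"
  using ev_add[of g x "- x"] by (simp add: eq_neg_iff_add_eq_0 add.commute)

lemma ev_diff: "ev g (x - y) = ev g x - ev g y"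
  by (metis ev_add ev_uminus diff_conv_add_uminus)

lemma ev_1 [simp]: "ev g 1 = 1"
  using ev_wd[of g "[]"] by (simp add: one_ncpoly_def fone_wd)

lemma ev_ngen [simp]: "ev g (ngen a) = g a"
  using ev_wd[of g "[a]"] by (simp add: ngen_def fgen_wd)

lemma ev_mult: "ev g (x * y) = ev g x * ev g y"
proof -
  have gen: "ev g (ngen a * y) = g a * ev g y" for a y
  proof -
    have "ev g (ngen a * Abs_nc f) = g a * ev g (Abs_nc f)" if "f \<in> FA" for f
      using that
    proof (induction f rule: FA_induct)
      case zero
      then show ?case by (simp flip: zero_ncpoly_def)
    next
      case (wd w)
      have "ngen a * Abs_nc (wd w) = Abs_nc (wd (a # w))"
        by (simp add: times_ncpoly_def nco_ngen Abs_nc_inverse FA_wd fgen_wd fmul_wd)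
      then show ?case by (simp add: ev_wd)
    next
      case (add f h)
      have "Abs_nc (fadd f h) = Abs_nc f + Abs_nc h"
        using add by (simp add: plus_ncpoly_def Abs_nc_inverse)
      then show ?case using add by (simp add: distrib_left ev_add)
    next
      case (sc c f)
      have "Abs_nc (fsc c f) = nsc c (Abs_nc f)"
        using sc by (simp add: nsc_def Abs_nc_inverse)
      then show ?case using sc by (simp add: nsc_mult_right ev_nsc cst_left_commute)
    qed
    then show ?thesis by (metis nco nco_inverse)
  qed
  show ?thesis
    by (induction x rule: ncpoly_induct)
      (simp_all add: gen mult.assoc distrib_right ev_add nsc_mult_left ev_nsc)
qed

section \<open>The defining ideal and maps out of the quotient\<close>

definition Jid :: "complex \<Rightarrow> ncpoly set" where "Jid lam = {x. nco x \<in> ideal_gen lam}"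

lemma ideal_gen_FA: "p \<in> ideal_gen lam \<Longrightarrow> p \<in> FA"
  by (induction rule: ideal_gen.induct)
    (auto simp: rels_def casimir_rel_def fcomm_def fX_def fH_def fY_def fgen_wd fone_wd
      intro!: FA_fadd FA_fsub FA_fsc FA_fmul FA_wd FA_fzero)

lemma Jid_0: "0 \<in> Jid lam"
  and Jid_add: "x \<in> Jid lam \<Longrightarrow> y \<in> Jid lam \<Longrightarrow> x + y \<in> Jid lam"
  and Jid_nsc: "x \<in> Jid lam \<Longrightarrow> nsc c x \<in> Jid lam"
  and Jid_lmult: "x \<in> Jid lam \<Longrightarrow> y * x \<in> Jid lam"
  and Jid_rmult: "x \<in> Jid lam \<Longrightarrow> x * y \<in> Jid lam"
  by (simp_all add: Jid_def nco_simps nco_nsc ideal_gen.intros nco)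

abbreviation "nX \<equiv> ngen GX"
abbreviation "nH \<equiv> ngen GH"
abbreviation "nY \<equiv> ngen GY"

lemma Jid_rels:
  "nX * nY - nY * nX - nH \<in> Jid lam"
  "nH * nX - nX * nH - nsc 2 nX \<in> Jid lam"
  "nH * nY - nY * nH + nsc 2 nY \<in> Jid lam"
  "nsc 2 (nY * nX) + nsc (1/2) (nH * nH) + nH - nsc ((lam\<^sup>2 - 1) / 2) 1 \<in> Jid lam"
  by (auto simp: Jid_def nco_simps nco_nsc nco_ngen rels_def casimir_rel_def fcomm_def fX_def fH_def fY_def
      intro!: ideal_gen.gen)

lemma ev_Jid:
  assumes rel: "sl2_rel lam (g GX) (g GH) (g GY)" and "x \<in> Jid lam"
  shows "ev g x = 0"
proof -
  have "ev g (Abs_nc p) = 0" if "p \<in> ideal_gen lam" for p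
    using that
  proof (induction rule: ideal_gen.induct)
    case (gen r)
    have "Abs_nc r \<in> {nX * nY - nY * nX - nH, nH * nX - nX * nH - nsc 2 nX, nH * nY - nY * nH + nsc 2 nY,
       nsc 2 (nY * nX) + nsc (1/2) (nH * nH) + nH - nsc ((lam\<^sup>2 - 1) / 2) 1}"
    proof -
      have "r \<in> FA" using gen ideal_gen_FA ideal_gen.gen by blast
      then show ?thesis using gen
        by (simp add: Abs_nc_inverse rels_def casimir_rel_def fcomm_def fX_def fH_def fY_def nco_simps nco_nsc nco_ngen flip: nco_inject)
    qed
    moreover have "g GX * g GY - g GY * g GX = g GH" "g GH * g GX - g GX * g GH = cst 2 * g GX"
      "g GH * g GY - g GY * g GH = - (cst 2 * g GY)"
      "cst 2 * (g GY * g GX) + cst (1/2) * (g GH * g GH) + g GH = cst ((lam\<^sup>2 - 1) / 2)"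
      using rel by (simp_all add: sl2_rel_def com_def)
    ultimately show ?case by (auto simp: ev_diff ev_add ev_mult ev_nsc)
  next
    case zero
    then show ?case by (simp flip: zero_ncpoly_def)
  next
    case (add p q)
    then have "Abs_nc (fadd p q) = Abs_nc p + Abs_nc q"
      by (simp add: plus_ncpoly_def Abs_nc_inverse ideal_gen_FA)
    then show ?case using add by (simp add: ev_add)
  next
    case (sc p c)
    then have "Abs_nc (fsc c p) = nsc c (Abs_nc p)"
      by (simp add: nsc_def Abs_nc_inverse ideal_gen_FA)
    then show ?case using sc by (simp add: ev_nsc)
  next
    case (lmul a p)
    then have "Abs_nc (fmul a p) = Abs_nc a * Abs_nc p"
      by (simp add: times_ncpoly_def Abs_nc_inverse ideal_gen_FA)
    then show ?case using lmul by (simp add: ev_mult)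
  next
    case (rmul a p)
    then have "Abs_nc (fmul p a) = Abs_nc p * Abs_nc a"
      by (simp add: times_ncpoly_def Abs_nc_inverse ideal_gen_FA)
    then show ?case using rmul by (simp add: ev_mult)
  qed
  then show ?thesis using assms(2) by (metis Jid_def mem_Collect_eq nco_inverse)
qed

section \<open>Normal forms in the quotient\<close>

text \<open>The counterpart of theta: half of H, so that passing X or Y costs 1 instead of
  2.\<close>

definition nT :: ncpoly where "nT = nsc (1/2) nH"

lemma Jid_nT:
  "nT * nX - (nX * nT + nX) \<in> Jid lam"
  "nT * nY - (nY * nT - nY) \<in> Jid lam"
  "nY * nX - (nsc ((lam\<^sup>2 - 1) / 4) 1 - nT * nT - nT) \<in> Jid lam"
  "nX * nY - (nsc ((lam\<^sup>2 - 1) / 4) 1 - nT * nT + nT) \<in> Jid lam"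
proof -
  have "nT * nX - (nX * nT + nX) = nsc (1/2) (nH * nX - nX * nH - nsc 2 nX)"
    by (simp add: nT_def nsc_mult_left nsc_mult_right nsc_diff nsc_nsc)
  then show "nT * nX - (nX * nT + nX) \<in> Jid lam" using Jid_nsc Jid_rels(2) by metis
  have "nT * nY - (nY * nT - nY) = nsc (1/2) (nH * nY - nY * nH + nsc 2 nY)"
    by (simp add: nT_def nsc_mult_left nsc_mult_right nsc_diff nsc_add nsc_nsc)
  then show "nT * nY - (nY * nT - nY) \<in> Jid lam" using Jid_nsc Jid_rels(3) by metis
  have "nY * nX - (nsc ((lam\<^sup>2 - 1) / 4) 1 - nT * nT - nT)
    = nsc (1/2) (nsc 2 (nY * nX) + nsc (1/2) (nH * nH) + nH - nsc ((lam\<^sup>2 - 1) / 2) 1)"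
    by (simp add: nT_def nsc_mult_left nsc_mult_right nsc_diff nsc_add nsc_nsc)
  then show *: "nY * nX - (nsc ((lam\<^sup>2 - 1) / 4) 1 - nT * nT - nT) \<in> Jid lam"
    using Jid_nsc Jid_rels(4) by metis
  have "nH = nT + nT"
    by (simp add: nT_def flip: nsc_plus)
  then have "nX * nY - (nsc ((lam\<^sup>2 - 1) / 4) 1 - nT * nT + nT)
     = (nX * nY - nY * nX - nH) + (nY * nX - (nsc ((lam\<^sup>2 - 1) / 4) 1 - nT * nT - nT))"
    by simp
  then show "nX * nY - (nsc ((lam\<^sup>2 - 1) / 4) 1 - nT * nT + nT) \<in> Jid lam"
    using * Jid_rels(1) Jid_add by metis
qed

text \<open>Applied with c = 1 to X and with c = -1 to Y.\<close>

lemma Jid_nT_power: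
  assumes "nT * x - (x * nT + nsc c x) \<in> Jid lam"
  shows "nT * x ^ k - (x ^ k * nT + nsc (of_nat k * c) (x ^ k)) \<in> Jid lam"
proof (induction k)
  case 0
  then show ?case by (simp add: Jid_0)
next
  case (Suc k)
  have "nT * x ^ Suc k - (x ^ Suc k * nT + nsc (of_nat (Suc k) * c) (x ^ Suc k))
    = (nT * x - (x * nT + nsc c x)) * x ^ k + x * (nT * x ^ k - (x ^ k * nT + nsc (of_nat k * c) (x ^ k)))"
    by (simp add: algebra_simps nsc_mult_left nsc_mult_right nsc_plus)
  then show ?case using Suc assms Jid_add Jid_lmult Jid_rmult by metis
qed

text \<open>Modulo the ideal XY and YX are polynomials in theta, so no basis monomial needs both X
  and Y. The ideal itself is included to make the set closed under congruence.\<close>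

inductive_set span_nf :: "complex \<Rightarrow> ncpoly set" for lam where
  ideal: "x \<in> Jid lam \<Longrightarrow> x \<in> span_nf lam"
| X: "nX ^ k * nT ^ j \<in> span_nf lam"
| Y: "nY ^ k * nT ^ j \<in> span_nf lam"
| add: "x \<in> span_nf lam \<Longrightarrow> y \<in> span_nf lam \<Longrightarrow> x + y \<in> span_nf lam"
| sc: "x \<in> span_nf lam \<Longrightarrow> nsc c x \<in> span_nf lam"

lemma span_nf_diff: "x \<in> span_nf lam \<Longrightarrow> y \<in> span_nf lam \<Longrightarrow> x - y \<in> span_nf lam"
  using span_nf.add[of x lam "nsc (-1) y"] span_nf.sc[of y lam "-1"] by (simp add: nsc_uminus)

lemma span_nf_cong: "x - y \<in> Jid lam \<Longrightarrow> y \<in> span_nf lam \<Longrightarrow> x \<in> span_nf lam"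
  using span_nf.add[of "x - y" lam y] by (simp add: span_nf.ideal)

lemma span_nf_nT: "x \<in> span_nf lam \<Longrightarrow> nT * x \<in> span_nf lam"
proof (induction rule: span_nf.induct)
  case (ideal x)
  then show ?case by (intro span_nf.ideal Jid_lmult)
next
  case (X k j)
  have "nT * nX - (nX * nT + nsc 1 nX) \<in> Jid lam" using Jid_nT(1) by simp
  from Jid_rmult[OF Jid_nT_power[OF this, of k], of "nT ^ j"]
  have "nT * (nX ^ k * nT ^ j) - (nX ^ k * nT ^ Suc j + nsc (of_nat k) (nX ^ k * nT ^ j)) \<in> Jid lam"
    by (simp add: algebra_simps nsc_mult_left)
  then show ?case by (rule span_nf_cong) (intro span_nf.intros)
next
  case (Y k j)
  have "nT * nY - (nY * nT + nsc (-1) nY) \<in> Jid lam" using Jid_nT(2) by (simp add: nsc_uminus)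
  from Jid_rmult[OF Jid_nT_power[OF this, of k], of "nT ^ j"]
  have "nT * (nY ^ k * nT ^ j) - (nY ^ k * nT ^ Suc j + nsc (- of_nat k) (nY ^ k * nT ^ j)) \<in> Jid lam"
    by (simp add: algebra_simps nsc_mult_left)
  then show ?case by (rule span_nf_cong) (intro span_nf.intros)
qed (simp_all add: distrib_left nsc_mult_right span_nf.intros)

lemma span_nf_nX: "x \<in> span_nf lam \<Longrightarrow> nX * x \<in> span_nf lam"
proof (induction rule: span_nf.induct)
  case (ideal x)
  then show ?case by (intro span_nf.ideal Jid_lmult)
next
  case (X k j)
  then show ?case using span_nf.X[of "Suc k" j] by (simp add: mult.assoc)
next
  case (Y k j)
  show ?case
  proof (cases k)
    case 0
    then show ?thesis using span_nf.X[of 1 j] by simp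
  next
    case (Suc k')
    let ?v = "nY ^ k' * nT ^ j"
    have v: "?v \<in> span_nf lam" by (rule span_nf.Y)
    have "nX * (nY ^ k * nT ^ j) - (nsc ((lam\<^sup>2 - 1) / 4) ?v - nT * (nT * ?v) + nT * ?v) \<in> Jid lam"
      using Jid_rmult[OF Jid_nT(4)[of lam], of ?v] Suc by (simp add: algebra_simps nsc_mult_left)
    then show ?thesis
      by (rule span_nf_cong) (intro span_nf.add span_nf_diff span_nf.sc span_nf_nT v)
  qed
qed (simp_all add: distrib_left nsc_mult_right span_nf.intros)

lemma span_nf_nY: "x \<in> span_nf lam \<Longrightarrow> nY * x \<in> span_nf lam"
proof (induction rule: span_nf.induct)
  case (ideal x)
  then show ?case by (intro span_nf.ideal Jid_lmult)
next
  case (Y k j)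
  then show ?case using span_nf.Y[of "Suc k" j] by (simp add: mult.assoc)
next
  case (X k j)
  show ?case
  proof (cases k)
    case 0
    then show ?thesis using span_nf.Y[of 1 j] by simp
  next
    case (Suc k')
    let ?v = "nX ^ k' * nT ^ j"
    have v: "?v \<in> span_nf lam" by (rule span_nf.X)
    have "nY * (nX ^ k * nT ^ j) - (nsc ((lam\<^sup>2 - 1) / 4) ?v - nT * (nT * ?v) - nT * ?v) \<in> Jid lam"
      using Jid_rmult[OF Jid_nT(3)[of lam], of ?v] Suc by (simp add: algebra_simps nsc_mult_left)
    then show ?thesis
      by (rule span_nf_cong) (intro span_nf_diff span_nf.sc span_nf_nT v)
  qed
qed (simp_all add: distrib_left nsc_mult_right span_nf.intros)

lemma span_nf_UNIV: "x \<in> span_nf lam"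
proof (induction x rule: ncpoly_induct)
  case one
  show ?case using span_nf.X[of 0 0] by simp
next
  case (gen g x)
  have "nH = nsc 2 nT" by (simp add: nT_def nsc_nsc)
  then have "nH * x \<in> span_nf lam" using gen by (simp add: nsc_mult_left span_nf.sc span_nf_nT)
  then show ?case using gen by (cases g) (simp_all add: span_nf_nX span_nf_nY)
qed (rule span_nf.add span_nf.sc; assumption)+

section \<open>The standard triple in the Laurent ring and the kernel of its evaluation\<close>

definition sgen :: "complex \<Rightarrow> gen \<Rightarrow> skew" where
  "sgen lam g = (case g of GX \<Rightarrow> sX | GH \<Rightarrow> cst 2 * sT | GY \<Rightarrow> sY lam)"

lemma poly_ext: "(\<And>z. poly p z = poly q (z::complex)) \<Longrightarrow> p = q"
  by (simp add: poly_eq_poly_eq_iff[symmetric] fun_eq_iff)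

lemma sl2_rel_sgen: "sl2_rel lam sX (cst 2 * sT) (sY lam)"
proof -
  have 1: "com sX (sY lam) = cst 2 * sT"
    unfolding sX_def sY_def sT_def com_tmon cst_tmon
    by (simp, rule arg_cong[where f = "tmon 0"], rule poly_ext)
      (simp add: qpoly_def algebra_simps power2_eq_square)
  have 2: "com (cst 2 * sT) sX = cst 2 * sX"
    unfolding sX_def sT_def com_tmon cst_tmon
    by (simp, rule arg_cong[where f = "tmon 1"], rule poly_ext) simp
  have 3: "com (cst 2 * sT) (sY lam) = - (cst 2 * sY lam)"
    unfolding sY_def sT_def com_tmon cst_tmon tmon_uminus[symmetric]
    by (simp, rule arg_cong[where f = "tmon (-1)"], rule poly_ext) (simp add: algebra_simps)
  have 4: "cst 2 * (sY lam * sX) + cst (1/2) * ((cst 2 * sT) * (cst 2 * sT)) + cst 2 * sT = cst ((lam\<^sup>2 - 1) / 2)"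
    unfolding sX_def sY_def sT_def tmon_mult cst_tmon cst_def[of "(lam\<^sup>2 - 1) / 2"]
    by (simp add: tmon_mult cst_tmon flip: tmon_add, rule arg_cong[where f = "tmon 0"], rule poly_ext)
      (simp add: qpoly_def field_simps power2_eq_square)
  show ?thesis unfolding sl2_rel_def using 1 2 3 4 by blast
qed

text \<open>Characterised by Y^n = T^(-n) Qp: the product q(theta) q(theta - 1) ... q(theta - n +
  1).\<close>

fun Qp :: "complex \<Rightarrow> nat \<Rightarrow> complex poly" where
  "Qp lam 0 = 1"
| "Qp lam (Suc n) = shift (- int n) (qpoly lam) * Qp lam n"

lemma degree_qpoly: "degree (qpoly lam) = 2"
  by (simp add: qpoly_def)

lemma Qp_nonzero: "Qp lam n \<noteq> 0" and degree_Qp: "degree (Qp lam n) = 2 * n"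
proof (induction n)
  case (Suc n)
  have "shift (- int n) (qpoly lam) \<noteq> 0"
    by (metis degree_0 degree_qpoly degree_shift zero_neq_numeral)
  { case 1 then show ?case using Suc \<open>shift _ _ \<noteq> 0\<close> by simp }
  { case 2 then show ?case using Suc \<open>shift _ _ \<noteq> 0\<close> by (simp add: degree_mult_eq degree_qpoly) }
qed auto

lemma sX_power: "sX ^ n = tmon (int n) 1"
  by (induction n) (simp_all add: sX_def one_skew_def tmon_mult)

lemma sT_power: "sT ^ j = tmon 0 (monom 1 j)"
  by (induction j) (simp_all add: sT_def one_skew_def tmon_mult monom_0 pCons_one monom_Suc)

lemma sY_power: "sY lam ^ n = tmon (- int n) (Qp lam n)"
  by (induction n) (simp_all add: sY_def one_skew_def tmon_mult)

definition evs :: "complex \<Rightarrow> ncpoly \<Rightarrow> skew" where "evs lam = ev (sgen lam)"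

lemma ev_power: "ev g (x ^ n) = ev g x ^ n"
  by (induction n) (simp_all add: ev_mult)

lemma ev_nT: "evs lam nT = sT"
  by (simp add: evs_def nT_def ev_nsc sgen_def flip: mult.assoc cst_mult)

lemma evs_X_basis: "evs lam (nX ^ n * nT ^ j) = tmon (int n) (monom 1 j)"
  using ev_nT by (simp add: evs_def ev_mult ev_power sgen_def sX_power sT_power tmon_mult)

lemma evs_Y_basis: "evs lam (nY ^ n * nT ^ j) = tmon (- int n) (Qp lam n * monom 1 j)"
  using ev_nT by (simp add: evs_def ev_mult ev_power sgen_def sY_power sT_power tmon_mult)

lemma evs_Jid: "x \<in> Jid lam \<Longrightarrow> evs lam x = 0"
  unfolding evs_def by (rule ev_Jid) (simp_all add: sgen_def sl2_rel_sgen)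

definition lin :: "(nat \<Rightarrow> ncpoly) \<Rightarrow> complex poly \<Rightarrow> ncpoly" where
  "lin b p = (\<Sum>j\<le>degree p. nsc (coeff p j) (b j))"

lemma lin_upto: "degree p \<le> N \<Longrightarrow> lin b p = (\<Sum>j\<le>N. nsc (coeff p j) (b j))"
  unfolding lin_def by (rule sum.mono_neutral_left) (auto simp: coeff_eq_0)

lemma nsc_sum: "nsc c (sum f A) = (\<Sum>x\<in>A. nsc c (f x))"
  by (induction A rule: infinite_finite_induct) (simp_all add: nsc_add)

lemma lin_add: "lin b (p + q) = lin b p + lin b q"
  using lin_upto[of p "max (degree p) (degree q)" b] lin_upto[of q "max (degree p) (degree q)" b]
    lin_upto[of "p + q" "max (degree p) (degree q)" b]
  by (simp add: degree_add_le_max nsc_plus sum.distrib)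

lemma lin_smult: "lin b (smult c p) = nsc c (lin b p)"
  using lin_upto[of p "degree p" b] lin_upto[of "smult c p" "degree p" b]
  by (simp add: nsc_sum nsc_nsc)

lemma lin_0 [simp]: "lin b 0 = 0"
  by (simp add: lin_def)

lemma lin_monom: "lin b (monom 1 j) = b j"
proof -
  have "nsc (coeff (monom 1 j) i) (b i) = (if i = j then b j else 0)" for i by auto
  then show ?thesis by (simp add: lin_def degree_monom_eq)
qed

text \<open>The division is exact on the image of the evaluation, where the component of degree -n is a
  multiple of Qp lam n.\<close>

definition lift1 :: "complex \<Rightarrow> int \<Rightarrow> complex poly \<Rightarrow> ncpoly" where
  "lift1 lam k p = (if k \<ge> 0 then lin (\<lambda>j. nX ^ nat k * nT ^ j) p
     else lin (\<lambda>j. nY ^ nat (- k) * nT ^ j) (p div Qp lam (nat (- k))))"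

definition lift :: "complex \<Rightarrow> skew \<Rightarrow> ncpoly" where
  "lift lam a = (\<Sum>k | coef a k \<noteq> 0. lift1 lam k (coef a k))"

lemma lift1_0 [simp]: "lift1 lam k 0 = 0"
  and lift1_add: "lift1 lam k (p + q) = lift1 lam k p + lift1 lam k q"
  and lift1_smult: "lift1 lam k (smult c p) = nsc c (lift1 lam k p)"
  by (simp_all add: lift1_def lin_add lin_smult poly_div_add_left div_smult_left)

lemma lift_superset:
  assumes "finite A" "{k. coef a k \<noteq> 0} \<subseteq> A"
  shows "lift lam a = (\<Sum>k\<in>A. lift1 lam k (coef a k))"
  unfolding lift_def by (rule sum.mono_neutral_left) (use assms in auto)

lemma lift_add: "lift lam (a + b) = lift lam a + lift lam b"
proof -
  let ?A = "{k. coef a k \<noteq> 0} \<union> {k. coef b k \<noteq> 0}"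
  have "lift lam (a + b) = (\<Sum>k\<in>?A. lift1 lam k (coef (a + b) k))"
    by (rule lift_superset) auto
  moreover have "lift lam a = (\<Sum>k\<in>?A. lift1 lam k (coef a k))"
    by (rule lift_superset) auto
  moreover have "lift lam b = (\<Sum>k\<in>?A. lift1 lam k (coef b k))"
    by (rule lift_superset) auto
  ultimately show ?thesis by (simp add: lift1_add sum.distrib)
qed

lemma lift_cst: "lift lam (cst c * a) = nsc c (lift lam a)"
proof -
  have "lift lam (cst c * a) = (\<Sum>k | coef a k \<noteq> 0. lift1 lam k (coef (cst c * a) k))"
    by (rule lift_superset) auto
  then show ?thesis by (simp add: lift_def nsc_sum lift1_smult)
qed

lemma lift_tmon: "lift lam (tmon k p) = lift1 lam k p"
  by (subst lift_superset[of "{k}"]) (auto simp: coef_tmon)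

text \<open>By linearity it suffices to recover the normal form monomials from their values T^k
  theta^j and T^(-k) Qp theta^j. Consequently an element that evaluates to 0 lies in the
  ideal.\<close>

lemma lift_evs: "x - lift lam (evs lam x) \<in> Jid lam"
  using span_nf_UNIV[of x lam]
proof (induction rule: span_nf.induct)
  case (ideal x)
  then show ?case by (simp add: evs_Jid lift_def)
next
  case (X k j)
  then show ?case by (simp add: evs_X_basis lift_tmon lift1_def lin_monom Jid_0)
next
  case (Y k j)
  \<comment> \<open>For k = 0 the exponent -k is not negative and \<open>lift1\<close> takes its X
    branch.\<close>
  then show ?case
    by (cases "k = 0")
      (simp_all only: evs_Y_basis, simp_all add: lift_tmon lift1_def lin_monom Jid_0 Qp_nonzero)
next
  case (add x y)
  have "x + y - lift lam (evs lam (x + y)) = (x - lift lam (evs lam x)) + (y - lift lam (evs lam y))"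
    by (simp add: evs_def ev_add lift_add)
  then show ?case using add Jid_add by metis
next
  case (sc x c)
  have "nsc c x - lift lam (evs lam (nsc c x)) = nsc c (x - lift lam (evs lam x))"
    by (simp add: evs_def ev_nsc lift_cst nsc_diff)
  then show ?case using sc Jid_nsc by metis
qed

lemma evs_eq_0_iff: "evs lam x = 0 \<longleftrightarrow> x \<in> Jid lam"
  using lift_evs[of x lam] evs_Jid[of x lam] by (auto simp: lift_def)

section \<open>The image algebra and its endomorphisms\<close>

definition B :: "complex \<Rightarrow> skew set" where "B lam = range (evs lam)"

lemma B_0: "0 \<in> B lam" and B_1: "1 \<in> B lam" and B_cst: "cst c \<in> B lam"
proof -
  have "evs lam 0 = 0" "evs lam 1 = 1" "evs lam (nsc c 1) = cst c"
    by (simp_all add: evs_def ev_nsc)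
  then show "0 \<in> B lam" "1 \<in> B lam" "cst c \<in> B lam" unfolding B_def by (metis rangeI)+
qed

lemma B_add: "a \<in> B lam \<Longrightarrow> b \<in> B lam \<Longrightarrow> a + b \<in> B lam"
  and B_diff: "a \<in> B lam \<Longrightarrow> b \<in> B lam \<Longrightarrow> a - b \<in> B lam"
  and B_mult: "a \<in> B lam \<Longrightarrow> b \<in> B lam \<Longrightarrow> a * b \<in> B lam"
  unfolding B_def evs_def
  by (auto simp flip: ev_add ev_diff ev_mult)

lemma B_uminus: "a \<in> B lam \<Longrightarrow> - a \<in> B lam"
  using B_diff[OF B_0, of a lam] by simp

lemma B_com: "a \<in> B lam \<Longrightarrow> b \<in> B lam \<Longrightarrow> com a b \<in> B lam"
  by (simp add: com_def B_diff B_mult)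

lemma B_sum: "(\<And>x. x \<in> A \<Longrightarrow> f x \<in> B lam) \<Longrightarrow> sum f A \<in> B lam"
  by (induction A rule: infinite_finite_induct) (auto simp: B_0 B_add)

lemma B_power: "a \<in> B lam \<Longrightarrow> a ^ n \<in> B lam"
  by (induction n) (auto simp: B_1 B_mult)

lemma B_gens: "sX \<in> B lam" "sT \<in> B lam" "sY lam \<in> B lam"
proof -
  have "evs lam nX = sX" "evs lam nY = sY lam" by (simp_all add: evs_def sgen_def)
  then show "sX \<in> B lam" "sT \<in> B lam" "sY lam \<in> B lam"
    using ev_nT unfolding B_def by (metis rangeI)+
qed

lemma B_X_basis: "tmon (int n) (monom 1 j) \<in> B lam"
  and B_Y_basis: "tmon (- int n) (Qp lam n * monom 1 j) \<in> B lam"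
  unfolding B_def evs_X_basis[of lam, symmetric] evs_Y_basis[symmetric] by simp_all

lemma B_induct [consumes 1, case_names X Y add sc]:
  assumes "a \<in> B lam" "\<And>n j. P (tmon (int n) (monom 1 j))"
    "\<And>n j. P (tmon (- int n) (Qp lam n * monom 1 j))"
    "\<And>a b. a \<in> B lam \<Longrightarrow> b \<in> B lam \<Longrightarrow> P a \<Longrightarrow> P b \<Longrightarrow> P (a + b)"
    "\<And>c a. a \<in> B lam \<Longrightarrow> P a \<Longrightarrow> P (cst c * a)"
  shows "P a"
proof -
  have "P (evs lam x)" for x
    using span_nf_UNIV[of x lam]
  proof (induction rule: span_nf.induct)
    case (ideal x)
    have "P (cst 0 * tmon (int 0) (monom 1 0))" by (intro assms(2,5) B_X_basis)
    then show ?case by (simp add: evs_Jid ideal)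
  next
    case (X k j)
    then show ?case using assms(2) by (simp add: evs_X_basis)
  next
    case (Y k j)
    then show ?case using assms(3) by (simp add: evs_Y_basis)
  next
    case (add x y)
    then show ?case using assms(4)[of "evs lam x" "evs lam y"] by (simp add: B_def evs_def ev_add)
  next
    case (sc x c)
    then show ?case using assms(5)[of "evs lam x" c] by (simp add: B_def evs_def ev_nsc)
  qed
  then show ?thesis using assms(1) by (auto simp: B_def)
qed

lemma B_tmon: "a \<in> B lam \<Longrightarrow> tmon k (coef a k) \<in> B lam"
proof (induction rule: B_induct)
  case (X n j)
  show ?case using B_X_basis B_0 by (simp add: coef_tmon)
next
  case (Y n j)
  show ?case using B_Y_basis B_0 by (simp add: coef_tmon)
next
  case (sc c a)
  then show ?case by (simp flip: cst_tmon add: B_mult B_cst)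
qed (simp_all add: tmon_add B_add)

lemma B_dvd: "a \<in> B lam \<Longrightarrow> Qp lam n dvd coef a (- int n)"
proof (induction rule: B_induct)
  case (X m j)
  then show ?case by (cases "n = 0") (auto simp: coef_tmon)
qed (auto simp: coef_tmon dvd_smult)

text \<open>A nonzero multiple of \<open>Qp lam n\<close> has degree at least 2n. This is the cone
  containing all Newton polygons of elements of \<open>B lam\<close>.\<close>

lemma B_degree:
  assumes "a \<in> B lam" "coef a k \<noteq> 0"
  shows "int (degree (coef a k)) \<ge> - 2 * k"
proof (cases "k \<ge> 0")
  case False
  define n where "n = nat (- k)"
  then have k: "k = - int n" using False by simp
  have "degree (Qp lam n) \<le> degree (coef a k)"
    using dvd_imp_degree_le B_dvd[OF assms(1), of n] assms(2) k by blast
  then show ?thesis by (simp add: degree_Qp k)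
qed simp

definition B_hom :: "complex \<Rightarrow> (skew \<Rightarrow> skew) \<Rightarrow> bool" where
  "B_hom lam \<phi> \<longleftrightarrow> (\<forall>a\<in>B lam. \<phi> a \<in> B lam) \<and> \<phi> 1 = 1 \<and>
     (\<forall>a\<in>B lam. \<forall>b\<in>B lam. \<phi> (a + b) = \<phi> a + \<phi> b \<and> \<phi> (a * b) = \<phi> a * \<phi> b) \<and>
     (\<forall>c. \<forall>a\<in>B lam. \<phi> (cst c * a) = cst c * \<phi> a)"

lemma B_homD:
  assumes "B_hom lam \<phi>"
  shows "a \<in> B lam \<Longrightarrow> \<phi> a \<in> B lam" "\<phi> 1 = 1"
    "a \<in> B lam \<Longrightarrow> b \<in> B lam \<Longrightarrow> \<phi> (a + b) = \<phi> a + \<phi> b"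
    "a \<in> B lam \<Longrightarrow> b \<in> B lam \<Longrightarrow> \<phi> (a * b) = \<phi> a * \<phi> b"
    "a \<in> B lam \<Longrightarrow> \<phi> (cst c * a) = cst c * \<phi> a"
  using assms by (auto simp: B_hom_def)

lemma B_hom_0: "B_hom lam \<phi> \<Longrightarrow> \<phi> 0 = 0"
  using B_homD(5)[of lam \<phi> 0 0] B_0 by simp

lemma B_hom_cst: "B_hom lam \<phi> \<Longrightarrow> \<phi> (cst c) = cst c"
  using B_homD(5)[of lam \<phi> 1 c] B_homD(2)[of lam \<phi>] B_1 by simp

lemma B_hom_uminus: "B_hom lam \<phi> \<Longrightarrow> a \<in> B lam \<Longrightarrow> \<phi> (- a) = - \<phi> a"
  using B_homD(5)[of lam \<phi> a "-1"] by (simp add: cst_uminus)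

lemma B_hom_diff: "B_hom lam \<phi> \<Longrightarrow> a \<in> B lam \<Longrightarrow> b \<in> B lam \<Longrightarrow> \<phi> (a - b) = \<phi> a - \<phi> b"
  using B_homD(3)[of lam \<phi> a "- b"] B_hom_uminus[of lam \<phi> b] B_uminus[of b lam] by simp

lemma B_hom_com:
  "B_hom lam \<phi> \<Longrightarrow> a \<in> B lam \<Longrightarrow> b \<in> B lam \<Longrightarrow> \<phi> (com a b) = com (\<phi> a) (\<phi> b)"
  by (simp add: com_def B_hom_diff B_homD B_mult)

lemma B_hom_sum:
  "B_hom lam \<phi> \<Longrightarrow> (\<And>x. x \<in> A \<Longrightarrow> f x \<in> B lam) \<Longrightarrow> \<phi> (sum f A) = (\<Sum>x\<in>A. \<phi> (f x))"
  by (induction A rule: infinite_finite_induct) (auto simp: B_hom_0 B_homD B_sum)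

lemma B_hom_power: "B_hom lam \<phi> \<Longrightarrow> a \<in> B lam \<Longrightarrow> \<phi> (a ^ n) = \<phi> a ^ n"
  by (induction n) (auto simp: B_homD B_power)

lemma B_hom_comp: "B_hom lam \<phi> \<Longrightarrow> B_hom lam \<psi> \<Longrightarrow> B_hom lam (\<lambda>a. \<phi> (\<psi> a))"
  by (simp add: B_hom_def)

lemma B_hom_id: "B_hom lam (\<lambda>a. a)"
  by (simp add: B_hom_def)

lemma B_hom_eqI:
  assumes "B_hom lam \<phi>" "B_hom lam \<psi>"
    and "\<phi> sX = \<psi> sX" "\<phi> sT = \<psi> sT" "\<phi> (sY lam) = \<psi> (sY lam)" and "a \<in> B lam"
  shows "\<phi> a = \<psi> a"
  using assms(6)
proof (induction rule: B_induct)
  case (X n j)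
  have "tmon (int n) (monom 1 j) = sX ^ n * sT ^ j"
    by (simp add: sX_power sT_power tmon_mult)
  then show ?case using assms by (simp add: B_homD B_hom_power B_gens B_power)
next
  case (Y n j)
  have "tmon (- int n) (Qp lam n * monom 1 j) = sY lam ^ n * sT ^ j"
    by (simp add: sY_power sT_power tmon_mult)
  then show ?case using assms by (simp add: B_homD B_hom_power B_gens B_power)
qed (use assms in \<open>simp_all add: B_homD\<close>)

text \<open>An arbitrary preimage under the standard evaluation is evaluated at the new triple. Two
  preimages differ by an element of the ideal, which the new evaluation kills, so the choice is
  harmless.\<close>

lemma B_hom_exists:
  assumes rel: "sl2_rel lam x h y" and "x \<in> B lam" "h \<in> B lam" "y \<in> B lam"
  obtains \<phi> where "B_hom lam \<phi>" "\<phi> sX = x" "\<phi> (cst 2 * sT) = h" "\<phi> (sY lam) = y"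
proof -
  define g where "g = (\<lambda>a. case a of GX \<Rightarrow> x | GH \<Rightarrow> h | GY \<Rightarrow> y)"
  define \<phi> where "\<phi> = (\<lambda>a. ev g (SOME u. evs lam u = a))"
  have \<phi>: "\<phi> (evs lam u) = ev g u" for u
  proof -
    let ?v = "SOME v. evs lam v = evs lam u"
    have "evs lam ?v = evs lam u" by (rule someI) simp
    then have "evs lam (?v - u) = 0" by (simp add: evs_def ev_diff)
    then have "?v - u \<in> Jid lam" by (simp add: evs_eq_0_iff)
    then have "ev g (?v - u) = 0" by (rule ev_Jid[rotated]) (simp add: g_def rel)
    then show ?thesis by (simp add: \<phi>_def ev_diff)
  qed
  have evB: "ev g u \<in> B lam" for u
  proof (induction u rule: ncpoly_induct)
    case (gen a u)
    then show ?case using assms by (cases a) (simp_all add: ev_mult B_mult g_def)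
  qed (simp_all add: B_1 B_add B_mult B_cst ev_add ev_nsc)
  have "B_hom lam \<phi>" unfolding B_hom_def
  proof (intro conjI ballI allI)
    show "\<phi> 1 = 1" using \<phi>[of 1] by (simp add: evs_def)
    fix a assume "a \<in> B lam"
    then obtain u where u: "a = evs lam u" by (auto simp: B_def)
    then show "\<phi> a \<in> B lam" using \<phi> evB by simp
    show "\<phi> (cst c * a) = cst c * \<phi> a" for c
      using \<phi>[of "nsc c u"] \<phi>[of u] u by (simp add: evs_def ev_nsc)
    fix b assume "b \<in> B lam"
    then obtain v where v: "b = evs lam v" by (auto simp: B_def)
    show "\<phi> (a + b) = \<phi> a + \<phi> b" using \<phi>[of "u + v"] \<phi>[of u] \<phi>[of v] u v by (simp add: evs_def ev_add)
    show "\<phi> (a * b) = \<phi> a * \<phi> b" using \<phi>[of "u * v"] \<phi>[of u] \<phi>[of v] u v by (simp add: evs_def ev_mult)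
  qed
  moreover have "\<phi> sX = x" "\<phi> (cst 2 * sT) = h" "\<phi> (sY lam) = y"
    using \<phi>[of nX] \<phi>[of nH] \<phi>[of nY] by (simp_all add: evs_def sgen_def g_def)
  ultimately show ?thesis using that by blast
qed

section \<open>Automorphisms\<close>

definition B_aut :: "complex \<Rightarrow> (skew \<Rightarrow> skew) \<Rightarrow> bool" where
  "B_aut lam \<phi> \<longleftrightarrow> B_hom lam \<phi> \<and>
     (\<exists>\<psi>. B_hom lam \<psi> \<and> (\<forall>a\<in>B lam. \<phi> (\<psi> a) = a \<and> \<psi> (\<phi> a) = a))"

lemma B_aut_hom: "B_aut lam \<phi> \<Longrightarrow> B_hom lam \<phi>"
  by (simp add: B_aut_def)

lemma B_aut_id: "B_aut lam (\<lambda>a. a)"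
  unfolding B_aut_def using B_hom_id by blast

lemma B_aut_comp:
  assumes "B_aut lam \<phi>" "B_aut lam \<psi>"
  shows "B_aut lam (\<lambda>a. \<phi> (\<psi> a))"
proof -
  obtain \<phi>' \<psi>' where "B_hom lam \<phi>'" "\<forall>a\<in>B lam. \<phi> (\<phi>' a) = a \<and> \<phi>' (\<phi> a) = a"
    "B_hom lam \<psi>'" "\<forall>a\<in>B lam. \<psi> (\<psi>' a) = a \<and> \<psi>' (\<psi> a) = a"
    using assms by (auto simp: B_aut_def)
  then have "B_hom lam (\<lambda>a. \<psi>' (\<phi>' a))"
    "\<forall>a\<in>B lam. \<phi> (\<psi> (\<psi>' (\<phi>' a))) = a \<and> \<psi>' (\<phi>' (\<phi> (\<psi> a))) = a"
    using assms B_aut_hom by (auto simp: B_hom_comp B_homD)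
  moreover have "B_hom lam (\<lambda>a. \<phi> (\<psi> a))"
    by (rule B_hom_comp[OF assms[THEN B_aut_hom]])
  ultimately show ?thesis unfolding B_aut_def by blast
qed

definition ad_nilpotent :: "complex \<Rightarrow> skew \<Rightarrow> bool" where
  "ad_nilpotent lam a \<longleftrightarrow> a \<in> B lam \<and> (\<forall>b\<in>B lam. \<exists>n. (com a ^^ n) b = 0)"

lemma B_com_iterate: "a \<in> B lam \<Longrightarrow> b \<in> B lam \<Longrightarrow> (com a ^^ n) b \<in> B lam"
  by (induction n) (simp_all add: B_com)

lemma ad_nilpotent_aut:
  assumes "B_aut lam \<phi>" "ad_nilpotent lam a"
  shows "ad_nilpotent lam (\<phi> a)"
proof -
  obtain \<psi> where \<psi>: "B_hom lam \<psi>" "\<And>a. a \<in> B lam \<Longrightarrow> \<phi> (\<psi> a) = a"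
    using assms(1) by (auto simp: B_aut_def)
  have \<phi>: "B_hom lam \<phi>" and a: "a \<in> B lam" using assms by (auto simp: B_aut_def ad_nilpotent_def)
  have "\<exists>n. (com (\<phi> a) ^^ n) b = 0" if b: "b \<in> B lam" for b
  proof -
    have "(com (\<phi> a) ^^ n) b = \<phi> ((com a ^^ n) (\<psi> b))" for n
      using \<psi> b by (induction n) (simp_all add: B_hom_com[OF \<phi> a B_com_iterate[OF a]] B_homD)
    moreover obtain n where "(com a ^^ n) (\<psi> b) = 0"
      using assms(2) B_homD(1)[OF \<psi>(1) b] unfolding ad_nilpotent_def by blast
    ultimately have "(com (\<phi> a) ^^ n) b = 0" using B_hom_0[OF \<phi>] by simp
    then show ?thesis ..
  qed
  then show ?thesis using B_homD(1)[OF \<phi> a] by (simp add: ad_nilpotent_def)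
qed

lemma coef_com_sT: "coef (com sT a) k = smult (of_int k) (coef a k)"
proof -
  have "coef (com sT a) k = shift k [:0, 1:] * coef a k - coef a k * [:0, 1:]"
    unfolding sT_def coef_com_tmon_left by simp
  also have "\<dots> = smult (of_int k) (coef a k)"
    by (rule poly_ext) (simp add: algebra_simps)
  finally show ?thesis .
qed

text \<open>X and Y are exchanged and theta is negated. Since T^l p is an eigenvector of ad theta
  with eigenvalue l, its image has eigenvalue -l, so the exponents of T are reversed.\<close>

lemma swap_aut:
  obtains \<phi> where "B_aut lam \<phi>" "\<And>a k. a \<in> B lam \<Longrightarrow> coef (\<phi> a) k \<noteq> 0 \<Longrightarrow> coef a (- k) \<noteq> 0"
proof -
  define h where "h = cst 2 * sT"
  have h: "h \<in> B lam" by (simp add: h_def B_mult B_cst B_gens)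
  have r: "com sX (sY lam) = h" "com h sX = cst 2 * sX" "com h (sY lam) = - (cst 2 * sY lam)"
     "cst 2 * (sY lam * sX) + cst (1/2) * (h * h) + h = cst ((lam\<^sup>2 - 1) / 2)"
    using sl2_rel_sgen[of lam] by (simp_all add: sl2_rel_def h_def)
  have "sl2_rel lam (sY lam) (- h) sX"
    unfolding sl2_rel_def
  proof (intro conjI)
    have xy: "sX * sY lam = sY lam * sX + h" using r(1) by (simp add: com_def algebra_simps)
    have "cst 2 * h = h + h" by (simp add: cst_numeral mult_2)
    then show "cst 2 * (sX * sY lam) + cst (1/2) * (- h * - h) + - h = cst ((lam\<^sup>2 - 1) / 2)"
      unfolding xy r(4)[symmetric] by (simp add: distrib_left)
  qed (use r in \<open>simp_all add: com_def algebra_simps\<close>)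
  then obtain \<phi> where \<phi>: "B_hom lam \<phi>" "\<phi> sX = sY lam" "\<phi> (cst 2 * sT) = - h" "\<phi> (sY lam) = sX"
    using B_hom_exists h B_gens B_uminus by metis
  have "\<phi> sT = \<phi> (cst (1/2) * h)" by (simp add: h_def flip: mult.assoc cst_mult)
  also have "\<dots> = - sT" using \<phi>(3) B_homD(5)[OF \<phi>(1) h, of "1/2"]
    by (simp add: h_def flip: mult.assoc cst_mult)
  finally have \<phi>T: "\<phi> sT = - sT" .
  have inv: "\<phi> (\<phi> a) = a" if "a \<in> B lam" for a
    by (rule B_hom_eqI[OF B_hom_comp[OF \<phi>(1) \<phi>(1)] B_hom_id])
      (simp_all add: \<phi> \<phi>T that B_hom_uminus[OF \<phi>(1)] B_gens)
  then have "B_aut lam \<phi>" using \<phi>(1) by (auto simp: B_aut_def)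
  moreover have "coef a (- k) \<noteq> 0" if a: "a \<in> B lam" and k: "coef (\<phi> a) k \<noteq> 0" for a k
  proof -
    have hom: "coef (\<phi> (tmon l (coef a l))) k = 0" if "l \<noteq> - k" for l
    proof -
      let ?b = "tmon l (coef a l)"
      have b: "?b \<in> B lam" using a by (rule B_tmon)
      have "com sT ?b = cst (of_int l) * ?b"
        by (rule skew_eqI) (simp add: coef_com_sT coef_tmon)
      then have "com (- sT) (\<phi> ?b) = cst (of_int l) * \<phi> ?b"
        using B_hom_com[OF \<phi>(1) B_gens(2) b] B_homD(5)[OF \<phi>(1) b] \<phi>T by simp
      moreover have "com (- sT) (\<phi> ?b) = - com sT (\<phi> ?b)" by (simp add: com_def)
      ultimately have "smult (of_int (- k)) (coef (\<phi> ?b) k) = smult (of_int l) (coef (\<phi> ?b) k)"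
        by (metis coef_cst_mult coef_com_sT coef_uminus of_int_minus smult_minus_left)
      then have "smult (of_int (- k) - of_int l) (coef (\<phi> ?b) k) = 0"
        by (simp add: smult_diff_left)
      moreover have "of_int (- k) - of_int l \<noteq> (0::complex)"
        using that by (metis eq_iff_diff_eq_0 of_int_eq_iff)
      ultimately show ?thesis by simp
    qed
    have "\<phi> a = (\<Sum>l | coef a l \<noteq> 0. \<phi> (tmon l (coef a l)))"
      by (subst skew_expand[of a], rule B_hom_sum[OF \<phi>(1)]) (rule B_tmon[OF a])
    then have "coef (\<phi> a) k = (\<Sum>l | coef a l \<noteq> 0. coef (\<phi> (tmon l (coef a l))) k)"
      by (simp add: coef_sum)
    then obtain l where "coef a l \<noteq> 0" "coef (\<phi> (tmon l (coef a l))) k \<noteq> 0"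
      using k by (metis (mono_tags, lifting) mem_Collect_eq sum.neutral)
    then show ?thesis using hom by metis
  qed
  ultimately show ?thesis using that by blast
qed

text \<open>T^(-1) exists in the Laurent ring but not in the image algebra, so membership in
  \<open>B lam\<close> of anything built with it needs an argument.\<close>

definition sI :: skew where "sI = tmon (- 1) 1"

lemma sX_sI: "sX * sI = 1" "sI * sX = 1"
  by (simp_all add: sX_def sI_def tmon_mult one_skew_def)

lemma sX_cancel_right: "a * sX = b * sX \<Longrightarrow> a = b"
  by (metis mult.assoc mult.right_neutral sX_sI(1))

lemma sT_sX: "sT * sX = sX * sT + sX"
  by (simp add: sT_def sX_def tmon_mult shift_def pcompose_pCons flip: tmon_add)
    (simp add: one_pCons)

lemma sY_sX: "sY lam * sX = cst ((lam\<^sup>2 - 1) / 4) - sT * sT - sT"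
proof -
  have "qpoly lam \<circ>\<^sub>p [:1, 1:] = [:(lam\<^sup>2 - 1) / 4:] - [:0, 1:] * [:0, 1:] - [:0, 1:]"
    by (rule poly_ext) (simp add: poly_pcompose qpoly_def field_simps power2_eq_square)
  then show ?thesis
    by (simp add: sY_def sX_def sT_def cst_def tmon_mult shift_def flip: tmon_diff)
qed

lemma sT_sI: "sI * sT = sT * sI + sI"
proof -
  have "sI * (sT * sX) * sI = sI * (sX * sT + sX) * sI" by (simp add: sT_sX)
  then show ?thesis by (simp add: algebra_simps) (metis (no_types, lifting) mult.assoc mult.left_neutral mult.right_neutral sX_sI)
qed

text \<open>YX is a polynomial in theta and X can be cancelled, so the values at X and theta
  determine the value at Y.\<close>

lemma B_hom_fix:
  assumes "B_hom lam \<chi>" "\<chi> sX = sX" "\<chi> sT = sT" "a \<in> B lam"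
  shows "\<chi> a = a"
proof -
  have "\<chi> (sY lam) * sX = \<chi> (sY lam * sX)" using assms B_homD B_gens by metis
  also have "\<dots> = sY lam * sX" unfolding sY_sX
    using assms by (simp add: B_hom_diff B_homD B_hom_cst B_gens B_mult B_cst B_diff)
  finally have "\<chi> (sY lam) = sY lam" by (rule sX_cancel_right)
  then show ?thesis using B_hom_eqI[OF assms(1) B_hom_id] assms by blast
qed

text \<open>The image \<open>y\<close> of Y is forced: the Casimir relation prescribes y X, and the
  Laurent ring allows solving for \<open>y\<close>. The factor X in the translation X G keeps
  \<open>y\<close> in the image algebra, because X G T^(-1) = G. For G a polynomial in X this is the
  exponential of ad f(X) with G = -f'(X).\<close>

lemma translate_hom:
  assumes G: "G \<in> B lam" "G * sX = sX * G"
  obtains \<phi> where "B_hom lam \<phi>" "\<phi> sX = sX" "\<phi> sT = sT + sX * G"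
proof -
  define F where "F = sX * G"
  define t where "t = sT + F"
  define r where "r = cst ((lam\<^sup>2 - 1) / 4) - t * t - t"
  define y where "y = r * sI"
  have FI: "F * sI = G" by (simp add: F_def mult.assoc sX_sI flip: G(2))
  have FB: "F \<in> B lam" by (simp add: F_def B_mult B_gens G)
  have FX: "F * sX = sX * F" by (simp add: F_def mult.assoc G(2))
  have tX: "sX * t = t * sX - sX" by (simp add: t_def distrib_left distrib_right FX sT_sX)
  have It: "sI * t = t * sI + sI"
  proof -
    have "F * sI = sI * F" using FI by (simp add: F_def sX_sI flip: mult.assoc)
    then show ?thesis by (simp add: t_def distrib_left distrib_right sT_sI)
  qed
  have Xr: "sX * r = (cst ((lam\<^sup>2 - 1) / 4) - t * t + t) * sX"
  proof -
    have "sX * (t * t) = t * (t * sX) - t * sX - t * sX + sX"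
      by (simp add: tX right_diff_distrib left_diff_distrib mult.assoc flip: mult.assoc[of sX t t])
    then show ?thesis
      by (simp add: r_def right_diff_distrib left_diff_distrib distrib_right tX mult.assoc cst_commute)
  qed
  have yX: "y * sX = r" by (simp add: y_def mult.assoc sX_sI)
  have "com sX y = cst 2 * t"
  proof -
    have "sX * y = cst ((lam\<^sup>2 - 1) / 4) - t * t + t"
      using Xr by (simp add: y_def mult.assoc sX_sI flip: mult.assoc[of sX r sI])
    then show ?thesis unfolding com_def yX by (simp add: r_def cst_numeral mult_2)
  qed
  moreover have "com (cst 2 * t) sX = cst 2 * sX"
    unfolding com_cst_left by (simp add: com_def tX)
  moreover have "com (cst 2 * t) y = - (cst 2 * y)"
  proof -
    have "y * t = r * t * sI + y" by (simp add: y_def mult.assoc It distrib_left)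
    moreover have "t * r = r * t"
      by (simp add: r_def right_diff_distrib left_diff_distrib mult.assoc cst_commute)
    ultimately have "com t y = - y" by (simp add: com_def y_def flip: mult.assoc)
    then show ?thesis unfolding com_cst_left by simp
  qed
  moreover have "cst 2 * (y * sX) + cst (1/2) * ((cst 2 * t) * (cst 2 * t)) + cst 2 * t = cst ((lam\<^sup>2 - 1) / 2)"
  proof -
    have "(cst 2 * t) * (cst 2 * t) = cst 4 * (t * t)"
      by (simp add: mult.assoc cst_left_commute[of t] flip: cst_mult mult.assoc[of "cst 2" "cst 2"])
    then have "cst (1/2) * ((cst 2 * t) * (cst 2 * t)) = cst 2 * (t * t)"
      by (simp flip: mult.assoc cst_mult)
    moreover have "cst 2 * cst ((lam\<^sup>2 - 1) / 4) = cst ((lam\<^sup>2 - 1) / 2)"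
      unfolding cst_mult[symmetric] by (rule arg_cong[where f = cst]) (simp add: field_simps)
    ultimately show ?thesis unfolding yX r_def by (simp add: right_diff_distrib)
  qed
  ultimately have rel: "sl2_rel lam sX (cst 2 * t) y" by (simp add: sl2_rel_def)
  have tB: "t \<in> B lam" by (simp add: t_def B_add B_gens FB)
  \<comment> \<open>Expanding r T^(-1) exhibits \<open>y\<close> as Y minus products of elements of
    \<open>B lam\<close>, with every T^(-1) absorbed.\<close>
  have "y = sY lam - (sT * G + (G * sT - G) + F * G + G)"
  proof -
    have "(cst ((lam\<^sup>2 - 1) / 4) - sT * sT - sT) * sI = sY lam"
      by (simp add: mult.assoc sX_sI flip: sY_sX)
    moreover have "r = (cst ((lam\<^sup>2 - 1) / 4) - sT * sT - sT) - (sT * F + F * sT + F * F + F)"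
      by (simp add: r_def t_def algebra_simps)
    moreover have "F * sT * sI = G * sT - G"
    proof -
      have "sT * sI = sI * sT - sI" by (simp add: sT_sI)
      then show ?thesis using FI by (simp add: mult.assoc right_diff_distrib) (simp flip: mult.assoc)
    qed
    ultimately show ?thesis unfolding y_def by (simp add: left_diff_distrib distrib_right mult.assoc FI)
  qed
  then have yB: "y \<in> B lam" by (simp add: B_add B_diff B_mult B_gens G FB)
  obtain \<phi> where \<phi>: "B_hom lam \<phi>" "\<phi> sX = sX" "\<phi> (cst 2 * sT) = cst 2 * t"
    using B_hom_exists[OF rel B_gens(1) _ yB] B_mult[OF B_cst tB] by metis
  have "\<phi> sT = \<phi> (cst (1/2) * (cst 2 * sT))" by (simp flip: mult.assoc cst_mult)
  also have "\<dots> = t" using B_homD(5)[OF \<phi>(1), of "cst 2 * sT" "1/2"] \<phi>(3)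
    by (simp add: B_mult B_cst B_gens flip: mult.assoc cst_mult)
  finally show ?thesis using that \<phi> by (simp add: t_def F_def)
qed

lemma translate_aut:
  obtains \<phi> where "B_aut lam \<phi>" "\<phi> sX = sX" "\<phi> sT = sT + sX * (\<Sum>i\<in>A. cst (c i) * sX ^ (i :: nat))"
proof -
  define G where "G = (\<Sum>i\<in>A. cst (c i) * sX ^ i)"
  have GB: "G \<in> B lam" by (simp add: G_def B_sum B_mult B_cst B_power B_gens)
  have GX: "G * sX = sX * G"
    by (simp add: G_def sum_distrib_left sum_distrib_right mult.assoc cst_left_commute power_commutes)
  have fixG: "\<phi> G = G" if "B_hom lam \<phi>" "\<phi> sX = sX" for \<phi>
    using that by (simp add: G_def B_hom_sum B_homD B_mult B_cst B_power B_gens B_hom_power B_hom_cst)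
  obtain \<phi> where \<phi>: "B_hom lam \<phi>" "\<phi> sX = sX" "\<phi> sT = sT + sX * G"
    using translate_hom[OF GB GX] by blast
  obtain \<psi> where \<psi>: "B_hom lam \<psi>" "\<psi> sX = sX" "\<psi> sT = sT + sX * (- G)"
    using translate_hom[of "- G" lam] B_uminus[OF GB] GX by auto
  have XG: "sX * G \<in> B lam" by (simp add: B_mult B_gens GB)
  have "\<phi> (\<psi> a) = a" if "a \<in> B lam" for a
    by (rule B_hom_fix[OF B_hom_comp[OF \<phi>(1) \<psi>(1)] _ _ that])
      (simp_all add: \<phi> \<psi> B_hom_diff[OF \<phi>(1)] B_gens XG B_homD[OF \<phi>(1)] GB fixG)
  moreover have "\<psi> (\<phi> a) = a" if "a \<in> B lam" for a
    by (rule B_hom_fix[OF B_hom_comp[OF \<psi>(1) \<phi>(1)] _ _ that])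
      (simp_all add: \<phi> \<psi> B_gens XG B_homD[OF \<psi>(1)] GB fixG)
  ultimately have "B_aut lam \<phi>" using \<phi>(1) \<psi>(1) by (auto simp: B_aut_def)
  then show ?thesis using that \<phi> by (simp add: G_def)
qed

section \<open>Substitution for theta with T fixed\<close>

definition pev :: "skew \<Rightarrow> complex poly \<Rightarrow> skew" where
  "pev t p = (\<Sum>i\<le>degree p. cst (coeff p i) * t ^ i)"

lemma pev_upto: "degree p \<le> N \<Longrightarrow> pev t p = (\<Sum>i\<le>N. cst (coeff p i) * t ^ i)"
  unfolding pev_def by (rule sum.mono_neutral_left) (auto simp: coeff_eq_0)

lemma pev_0 [simp]: "pev t 0 = 0"
  by (simp add: pev_def)

lemma pev_add: "pev t (p + q) = pev t p + pev t q"
  using pev_upto[of p "max (degree p) (degree q)" t] pev_upto[of q "max (degree p) (degree q)" t]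
    pev_upto[of "p + q" "max (degree p) (degree q)" t]
  by (simp add: degree_add_le_max cst_add distrib_right sum.distrib)

lemma pev_monom: "pev t (monom c i) = cst c * t ^ i"
proof -
  have "pev t (monom c i) = (\<Sum>j\<le>i. if j = i then cst c * t ^ i else 0)"
    unfolding pev_upto[OF degree_monom_le] by (rule sum.cong) auto
  then show ?thesis by simp
qed

lemma pev_sT: "pev sT p = tmon 0 p"
proof -
  have tsum: "tmon 0 (sum g A) = (\<Sum>i\<in>A. tmon 0 (g i))" for g and A :: "nat set"
    by (induction A rule: infinite_finite_induct) (auto simp: tmon_add)
  have "pev sT p = (\<Sum>i\<le>degree p. tmon 0 (monom (coeff p i) i))"
    by (simp add: pev_def sT_power cst_tmon smult_monom)
  also have "\<dots> = tmon 0 p" by (simp add: poly_as_sum_of_monoms flip: tsum)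
  finally show ?thesis .
qed

text \<open>Defined on the whole Laurent ring, whereas automorphisms act only on B. This permits
  computing symbols monomial by monomial even where the single monomials, such as T^(-1), lie
  outside B.\<close>

definition subst_sT :: "skew \<Rightarrow> skew \<Rightarrow> skew" where
  "subst_sT t a = (\<Sum>k | coef a k \<noteq> 0. tmon k 1 * pev t (coef a k))"

lemma subst_sT_superset:
  assumes "finite A" "{k. coef a k \<noteq> 0} \<subseteq> A"
  shows "subst_sT t a = (\<Sum>k\<in>A. tmon k 1 * pev t (coef a k))"
  unfolding subst_sT_def by (rule sum.mono_neutral_left) (use assms in auto)

lemma subst_sT_add: "subst_sT t (a + b) = subst_sT t a + subst_sT t b"
proof -
  let ?A = "{k. coef a k \<noteq> 0} \<union> {k. coef b k \<noteq> 0}"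
  have "subst_sT t (a + b) = (\<Sum>k\<in>?A. tmon k 1 * pev t (coef (a + b) k))"
    by (rule subst_sT_superset) auto
  moreover have "subst_sT t a = (\<Sum>k\<in>?A. tmon k 1 * pev t (coef a k))"
    by (rule subst_sT_superset) auto
  moreover have "subst_sT t b = (\<Sum>k\<in>?A. tmon k 1 * pev t (coef b k))"
    by (rule subst_sT_superset) auto
  ultimately show ?thesis by (simp add: pev_add distrib_left sum.distrib)
qed

lemma subst_sT_tmon: "subst_sT t (tmon k p) = tmon k 1 * pev t p"
  by (subst subst_sT_superset[of "{k}"]) (auto simp: coef_tmon)

lemma B_hom_pev: "B_hom lam \<phi> \<Longrightarrow> \<phi> (pev sT p) = pev (\<phi> sT) p"
  by (simp add: pev_def B_hom_sum B_homD B_hom_cst B_hom_power B_mult B_cst B_power B_gens)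

lemma B_hom_subst_sT:
  assumes \<phi>: "B_hom lam \<phi>" "\<phi> sX = sX" and a: "a \<in> B lam"
  shows "\<phi> a = subst_sT (\<phi> sT) a"
proof -
  have "\<phi> (tmon k (coef a k)) = tmon k 1 * pev (\<phi> sT) (coef a k)" for k
  proof (cases "k \<ge> 0")
    case True
    have "pev sT (coef a k) \<in> B lam"
      by (simp add: pev_def B_sum B_mult B_cst B_power B_gens)
    moreover have "tmon k (coef a k) = sX ^ nat k * pev sT (coef a k)"
      using True by (simp add: sX_power pev_sT tmon_mult)
    ultimately have "\<phi> (tmon k (coef a k)) = sX ^ nat k * pev (\<phi> sT) (coef a k)"
      using \<phi> by (simp add: B_homD B_hom_power B_hom_pev B_power B_gens)
    then show ?thesis using True by (simp add: sX_power)
  next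
    case False
    define n where "n = nat (- k)"
    have k: "k = - int n" using False by (simp add: n_def)
    \<comment> \<open>T^(-n) alone is not in B, so the component is first multiplied by X^n to
      become a polynomial in theta. The factor is cancelled afterwards in the Laurent ring.\<close>
    have "sX ^ n * tmon k (coef a k) = pev sT (coef a k)"
      by (simp add: sX_power pev_sT tmon_mult k)
    then have "sX ^ n * \<phi> (tmon k (coef a k)) = pev (\<phi> sT) (coef a k)"
      using \<phi> B_tmon[OF a, of k] by (metis B_homD(4) B_hom_pev B_hom_power B_gens(1) B_power)
    then have "tmon k 1 * (sX ^ n * \<phi> (tmon k (coef a k))) = tmon k 1 * pev (\<phi> sT) (coef a k)"
      by simp
    moreover have "tmon k 1 * sX ^ n = 1" by (simp add: sX_power tmon_mult k one_skew_def)
    ultimately show ?thesis by (simp flip: mult.assoc)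
  qed
  moreover have "\<phi> a = (\<Sum>k | coef a k \<noteq> 0. \<phi> (tmon k (coef a k)))"
    by (subst skew_expand[of a], rule B_hom_sum[OF \<phi>(1)]) (rule B_tmon[OF a])
  ultimately show ?thesis by (simp add: subst_sT_def)
qed

lemma wle_less_symb:
  assumes "wle \<alpha> d a" "d < e" "\<alpha> \<noteq> 0"
  shows "wle \<alpha> e a" "symb \<alpha> e a = 0"
proof -
  show "wle \<alpha> e a" using assms(1,2) unfolding wle_def by fastforce
  have "coeff (symb \<alpha> e a) j = 0" for j
  proof (rule ccontr)
    assume "coeff (symb \<alpha> e a) j \<noteq> 0"
    then obtain k where "\<alpha> * of_int k + of_nat j = e" "coeff (coef a k) j \<noteq> 0"
      using coeff_symb_nonzeroD assms(3) by blast
    then show False using assms(1,2) unfolding wle_def by fastforce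
  qed
  then show "symb \<alpha> e a = 0" by (intro poly_eqI) simp
qed

text \<open>Because \<alpha> m = 1, the element theta + z X^m is homogeneous of weight 1 with symbol
  theta + z. The substitution therefore translates symbols by z.\<close>

lemma subst_sT_symbol:
  assumes \<alpha>: "\<alpha> \<noteq> 0" and t: "t = sT + cst z * sX ^ m" "\<alpha> * real m = 1" and a: "wle \<alpha> d a"
  shows "wle \<alpha> d (subst_sT t a) \<and> symb \<alpha> d (subst_sT t a) = pcompose (symb \<alpha> d a) [:z, 1:]"
  using a
proof (induction rule: wle_induct)
  case (monom k i c)
  have T: "wle \<alpha> 1 sT" "symb \<alpha> 1 sT = [:0, 1:]"
    using wle_tmon_monom[of \<alpha> 1 0 1 1] symb_tmon_monom[OF \<alpha>, of 1 0 1 1]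
    by (simp_all add: sT_def monom_Suc monom_0)
  have Xm: "wle \<alpha> 1 (cst z * sX ^ m)" "symb \<alpha> 1 (cst z * sX ^ m) = [:z:]"
    using wle_tmon_monom[of \<alpha> 1 "int m" z 0] symb_tmon_monom[OF \<alpha>, of 1 "int m" z 0] t(2)
    by (simp_all add: sX_power cst_tmon monom_0)
  have tt: "wle \<alpha> 1 t" "symb \<alpha> 1 t = [:z, 1:]"
    using T Xm by (simp_all add: t(1) wle_add symb_add)
  have ti: "wle \<alpha> (real i) (t ^ i) \<and> symb \<alpha> (real i) (t ^ i) = [:z, 1:] ^ i" for i
  proof (induction i)
    case 0
    show ?case using wle_tmon_monom[of \<alpha> 0 0 1 0] symb_tmon_monom[OF \<alpha>, of 0 0 1 0]
      by (simp add: one_skew_def monom_0 pCons_one)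
  next
    case (Suc i)
    then show ?case using mult_symbol[OF \<alpha> tt(1), of "real i" "t ^ i"] tt(2) by (simp add: add.commute)
  qed
  have "wle \<alpha> (\<alpha> * of_int k) (tmon k [:c:])" "symb \<alpha> (\<alpha> * of_int k) (tmon k [:c:]) = [:c:]"
    using wle_tmon_monom[of \<alpha> "\<alpha> * of_int k" k c 0] symb_tmon_monom[OF \<alpha>, of "\<alpha> * of_int k" k c 0]
    by (simp_all add: monom_0)
  then have *: "wle \<alpha> (\<alpha> * of_int k + real i) (tmon k [:c:] * t ^ i)"
    "symb \<alpha> (\<alpha> * of_int k + real i) (tmon k [:c:] * t ^ i) = smult c ([:z, 1:] ^ i)"
    using mult_symbol[OF \<alpha> _ ti[THEN conjunct1, of i], of "\<alpha> * of_int k" "tmon k [:c:]"] ti[of i] by simp_all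
  have eq: "subst_sT t (tmon k (monom c i)) = tmon k [:c:] * t ^ i"
    by (simp add: subst_sT_tmon pev_monom cst_def tmon_mult flip: mult.assoc)
  have pc: "pcompose (monom c i) [:z, 1:] = smult c ([:z, 1:] ^ i)"
  proof -
    have "pcompose ([:0, 1:] ^ i) [:z, 1:] = [:z, 1:] ^ i"
      by (induction i) (simp_all add: pcompose_mult pcompose_pCons pcompose_1)
    then show ?thesis by (simp add: monom_altdef pcompose_smult)
  qed
  show ?case
  proof (cases "\<alpha> * of_int k + real i = d")
    case True
    then show ?thesis using * by (simp add: eq symb_tmon_monom[OF \<alpha>] pc)
  next
    case False
    then have "\<alpha> * of_int k + real i < d" using monom by simp
    then show ?thesis using wle_less_symb[OF *(1) _ \<alpha>, of d] False
      by (simp add: eq symb_tmon_monom[OF \<alpha>])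
  qed
next
  case (add a b)
  then show ?case by (simp add: subst_sT_add wle_add symb_add pcompose_add)
qed (simp add: subst_sT_def)

text \<open>A lower bound for the exponents of T. It complements the weights, which bound the Newton
  polygon from the other side.\<close>

definition lo :: "int \<Rightarrow> skew \<Rightarrow> bool" where "lo n a \<longleftrightarrow> (\<forall>k<n. coef a k = 0)"

lemma lo_add: "lo n a \<Longrightarrow> lo n b \<Longrightarrow> lo n (a + b)"
  by (simp add: lo_def)

lemma lo_0 [simp]: "lo n 0"
  by (simp add: lo_def)

lemma lo_sum: "(\<And>x. x \<in> A \<Longrightarrow> lo n (f x)) \<Longrightarrow> lo n (sum f A)"
  by (induction A rule: infinite_finite_induct) (auto simp: lo_add)

lemma lo_mult:
  assumes "lo n a" "lo m b"
  shows "lo (n + m) (a * b)"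
proof -
  have "n \<le> k" "m \<le> l" if "coef a k \<noteq> 0" "coef b l \<noteq> 0" for k l
    using that assms unfolding lo_def by (metis not_le)+
  then have "lo (n + m) (tmon (k + l) (shift l (coef a k) * coef b l))"
    if "coef a k \<noteq> 0" "coef b l \<noteq> 0" for k l
    using that by (force simp: lo_def coef_tmon)
  then show ?thesis unfolding times_skew_def by (intro lo_sum) auto
qed

lemma lo_tmon: "n \<le> k \<Longrightarrow> lo n (tmon k p)"
  by (auto simp: lo_def coef_tmon)

lemma lo_cst: "lo 0 (cst c)"
  by (simp add: cst_def lo_tmon)

lemma lo_power: "lo 0 a \<Longrightarrow> lo 0 (a ^ n)"
  using lo_mult[of 0 a 0] by (induction n) (auto simp: lo_tmon one_skew_def)

lemma lo_subst_sT:
  assumes "lo n a" "lo 0 t"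
  shows "lo n (subst_sT t a)"
proof -
  have "lo 0 (pev t p)" for p
    unfolding pev_def using lo_mult[OF lo_cst lo_power[OF assms(2)]] by (intro lo_sum) simp
  moreover have "lo n (tmon k 1)" if "coef a k \<noteq> 0" for k
    using that assms(1) by (intro lo_tmon) (meson lo_def not_le)
  ultimately show ?thesis unfolding subst_sT_def using lo_mult[of n _ 0] by (intro lo_sum) auto
qed

section \<open>Locally ad-nilpotent elements\<close>

lemma ad_nilpotentD:
  assumes "ad_nilpotent lam a" "b \<in> B lam"
  obtains n where "(com a ^^ n) b = 0"
  using assms by (auto simp: ad_nilpotent_def)

text \<open>With \<alpha> above all theta-degrees the highest power of T dominates and the symbol is
  c theta^J. Its root 0 has order J, and J \<le> \<alpha> m + J = d, so for J > 0 the brackets with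
  X never vanish.\<close>

lemma top_coef_constant:
  assumes a: "ad_nilpotent lam a" and m: "coef a (int m) \<noteq> 0" "\<And>k. coef a k \<noteq> 0 \<Longrightarrow> k \<le> int m"
  shows "degree (coef a (int m)) = 0"
proof (rule ccontr)
  define J where "J = degree (coef a (int m))"
  assume "degree (coef a (int m)) \<noteq> 0"
  then have J: "J > 0" by (simp add: J_def)
  obtain N where N: "\<And>k. degree (coef a k) \<le> N" using degree_coef_bounded by blast
  define \<alpha> where "\<alpha> = 1 + real N"
  have \<alpha>: "\<alpha> > 0" by (simp add: \<alpha>_def)
  define d where "d = \<alpha> * real m + real J"
  have low: "\<alpha> * of_int k + real j < d" if "coeff (coef a k) j \<noteq> 0" "k \<noteq> int m" for k j
  proof -
    have "coef a k \<noteq> 0" using that(1) by auto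
    then have "k \<le> int m - 1" using m(2)[of k] that(2) by linarith
    then have "real_of_int k \<le> real m - 1" by linarith
    then have "\<alpha> * of_int k \<le> \<alpha> * (real m - 1)" using \<alpha> by (intro mult_left_mono) auto
    moreover have "j \<le> N" using le_degree[OF that(1)] N[of k] by linarith
    ultimately show ?thesis using J by (simp add: d_def \<alpha>_def algebra_simps)
  qed
  have wle: "wle \<alpha> d a"
    unfolding wle_def
  proof (intro allI impI)
    fix k j assume kj: "coeff (coef a k) j \<noteq> 0"
    show "\<alpha> * of_int k + real j \<le> d"
    proof (cases "k = int m")
      case True
      then show ?thesis using le_degree[OF kj] by (simp add: d_def J_def)
    next
      case False
      then show ?thesis using low[OF kj] by simp
    qed
  qed
  define c where "c = lead_coeff (coef a (int m))"
  have c: "c \<noteq> 0" using m(1) by (simp add: c_def)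
  have P: "symb \<alpha> d a = monom c J"
  proof (rule poly_eqI)
    fix j
    show "coeff (symb \<alpha> d a) j = coeff (monom c J) j"
    proof (cases "j = J")
      case True
      have "coeff (symb \<alpha> d a) J = coeff (coef a (int m)) J"
        by (rule coeff_symb) (use \<alpha> in \<open>simp_all add: d_def\<close>)
      then show ?thesis using True by (simp add: c_def J_def)
    next
      case False
      have "coeff (symb \<alpha> d a) j = 0"
      proof (rule ccontr)
        assume "coeff (symb \<alpha> d a) j \<noteq> 0"
        then obtain k where k: "\<alpha> * of_int k + real j = d" "coeff (coef a k) j \<noteq> 0"
          using coeff_symb_nonzeroD \<alpha> by (metis less_irrefl)
        then have "k = int m" using low by fastforce
        then show False using k(1) False by (simp add: d_def)
      qed
      then show ?thesis using False by simp
    qed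
  qed
  have ord: "order 0 (monom c J) = J" using c by (rule order_0_monom)
  obtain n where "(com a ^^ n) sX = 0" using ad_nilpotentD[OF a B_gens(1)] .
  moreover have "(com a ^^ n) (tmon 1 1) \<noteq> 0"
  proof (rule com_iterates_nonzero_root[OF \<alpha> wle])
    show "symb \<alpha> d a \<noteq> 0" using c by (simp add: P)
    show "order 0 (symb \<alpha> d a) \<noteq> 0" "real (order 0 (symb \<alpha> d a)) \<le> d"
      unfolding P ord using J \<alpha> by (simp_all add: d_def)
  qed
  ultimately show False by (simp add: sX_def)
qed

text \<open>The vertex (m, 0) is removed. The edge polynomial leaving it turns out to be a multiple
  of (theta - z)^J, and replacing theta by theta + z T^t turns it into a multiple of theta^J. As t >
  0, the lower bound -n for the exponents survives.\<close>

lemma reduce_step: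
  assumes a: "ad_nilpotent lam a"
    and supp: "\<And>k. coef a k \<noteq> 0 \<Longrightarrow> - int n \<le> k \<and> k \<le> int m" and nm: "n \<le> m"
    and nonconst: "degree (coef a k0) \<noteq> 0"
  obtains \<phi> where "B_aut lam \<phi>" "m > 0"
    "\<And>k. coef (\<phi> a) k \<noteq> 0 \<Longrightarrow> - int n \<le> k \<and> k \<le> int (m - 1)"
proof (cases "coef a (int m) = 0")
  case True
  have "coef a k0 \<noteq> 0" using nonconst by auto
  from supp[OF this] have k0: "- int n \<le> k0" "k0 \<le> int m" by auto
  have "m \<noteq> 0"
  proof
    assume "m = 0"
    then have "k0 = int m" using k0 nm by simp
    then show False using True nonconst by simp
  qed
  moreover have "k \<le> int (m - 1)" if "coef a k \<noteq> 0" for k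
  proof -
    have "k \<noteq> int m" using that True by auto
    then show ?thesis using supp[OF that] \<open>m \<noteq> 0\<close> by linarith
  qed
  ultimately show ?thesis using that[OF B_aut_id] supp by blast
next
  case False
  have aB: "a \<in> B lam" using a by (simp add: ad_nilpotent_def)
  have am: "degree (coef a (int m)) = 0" using top_coef_constant[OF a False] supp by blast
  \<comment> \<open>These ratios belong to the segments from (m, 0) to the points (k, degree). With
    the largest one as \<alpha>, the line of weight d supports the polygon along an edge at (m,
    0).\<close>
  define S where "S = (\<lambda>k. real (degree (coef a k)) / (real m - of_int k)) ` {k. coef a k \<noteq> 0 \<and> k < int m}"
  have finS: "finite S" unfolding S_def by (rule finite_imageI, rule finite_subset[OF _ finite_coef[of a]]) auto
  have k0': "coef a k0 \<noteq> 0" using nonconst by auto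
  have "k0 \<noteq> int m" using nonconst am by auto
  then have k0: "k0 < int m" "coef a k0 \<noteq> 0" using supp[OF k0'] k0' by auto
  then have k0S: "real (degree (coef a k0)) / (real m - of_int k0) \<in> S" by (auto simp: S_def)
  define s where "s = Max S"
  have sS: "s \<in> S" unfolding s_def using finS k0S by (intro Max_in) auto
  have smax: "x \<le> s" if "x \<in> S" for x unfolding s_def using finS that by simp
  have "real m - of_int k0 > 0" using k0(1) by linarith
  then have "real (degree (coef a k0)) / (real m - of_int k0) > 0" using nonconst by simp
  then have s: "s > 0" using smax[OF k0S] by linarith
  then have s0: "s \<noteq> 0" by simp
  obtain k1 where k1: "s = real (degree (coef a k1)) / (real m - of_int k1)" "coef a k1 \<noteq> 0" "k1 < int m"
    using sS by (auto simp: S_def)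
  define d where "d = s * real m"
  have wle: "wle s d a"
    unfolding wle_def
  proof (intro allI impI)
    fix k j assume kj: "coeff (coef a k) j \<noteq> 0"
    then have "coef a k \<noteq> 0" by auto
    show "s * of_int k + real j \<le> d"
    proof (cases "k = int m")
      case True
      then show ?thesis using le_degree[OF kj] am by (simp add: d_def)
    next
      case False
      then have "k < int m" using supp[OF \<open>coef a k \<noteq> 0\<close>] by simp
      then have pos: "real m - of_int k > 0" by linarith
      have "real (degree (coef a k)) / (real m - of_int k) \<le> s"
        using smax \<open>k < int m\<close> \<open>coef a k \<noteq> 0\<close> by (auto simp: S_def)
      then have "real (degree (coef a k)) \<le> s * (real m - of_int k)" using pos by (simp add: field_simps)
      moreover have "real j \<le> real (degree (coef a k))" using le_degree[OF kj] by simp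
      ultimately show ?thesis by (simp add: d_def algebra_simps)
    qed
  qed
  define P where "P = symb s d a"
  have P0: "coeff P 0 \<noteq> 0"
  proof -
    have "coeff P 0 = coeff (coef a (int m)) 0"
      unfolding P_def by (rule coeff_symb[OF s0]) (simp add: d_def)
    then show ?thesis using am False by (metis leading_coeff_0_iff)
  qed
  then have Pne: "P \<noteq> 0" by auto
  define J where "J = degree P"
  have J: "J > 0"
  proof -
    have "real m - of_int k1 > 0" using k1(3) by linarith
    then have eq: "s * of_int k1 + real (degree (coef a k1)) = d" using k1(1) by (simp add: d_def field_simps)
    have "coeff P (degree (coef a k1)) = lead_coeff (coef a k1)"
      unfolding P_def by (rule coeff_symb[OF s0 eq])
    then have "degree (coef a k1) \<le> J" using k1(2) unfolding J_def by (intro le_degree) simp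
    moreover have "degree (coef a k1) \<noteq> 0"
    proof
      assume "degree (coef a k1) = 0"
      then show False using k1(1) s by simp
    qed
    ultimately show ?thesis by linarith
  qed
  have "coeff P J \<noteq> 0" using Pne by (simp add: J_def)
  then obtain k where k: "s * of_int k + real J = d" "coeff (coef a k) J \<noteq> 0"
    unfolding P_def using coeff_symb_nonzeroD[OF s0] by metis
  have ck: "coef a k \<noteq> 0" using k(2) by auto
  have dk: "degree (coef a k) = J"
  proof -
    have "s * of_int k + real (degree (coef a k)) \<le> d" using wle ck unfolding wle_def by simp
    then show ?thesis using k(1) le_degree[OF k(2)] by simp
  qed
  have root: "real (order z P) > d" if "poly P z = 0" for z
  proof (rule ccontr)
    assume "\<not> real (order z P) > d"
    moreover have "order z P \<noteq> 0" using that Pne order_root by blast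
    moreover obtain n where "(com a ^^ n) sX = 0" using ad_nilpotentD[OF a B_gens(1)] .
    ultimately show False
      using com_iterates_nonzero_root[OF s wle, of z n] Pne by (simp add: P_def sX_def)
  qed
  obtain z where z: "poly P z = 0"
    using fundamental_theorem_of_algebra[of P] J constant_degree[of P] by (auto simp: J_def)
  \<comment> \<open>The root has order above d = s k + J but at most J, hence k < 0: the edge ends
    at a negative power of T.\<close>
  have "real J \<ge> real (order z P)" using order_degree[OF Pne, of z] by (simp add: J_def)
  moreover have "d \<ge> 0" using s by (simp add: d_def)
  ultimately have "s * of_int k < 0" using k(1) root[OF z] by linarith
  then have kneg: "k < 0" using s by (simp add: mult_less_0_iff)
  \<comment> \<open>Brackets with Y exclude an end point strictly above the ray j = -2k, and the
    cone of B excludes one below it. The edge thus ends on the ray.\<close>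
  have "\<not> int J + 2 * k > 0"
  proof
    assume "int J + 2 * k > 0"
    moreover obtain n where "(com a ^^ n) (sY lam) = 0" using ad_nilpotentD[OF a B_gens(3)] .
    ultimately show False
      using com_iterates_nonzero_degree[OF s0 wle degree_qpoly[of lam], of J k n] Pne k(1) kneg
      by (simp add: J_def P_def sY_def)
  qed
  then have Jk: "int J = - 2 * k" using B_degree[OF aB ck] dk by linarith
  define \<nu> where "\<nu> = nat (- k)"
  have \<nu>: "k = - int \<nu>" "J = 2 * \<nu>" "\<nu> \<ge> 1" using kneg Jk by (auto simp: \<nu>_def)
  have \<nu>n: "\<nu> \<le> n" using supp[OF ck] \<nu>(1) by linarith
  \<comment> \<open>The assumption n \<le> m enters here: 2 \<nu> = d + s \<nu>, and s \<nu> \<le> s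
    m = d.\<close>
  have d\<nu>: "d \<ge> real \<nu>"
  proof -
    have "2 * real \<nu> = d + s * real \<nu>" using k(1) \<nu> by simp
    moreover have "s * real \<nu> \<le> d" unfolding d_def using s \<nu>n nm by (intro mult_left_mono) auto
    ultimately show ?thesis by linarith
  qed
  define e where "e = order z P"
  have e: "e > \<nu>" using root[OF z] d\<nu> by (simp add: e_def)
  obtain U where U: "P = [:- z, 1:] ^ e * U" "\<not> [:- z, 1:] dvd U"
    using order_decomp[OF Pne, of z] e_def by blast
  have Uz: "poly U z \<noteq> 0" using U(2) by (simp add: poly_eq_0_iff_dvd)
  then have Une: "U \<noteq> 0" by auto
  have dU: "J = e + degree U"
    unfolding J_def U(1) using Une by (subst degree_mult_eq) (simp_all add: degree_linear_power)
  \<comment> \<open>A second root would need order above d \<ge> \<nu>, but z already takes more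
    than \<nu> of the total degree 2 \<nu>.\<close>
  have "degree U = 0"
  proof (rule ccontr)
    assume "degree U \<noteq> 0"
    then obtain w where w: "poly U w = 0"
      using fundamental_theorem_of_algebra[of U] constant_degree[of U] by auto
    then have "w \<noteq> z" using Uz by auto
    have "order w P = order w ([:- z, 1:] ^ e) + order w U"
      unfolding U(1) by (rule order_mult) (use Une in simp)
    moreover have "order w ([:- z, 1:] ^ e) = 0"
      using \<open>w \<noteq> z\<close> by (intro order_0I) (simp add: poly_power)
    ultimately have "order w P \<le> degree U" using order_degree[OF Une, of w] by simp
    moreover have "real (order w P) > d" using root w U(1) by simp
    ultimately show False using dU e \<nu>(2) d\<nu> by linarith
  qed
  then obtain u where u: "U = [:u:]" using degree_eq_zeroE by blast
  have eJ: "e = J" using dU \<open>degree U = 0\<close> by simp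
  have Pu: "P = smult u ([:- z, 1:] ^ J)" using U(1) u eJ by simp
  have "u \<noteq> 0" using Pne Pu by auto
  have "z \<noteq> 0" using z P0 by (auto simp: poly_0_coeff_0)
  \<comment> \<open>The coefficient -u J z next to the top is nonzero, so the edge contains a
    lattice point at height J - 1. Comparing it with (k, J) shows that 1/s is a positive
    integer.\<close>
  have "J choose (J - 1) = J" using binomial_symmetric[of 1 J] J by simp
  then have "coeff P (J - 1) = u * of_nat J * (- z)"
    unfolding Pu using J coeff_linear_poly_power[of "J - 1" J "- z" 1] by simp
  then have "coeff P (J - 1) \<noteq> 0" using \<open>u \<noteq> 0\<close> \<open>z \<noteq> 0\<close> J by simp
  then obtain k' where k': "s * of_int k' + real (J - 1) = d"
    unfolding P_def using coeff_symb_nonzeroD[OF s0] by metis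
  have st0: "s * of_int (k' - k) = 1" using k' k(1) J by (simp add: of_nat_diff algebra_simps)
  then have "k' - k > 0" using s by (metis of_int_0_less_iff zero_less_mult_pos zero_less_one)
  define t where "t = nat (k' - k)"
  have t: "t > 0" "s * real t = 1" using \<open>k' - k > 0\<close> st0 by (simp_all add: t_def)
  \<comment> \<open>The exponent is t - 1 because \<open>translate_aut\<close> supplies one further
    factor X.\<close>
  obtain \<phi> where \<phi>: "B_aut lam \<phi>" "\<phi> sX = sX" "\<phi> sT = sT + sX * (\<Sum>i\<in>{t - 1}. cst z * sX ^ i)"
    using translate_aut[where A = "{t - 1}" and c = "\<lambda>_. z"] by blast
  have "sX * (cst z * sX ^ (t - 1)) = cst z * sX ^ t"
    using t(1) by (simp add: cst_left_commute power_eq_if)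
  then have \<phi>T: "\<phi> sT = sT + cst z * sX ^ t" using \<phi>(3) by simp
  have \<phi>a: "\<phi> a = subst_sT (\<phi> sT) a" by (rule B_hom_subst_sT[OF B_aut_hom[OF \<phi>(1)] \<phi>(2) aB])
  have sym: "wle s d (\<phi> a)" "symb s d (\<phi> a) = pcompose P [:z, 1:]"
    using subst_sT_symbol[OF s0 \<phi>T t(2) wle] by (simp_all add: \<phi>a P_def)
  have "lo 0 (\<phi> sT)" unfolding \<phi>T unfolding sX_power sT_def cst_tmon by (intro lo_add lo_tmon) auto
  moreover have "lo (- int n) a" using supp by (force simp: lo_def)
  ultimately have lo: "lo (- int n) (\<phi> a)" unfolding \<phi>a by (intro lo_subst_sT)
  have "- int n \<le> l \<and> l \<le> int (m - 1)" if l: "coef (\<phi> a) l \<noteq> 0" for l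
  proof
    show "- int n \<le> l" using lo l by (meson lo_def not_le)
    have le: "s * of_int l + real (degree (coef (\<phi> a) l)) \<le> s * real m"
      using sym(1) l unfolding wle_def d_def by simp
    then have "s * of_int l \<le> s * real m" by linarith
    then have "real_of_int l \<le> real m" using s by simp
    then have lm: "l \<le> int m" by linarith
    \<comment> \<open>A component at T^m would be constant and hence the constant term of P(theta +
      z), which is P(z) = 0.\<close>
    have "l \<noteq> int m"
    proof
      assume lm: "l = int m"
      then have "degree (coef (\<phi> a) l) = 0" using le by simp
      then have "coeff (coef (\<phi> a) l) 0 \<noteq> 0" using l by (metis leading_coeff_0_iff)
      moreover have "coeff (symb s d (\<phi> a)) 0 = coeff (coef (\<phi> a) (int m)) 0"
        by (rule coeff_symb[OF s0]) (simp add: d_def)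
      moreover have "coeff (pcompose P [:z, 1:]) 0 = 0"
        using z by (simp add: poly_pcompose flip: poly_0_coeff_0)
      ultimately show False using lm sym(2) by simp
    qed
    then show "l \<le> int (m - 1)" using lm \<nu>n nm \<nu>(3) by linarith
  qed
  moreover have "m > 0" using \<nu>n nm \<nu>(3) by linarith
  ultimately show ?thesis using that \<phi>(1) by blast
qed

text \<open>Induction on the width n + m of the interval of exponents. Exchanging X and Y swaps n
  and m at equal width, so the reduction always shortens the longer side.\<close>

theorem ad_nilpotent_conjugate:
  assumes "ad_nilpotent lam a"
  obtains \<phi> where "B_aut lam \<phi>" "\<And>k. degree (coef (\<phi> a) k) = 0"
proof -
  have main: "\<exists>\<phi>. B_aut lam \<phi> \<and> (\<forall>k. degree (coef (\<phi> a) k) = 0)"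
    if "ad_nilpotent lam a" "\<And>k. coef a k \<noteq> 0 \<Longrightarrow> - int n \<le> k \<and> k \<le> int m" for n m a
    using that
  proof (induction "n + m" arbitrary: n m a rule: less_induct)
    case less
    have le: "\<exists>\<phi>. B_aut lam \<phi> \<and> (\<forall>k. degree (coef (\<phi> b) k) = 0)"
      if b: "ad_nilpotent lam b" "\<And>k. coef b k \<noteq> 0 \<Longrightarrow> - int n' \<le> k \<and> k \<le> int m'"
        and le: "n' \<le> m'" and sum: "n' + m' = n + m" for b n' m'
    proof (cases "\<exists>k. degree (coef b k) \<noteq> 0")
      case False
      then show ?thesis using B_aut_id by auto
    next
      case True
      then obtain k0 where "degree (coef b k0) \<noteq> 0" by blast
      then obtain \<phi> where \<phi>: "B_aut lam \<phi>" "m' > 0"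
        "\<And>k. coef (\<phi> b) k \<noteq> 0 \<Longrightarrow> - int n' \<le> k \<and> k \<le> int (m' - 1)"
        using reduce_step[OF b le] by blast
      have "n' + (m' - 1) < n + m" using \<phi>(2) sum by linarith
      then obtain \<psi> where "B_aut lam \<psi>" "\<forall>k. degree (coef (\<psi> (\<phi> b)) k) = 0"
        using less(1)[OF _ ad_nilpotent_aut[OF \<phi>(1) b(1)] \<phi>(3)] by blast
      then show ?thesis using B_aut_comp[OF _ \<phi>(1)] by blast
    qed
    show ?case
    proof (cases "n \<le> m")
      case True
      then show ?thesis using le[OF less(2,3)] by simp
    next
      case False
      obtain \<sigma> where \<sigma>: "B_aut lam \<sigma>" "\<And>a k. a \<in> B lam \<Longrightarrow> coef (\<sigma> a) k \<noteq> 0 \<Longrightarrow> coef a (- k) \<noteq> 0"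
        using swap_aut by metis
      have "- int m \<le> k \<and> k \<le> int n" if "coef (\<sigma> a) k \<noteq> 0" for k
        using less(3)[of "- k"] \<sigma>(2)[OF _ that] less(2) by (auto simp: ad_nilpotent_def)
      then obtain \<phi> where "B_aut lam \<phi>" "\<forall>k. degree (coef (\<phi> (\<sigma> a)) k) = 0"
        using le[OF ad_nilpotent_aut[OF \<sigma>(1) less(2)], of m n] False by auto
      then show ?thesis using B_aut_comp[OF _ \<sigma>(1)] by blast
    qed
  qed
  have "finite ((\<lambda>k. nat \<bar>k\<bar>) ` {k. coef a k \<noteq> 0})" by simp
  then obtain N where N: "\<forall>x\<in>(\<lambda>k. nat \<bar>k\<bar>) ` {k. coef a k \<noteq> 0}. x \<le> N"
    using finite_nat_set_iff_bounded_le by blast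
  then have "- int N \<le> k \<and> k \<le> int N" if "coef a k \<noteq> 0" for k
    using that by auto
  then show ?thesis using main[OF assms] that by blast
qed

section \<open>Antilinear maps fixing the standard triple\<close>

text \<open>Involutivity would be lost on composing with a normalizing automorphism. Only its
  consequence of a trivial kernel is kept.\<close>

definition antilinear_lie :: "complex \<Rightarrow> (skew \<Rightarrow> skew) \<Rightarrow> bool" where
  "antilinear_lie lam \<omega> \<longleftrightarrow> (\<forall>a\<in>B lam. \<omega> a \<in> B lam) \<and>
     (\<forall>a\<in>B lam. \<forall>b\<in>B lam. \<omega> (a + b) = \<omega> a + \<omega> b \<and> \<omega> (com a b) = com (\<omega> a) (\<omega> b)) \<and>
     (\<forall>c. \<forall>a\<in>B lam. \<omega> (cst c * a) = cst (cnj c) * \<omega> a) \<and>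
     (\<forall>a\<in>B lam. \<omega> a = 0 \<longrightarrow> a = 0)"

text \<open>A polynomial of period 1 takes the value p(0) at every natural number.\<close>

lemma shift_1_fixed:
  assumes "shift 1 p = p"
  shows "degree p = 0"
proof -
  have step: "poly p (z + 1) = poly p z" for z
    using poly_shift[of 1 p z] assms by simp
  have "poly p (of_nat n) = poly p 0" for n
  proof (induction n)
    case (Suc n)
    then show ?case using step[of "of_nat n"] by (simp add: add.commute)
  qed simp
  then have "range (of_nat :: nat \<Rightarrow> complex) \<subseteq> {z. poly (p - [:poly p 0:]) z = 0}" by auto
  moreover have "infinite (range (of_nat :: nat \<Rightarrow> complex))"
    by (rule range_inj_infinite) (simp add: inj_of_nat)
  ultimately have "p - [:poly p 0:] = 0" using poly_roots_finite finite_subset by metis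
  then have "p = [:poly p 0:]" by simp
  then show ?thesis by (metis degree_pCons_0)
qed

text \<open>The eigenvalue of ad theta leaves a single component T^n p, and commuting with X says
  that p has period 1. These are the highest weight vectors of the adjoint action.\<close>

lemma weight_vector:
  assumes "com sX a = 0" "com sT a = cst (of_nat n) * a"
  obtains c where "a = cst c * sX ^ n"
proof -
  have other: "coef a k = 0" if "k \<noteq> int n" for k
  proof -
    have "smult (of_int k) (coef a k) = smult (of_nat n) (coef a k)"
      using coef_com_sT[of a k] assms(2) by simp
    then have "smult (of_int k - of_nat n) (coef a k) = 0" by (simp add: smult_diff_left)
    moreover have "of_int k - of_nat n \<noteq> (0 :: complex)"
      using that by (metis eq_iff_diff_eq_0 of_int_eq_iff of_int_of_nat_eq)
    ultimately show ?thesis by simp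
  qed
  have "coef (com sX a) (int n + 1) = coef a (int n) - shift 1 (coef a (int n))"
    unfolding sX_def coef_com_tmon_left by simp
  then have "shift 1 (coef a (int n)) = coef a (int n)" using assms(1) by simp
  then have "degree (coef a (int n)) = 0" by (rule shift_1_fixed)
  then obtain c where c: "coef a (int n) = [:c:]" using degree_eq_zeroE by blast
  have "a = cst c * sX ^ n"
    by (rule skew_eqI) (auto simp: sX_power cst_tmon coef_tmon other c)
  then show ?thesis using that by blast
qed

lemma sX_pow_tmon: "sX ^ 2 = tmon 2 1" "sX ^ 3 = tmon 3 1" "sX ^ 4 = tmon 4 1"
  by (simp_all add: sX_power)

lemma tmon_cong: "k = l \<Longrightarrow> (\<And>z. poly p z = poly q z) \<Longrightarrow> tmon k p = tmon l q"
  using poly_ext by metis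

text \<open>Clebsch-Gordan decompositions of brackets: the right-hand sides lie in the modules
  generated by X^3 and X, respectively X^4 and X^2. Three applications of \<open>D\<close> lower the
  weight of the bracket to that of the highest weight vector of the smaller module. The scalars
  result from comparing coefficients of powers of theta. The last item later separates D (D (X^4))
  from X^2.\<close>

lemma lie_identities:
  fixes lam :: complex
  defines "\<Lambda> \<equiv> lam\<^sup>2 / 4"
  defines "D \<equiv> com (sY lam)"
  shows "com (sX ^ 2) (D (sX ^ 2)) = cst 8 * sX ^ 3"
    and "com (sX ^ 2) (D (D (D (sX ^ 2)))) = cst (24 / 5) * D (D (sX ^ 3)) + cst (96 / 5 * (1 - \<Lambda>)) * sX"
    and "com (sX ^ 2) (D (D (D (sX ^ 3)))) = cst (90 / 7) * D (D (sX ^ 4)) + cst (72 / 7 * (9 - 4 * \<Lambda>)) * sX ^ 2"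
    and "coeff (coef (D (D (sX ^ 4))) 2) 2 = 56"
proof -
  have D: "D (tmon k p) = tmon (k - 1) (shift k (qpoly lam) * p - shift (- 1) p * qpoly lam)" for k p
    by (simp add: D_def sY_def com_tmon)
  have A1: "D (sX ^ 2) = tmon 1 [:- 2, - 4:]"
    unfolding sX_pow_tmon D by (rule tmon_cong) (simp_all add: qpoly_def field_simps power2_eq_square)
  have A2: "D (D (sX ^ 2)) = tmon 0 [:1 - 4 * \<Lambda>, 0, 12:]"
    unfolding A1 D by (rule tmon_cong) (simp_all add: qpoly_def \<Lambda>_def field_simps power2_eq_square)
  have A3: "D (D (D (sX ^ 2))) = tmon (- 1) (qpoly lam * [:- 12, 24:])"
    unfolding A2 D by (rule tmon_cong) (simp_all add: qpoly_def \<Lambda>_def field_simps power2_eq_square)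
  have B1: "D (sX ^ 3) = tmon 2 [:- 6, - 6:]"
    unfolding sX_pow_tmon D by (rule tmon_cong) (simp_all add: qpoly_def field_simps power2_eq_square)
  have B2: "D (D (sX ^ 3)) = tmon 1 [:27 / 2 - 6 * \<Lambda>, 30, 30:]"
    unfolding B1 D by (rule tmon_cong) (simp_all add: qpoly_def \<Lambda>_def field_simps power2_eq_square)
  have B3: "D (D (D (sX ^ 3))) = tmon 0 [:0, 72 * \<Lambda> - 42, 0, - 120:]"
    unfolding B2 D by (rule tmon_cong) (simp_all add: qpoly_def \<Lambda>_def field_simps power2_eq_square)
  have C1: "D (sX ^ 4) = tmon 3 [:- 12, - 8:]"
    unfolding sX_pow_tmon D by (rule tmon_cong) (simp_all add: qpoly_def field_simps power2_eq_square)
  have C2: "D (D (sX ^ 4)) = tmon 2 [:74 - 8 * \<Lambda>, 112, 56:]"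
    unfolding C1 D by (rule tmon_cong) (simp_all add: qpoly_def \<Lambda>_def field_simps power2_eq_square)
  show "com (sX ^ 2) (D (sX ^ 2)) = cst 8 * sX ^ 3"
    unfolding A1 unfolding sX_pow_tmon com_tmon cst_tmon by (rule tmon_cong) (simp_all add: field_simps)
  show "com (sX ^ 2) (D (D (D (sX ^ 2)))) = cst (24 / 5) * D (D (sX ^ 3)) + cst (96 / 5 * (1 - \<Lambda>)) * sX"
    unfolding A3 B2 unfolding sX_pow_tmon unfolding com_tmon cst_tmon sX_def tmon_add[symmetric]
    by (rule tmon_cong) (simp_all add: qpoly_def \<Lambda>_def field_simps power2_eq_square)
  show "com (sX ^ 2) (D (D (D (sX ^ 3)))) = cst (90 / 7) * D (D (sX ^ 4)) + cst (72 / 7 * (9 - 4 * \<Lambda>)) * sX ^ 2"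
    unfolding B3 C2 unfolding sX_pow_tmon com_tmon cst_tmon tmon_add[symmetric]
    by (rule tmon_cong) (simp_all add: field_simps power2_eq_square)
  show "coeff (coef (D (D (sX ^ 4))) 2) 2 = 56"
    unfolding C2 by (simp add: coef_tmon numeral_2_eq_2)
qed

lemma antilinear_lie_fixing_sl2:
  assumes \<omega>: "antilinear_lie lam \<omega>"
    and fix_gen: "\<omega> sX = sX" "\<omega> (cst 2 * sT) = cst 2 * sT" "\<omega> (sY lam) = sY lam"
  shows "lam\<^sup>2 \<in> \<real>"
proof -
  define \<Lambda> where "\<Lambda> = lam\<^sup>2 / 4"
  define D where "D = com (sY lam)"
  have add: "\<omega> (a + b) = \<omega> a + \<omega> b" and com: "\<omega> (com a b) = com (\<omega> a) (\<omega> b)"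
    and sc: "\<omega> (cst c * a) = cst (cnj c) * \<omega> a" and inj: "\<omega> a = 0 \<Longrightarrow> a = 0"
    if "a \<in> B lam" "b \<in> B lam" for a b c
    using \<omega> that unfolding antilinear_lie_def by blast+
  have sc': "\<omega> (cst c * a) = cst (cnj c) * \<omega> a" if "a \<in> B lam" for a c
    using sc[OF that that] .
  have XB: "sX ^ n \<in> B lam" for n by (simp add: B_power B_gens)
  have DB: "D a \<in> B lam" if "a \<in> B lam" for a using that by (simp add: D_def B_com B_gens)
  have \<omega>D: "\<omega> (D a) = D (\<omega> a)" if "a \<in> B lam" for a
    unfolding D_def using com[OF B_gens(3) that] fix_gen(3) by simp
  have TT: "sT = cst (1/2) * (cst 2 * sT)" by (simp flip: mult.assoc cst_mult)
  have \<omega>T: "\<omega> sT = sT"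
    using sc'[of "cst 2 * sT" "1/2"] fix_gen(2) TT by (simp add: B_mult B_cst B_gens)
  \<comment> \<open>X and theta are fixed, so highest weight vectors go to highest weight vectors.
    The weight n is real and unaffected by conjugation.\<close>
  have "\<exists>c. \<omega> (sX ^ n) = cst c * sX ^ n" for n
  proof -
    have "com sX (sX ^ n) = 0" by (simp add: com_def power_commutes)
    then have "com sX (\<omega> (sX ^ n)) = 0"
      using com[OF B_gens(1) XB, of n] fix_gen(1) sc'[OF B_0, of 0] by simp
    moreover have "com sT (sX ^ n) = cst (of_nat n) * sX ^ n"
      by (rule skew_eqI) (simp add: coef_com_sT sX_power coef_tmon)
    then have "com sT (\<omega> (sX ^ n)) = cst (of_nat n) * \<omega> (sX ^ n)"
      using com[OF B_gens(2) XB, of n] \<omega>T sc'[OF XB, of "of_nat n" n] by simp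
    ultimately show ?thesis using weight_vector by metis
  qed
  then obtain c where c: "\<And>n. \<omega> (sX ^ n) = cst (c n) * sX ^ n" by metis
  have Dc: "D (cst e * a) = cst e * D a" for e a by (simp add: D_def com_cst_right)
  have ids: "com (sX ^ 2) (D (sX ^ 2)) = cst 8 * sX ^ 3"
    "com (sX ^ 2) (D (D (D (sX ^ 2)))) = cst (24 / 5) * D (D (sX ^ 3)) + cst (96 / 5 * (1 - \<Lambda>)) * sX"
    "com (sX ^ 2) (D (D (D (sX ^ 3)))) = cst (90 / 7) * D (D (sX ^ 4)) + cst (72 / 7 * (9 - 4 * \<Lambda>)) * sX ^ 2"
    "coeff (coef (D (D (sX ^ 4))) 2) 2 = 56"
    using lie_identities[of lam] unfolding D_def \<Lambda>_def by auto
  have cX: "e = f" if "cst e * sX ^ n = cst f * sX ^ n" for e f n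
    using that by (simp add: sX_power cst_tmon tmon_eq_iff)
  have c3: "c 3 = c 2 * c 2"
  proof -
    have "\<omega> (com (sX ^ 2) (D (sX ^ 2))) = cst (c 2 * c 2) * com (sX ^ 2) (D (sX ^ 2))"
      using com[OF XB DB[OF XB]] by (simp add: \<omega>D XB c Dc com_cst_left com_cst_right cst_mult mult.assoc)
    moreover have "\<omega> (cst 8 * sX ^ 3) = cst 8 * (cst (c 3) * sX ^ 3)"
      using sc'[OF XB] by (simp add: c)
    ultimately have "cst (c 2 * c 2) * (cst 8 * sX ^ 3) = cst 8 * (cst (c 3) * sX ^ 3)"
      unfolding ids(1) by simp
    then have "cst (c 2 * c 2 * 8) * sX ^ 3 = cst (8 * c 3) * sX ^ 3"
      by (simp add: cst_mult mult.assoc)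
    from cX[OF this] show ?thesis by simp
  qed
  have e1: "c 2 * c 2 * (1 - \<Lambda>) = cnj (1 - \<Lambda>)"
  proof -
    define \<kappa> where "\<kappa> = 96 / 5 * (1 - \<Lambda>)"
    have "\<omega> (com (sX ^ 2) (D (D (D (sX ^ 2))))) = cst (c 2 * c 2) * com (sX ^ 2) (D (D (D (sX ^ 2))))"
      using com[OF XB DB[OF DB[OF DB[OF XB]]]]
      by (simp add: \<omega>D XB DB c Dc com_cst_left com_cst_right cst_mult mult.assoc)
    moreover have "\<omega> (cst (24 / 5) * D (D (sX ^ 3)) + cst \<kappa> * sX)
       = cst (24 / 5) * (cst (c 3) * D (D (sX ^ 3))) + cst (cnj \<kappa>) * sX"
      using sc'[OF DB[OF DB[OF XB]]] sc'[OF B_gens(1)]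
      by (subst add) (simp_all add: B_mult B_cst B_gens \<omega>D XB DB c Dc fix_gen)
    ultimately have "cst (c 2 * c 2) * (cst (24 / 5) * D (D (sX ^ 3)) + cst \<kappa> * sX)
       = cst (24 / 5) * (cst (c 3) * D (D (sX ^ 3))) + cst (cnj \<kappa>) * sX"
      unfolding ids(2) \<kappa>_def by simp
    moreover have "cst (c 2 * c 2) * (cst (24 / 5) * D (D (sX ^ 3))) = cst (24 / 5) * (cst (c 3) * D (D (sX ^ 3)))"
      unfolding c3 by (rule cst_left_commute)
    ultimately have "cst (c 2 * c 2 * \<kappa>) * sX ^ 1 = cst (cnj \<kappa>) * sX ^ 1"
      by (simp add: distrib_left cst_mult mult.assoc)
    from cX[OF this] have "96 / 5 * (c 2 * c 2 * (1 - \<Lambda>)) = 96 / 5 * cnj (1 - \<Lambda>)"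
      unfolding \<kappa>_def by (simp only: complex_cnj_mult complex_cnj_divide complex_cnj_numeral mult_ac)
    then show ?thesis by (subst (asm) mult_left_cancel) auto
  qed
  have e2: "c 2 * c 2 * (9 - 4 * \<Lambda>) = cnj (9 - 4 * \<Lambda>)"
  proof -
    define \<kappa> where "\<kappa> = 72 / 7 * (9 - 4 * \<Lambda>)"
    have c2: "c 2 \<noteq> 0"
    proof
      assume "c 2 = 0"
      then have "sX ^ 2 = 0" using c[of 2] inj[OF XB XB] by simp
      then show False by (simp add: sX_power tmon_eq_0_iff)
    qed
    have "\<omega> (com (sX ^ 2) (D (D (D (sX ^ 3))))) = cst (c 2 * c 3) * com (sX ^ 2) (D (D (D (sX ^ 3))))"
      using com[OF XB DB[OF DB[OF DB[OF XB]]]]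
      by (simp add: \<omega>D XB DB c Dc com_cst_left com_cst_right cst_mult mult.assoc cst_left_commute[of "cst (c 3)"])
    moreover have "\<omega> (cst (90 / 7) * D (D (sX ^ 4)) + cst \<kappa> * sX ^ 2)
       = cst (90 / 7) * (cst (c 4) * D (D (sX ^ 4))) + cst (cnj \<kappa>) * (cst (c 2) * sX ^ 2)"
      using sc'[OF DB[OF DB[OF XB]]] sc'[OF XB]
      by (subst add) (simp_all add: B_mult B_cst B_gens \<omega>D XB DB c Dc fix_gen)
    ultimately have eq: "cst (c 2 * c 3) * (cst (90 / 7) * D (D (sX ^ 4)) + cst \<kappa> * sX ^ 2)
       = cst (90 / 7) * (cst (c 4) * D (D (sX ^ 4))) + cst (cnj \<kappa>) * (cst (c 2) * sX ^ 2)"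
      unfolding ids(3) \<kappa>_def by simp
    \<comment> \<open>X^2 has no theta^2 term, so this coefficient sees only D (D (X^4)) and yields
      c 4.\<close>
    have "coeff (coef (sX ^ 2) 2) 2 = 0" by (simp add: sX_power coef_tmon)
    then have "c 2 * c 3 * (90 / 7) = 90 / 7 * c 4"
      using arg_cong[OF eq, of "\<lambda>a. coeff (coef a 2) 2"] by (simp add: ids(4))
    then have "c 4 = c 2 * c 3" by simp
    then have "cst (c 2 * c 3) * (cst (90 / 7) * D (D (sX ^ 4))) = cst (90 / 7) * (cst (c 4) * D (D (sX ^ 4)))"
      by (simp only: cst_left_commute[of "cst (c 2 * c 3)"])
    then have "cst (c 2 * c 3 * \<kappa>) * sX ^ 2 = cst (cnj \<kappa> * c 2) * sX ^ 2"
      using eq by (simp add: distrib_left cst_mult mult.assoc)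
    from cX[OF this] c2 have "c 3 * \<kappa> = cnj \<kappa>" by simp
    then have "72 / 7 * (c 2 * c 2 * (9 - 4 * \<Lambda>)) = 72 / 7 * cnj (9 - 4 * \<Lambda>)"
      unfolding \<kappa>_def c3 by (simp only: complex_cnj_mult complex_cnj_divide complex_cnj_numeral mult_ac)
    then show ?thesis by (subst (asm) mult_left_cancel) auto
  qed
  \<comment> \<open>In \<open>e2\<close> minus four times \<open>e1\<close> the unknown \<Lambda>
    cancels: 9 - 4 \<Lambda> - 4 (1 - \<Lambda>) = 5.\<close>
  have "c 2 * c 2 * 5 = 5"
    using arg_cong2[OF e2 e1, of "\<lambda>x y. x - 4 * y"] by (simp add: algebra_simps)
  then have "c 2 * c 2 = 1" by simp
  then have "\<Lambda> = cnj \<Lambda>" using e1 by simp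
  then have "\<Lambda> \<in> \<real>" by (simp add: Reals_cnj_iff)
  moreover have "lam\<^sup>2 = 4 * \<Lambda>" by (simp add: \<Lambda>_def)
  ultimately show ?thesis by simp
qed

section \<open>Normalizing a triple\<close>

lemma B_aut_eq_0:
  assumes "B_aut lam \<phi>" "a \<in> B lam" "\<phi> a = 0"
  shows "a = 0"
proof -
  obtain \<psi> where "B_hom lam \<psi>" "\<psi> (\<phi> a) = a" using assms(1,2) unfolding B_aut_def by blast
  then show ?thesis using assms(3) B_hom_0[of lam \<psi>] by simp
qed

text \<open>For small \<alpha> the symbol of \<open>X\<close> is its constant top coefficient
  \<eta>, and ad X acts on symbols as -M \<eta> times d/dtheta. A leading monomial of degree J
  therefore survives J brackets.\<close>

lemma degree_le_of_com_nilpotent: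
  assumes X: "\<And>k. degree (coef X k) = 0" "\<And>k. coef X k \<noteq> 0 \<Longrightarrow> k \<le> int M"
    and M: "coef X (int M) \<noteq> 0" "M > 0"
    and b: "(com X ^^ Suc n) b = 0"
  shows "degree (coef b k) \<le> n"
proof (rule ccontr)
  assume k: "\<not> degree (coef b k) \<le> n"
  define Js where "Js = (\<lambda>k. degree (coef b k)) ` {k. coef b k \<noteq> 0}"
  have finJ: "finite Js" by (simp add: Js_def)
  have kJ: "degree (coef b k) \<in> Js" using k by (auto simp: Js_def)
  define J where "J = Max Js"
  have J: "J \<in> Js" unfolding J_def using finJ kJ by (intro Max_in) auto
  have Jmax: "degree (coef b l) \<le> J" for l
    using Max_ge[OF finJ] by (cases "coef b l = 0") (auto simp: J_def Js_def)
  have Jn: "J > n" using Jmax[of k] k by linarith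
  define Ks where "Ks = {k. coef b k \<noteq> 0 \<and> degree (coef b k) = J}"
  have finK: "finite Ks" unfolding Ks_def by (rule finite_subset[OF _ finite_coef[of b]]) auto
  have "Ks \<noteq> {}" using J by (auto simp: Ks_def Js_def)
  define K where "K = Max Ks"
  have K: "K \<in> Ks" unfolding K_def using finK \<open>Ks \<noteq> {}\<close> by (rule Max_in)
  have Kmax: "l \<le> K" if "l \<in> Ks" for l unfolding K_def using finK that by simp
  have "finite ((\<lambda>l. nat (l - K)) ` {l. coef b l \<noteq> 0})" by simp
  then obtain R where R: "\<forall>x\<in>(\<lambda>l. nat (l - K)) ` {l. coef b l \<noteq> 0}. x \<le> R"
    using finite_nat_set_iff_bounded_le by blast
  \<comment> \<open>\<open>R\<close> bounds how far an exponent of T can exceed \<open>K\<close>, so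
    \<alpha> (l - K) < 1. A loss of one theta-degree outweighs any gain in T, and T only breaks
    ties.\<close>
  define \<alpha> where "\<alpha> = 1 / (real R + 1)"
  have \<alpha>: "\<alpha> > 0" "\<alpha> \<noteq> 0" by (simp_all add: \<alpha>_def)
  define d where "d = \<alpha> * of_int K + real J"
  have low: "\<alpha> * of_int l + real j < d" if lj: "coeff (coef b l) j \<noteq> 0" "j \<noteq> J \<or> l \<noteq> K" for l j
  proof -
    have l: "coef b l \<noteq> 0" using lj(1) by auto
    have "j \<le> J" using le_degree[OF lj(1)] Jmax[of l] by linarith
    show ?thesis
    proof (cases "j = J")
      case True
      then have "degree (coef b l) = J" using le_degree[OF lj(1)] Jmax[of l] by linarith
      then have "l \<le> K" using Kmax l by (simp add: Ks_def)
      then have "l < K" using lj(2) True by simp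
      then have "\<alpha> * of_int l < \<alpha> * of_int K" using \<alpha> by simp
      then show ?thesis using True by (simp add: d_def)
    next
      case False
      have "nat (l - K) \<le> R" using R l by auto
      then have "real_of_int (l - K) < real R + 1" by linarith
      then have "\<alpha> * of_int (l - K) < 1" by (simp add: \<alpha>_def divide_less_eq)
      moreover have "real j \<le> real J - 1" using False \<open>j \<le> J\<close> by linarith
      ultimately show ?thesis by (simp add: d_def algebra_simps)
    qed
  qed
  define c where "c = lead_coeff (coef b K)"
  have c: "c \<noteq> 0" "coeff (coef b K) J = c" using K by (auto simp: c_def Ks_def)
  have wb: "wle \<alpha> d b"
    unfolding wle_def using low by (metis d_def less_eq_real_def)
  have sb: "symb \<alpha> d b = monom c J"
  proof (rule poly_eqI)
    fix j
    show "coeff (symb \<alpha> d b) j = coeff (monom c J) j"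
    proof (cases "j = J")
      case True
      then show ?thesis using coeff_symb[OF \<alpha>(2), of K J d b] c(2) by (simp add: d_def)
    next
      case False
      have "coeff (symb \<alpha> d b) j = 0"
      proof (rule ccontr)
        assume "coeff (symb \<alpha> d b) j \<noteq> 0"
        then obtain l where "\<alpha> * of_int l + real j = d" "coeff (coef b l) j \<noteq> 0"
          by (rule coeff_symb_nonzeroD[OF \<alpha>(2)])
        then show False using low[of l j] False by simp
      qed
      then show ?thesis using False by simp
    qed
  qed
  define \<eta> where "\<eta> = coeff (coef X (int M)) 0"
  have \<eta>: "\<eta> \<noteq> 0" unfolding \<eta>_def using M(1) X(1) by (metis leading_coeff_0_iff)
  have X0: "j = 0 \<and> l \<le> int M" if "coeff (coef X l) j \<noteq> 0" for l j
  proof -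
    have "coef X l \<noteq> 0" using that by auto
    then show ?thesis using le_degree[OF that] X(1)[of l] X(2)[of l] by simp
  qed
  have wX: "wle \<alpha> (\<alpha> * real M) X"
    unfolding wle_def
  proof (intro allI impI)
    fix l j assume "coeff (coef X l) j \<noteq> 0"
    from X0[OF this] have "j = 0" "real_of_int l \<le> real M" by simp_all
    then show "\<alpha> * of_int l + real j \<le> \<alpha> * real M" using \<alpha> by simp
  qed
  have sX: "symb \<alpha> (\<alpha> * real M) X = [:\<eta>:]"
  proof (rule poly_eqI)
    fix j
    show "coeff (symb \<alpha> (\<alpha> * real M) X) j = coeff [:\<eta>:] j"
    proof (cases j)
      case 0
      then show ?thesis using coeff_symb[OF \<alpha>(2), of "int M" 0 "\<alpha> * real M" X] by (simp add: \<eta>_def)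
    next
      case (Suc j')
      have "coeff (symb \<alpha> (\<alpha> * real M) X) j = 0"
      proof (rule ccontr)
        assume "coeff (symb \<alpha> (\<alpha> * real M) X) j \<noteq> 0"
        then obtain l where "coeff (coef X l) j \<noteq> 0" by (rule coeff_symb_nonzeroD[OF \<alpha>(2)])
        then show False using X0[of l j] Suc by simp
      qed
      then show ?thesis using Suc by simp
    qed
  qed
  have "\<exists>w c. wle \<alpha> w ((com X ^^ i) b) \<and> symb \<alpha> w ((com X ^^ i) b) = monom c (J - i) \<and> c \<noteq> 0"
    if "i \<le> J" for i
    using that
  proof (induction i)
    case 0
    then show ?case using wb sb c(1) by auto
  next
    case (Suc i)
    then obtain w c where w: "wle \<alpha> w ((com X ^^ i) b)" "symb \<alpha> w ((com X ^^ i) b) = monom c (J - i)" "c \<noteq> 0"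
      by auto
    have "symb \<alpha> (\<alpha> * real M + w - 1) (com X ((com X ^^ i) b)) = smult (of_real (1 / \<alpha>))
        (smult (of_real w) (pderiv [:\<eta>:] * monom c (J - i)) - smult (of_real (\<alpha> * real M)) ([:\<eta>:] * pderiv (monom c (J - i))))"
      "wle \<alpha> (\<alpha> * real M + w - 1) (com X ((com X ^^ i) b))"
      using com_symbol[OF \<alpha>(2) wX w(1)] sX w(2) by simp_all
    moreover have "smult (of_real (1 / \<alpha>))
        (smult (of_real w) (pderiv [:\<eta>:] * monom c (J - i)) - smult (of_real (\<alpha> * real M)) ([:\<eta>:] * pderiv (monom c (J - i))))
        = monom (- (of_nat M * \<eta> * of_nat (J - i) * c)) (J - Suc i)"
      using \<alpha>(2) by (simp add: pderiv_monom smult_monom minus_monom pderiv_pCons)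
    ultimately show ?case using Suc.prems w(3) \<eta> M(2)
      by (intro exI[of _ "\<alpha> * real M + w - 1"] exI[of _ "- (of_nat M * \<eta> * of_nat (J - i) * c)"]) auto
  qed
  from this[of "Suc n"] Jn b show False by (auto simp del: funpow.simps)
qed

lemma scale_aut:
  assumes "\<eta> \<noteq> 0"
  obtains \<phi> where "B_aut lam \<phi>" "\<phi> sX = cst \<eta> * sX" "\<phi> sT = sT"
proof -
  have hom: "\<exists>\<phi>. B_hom lam \<phi> \<and> \<phi> sX = cst \<eta> * sX \<and> \<phi> sT = sT" if "\<eta> \<noteq> 0" for \<eta>
  proof -
    let ?x = "cst \<eta> * sX" and ?y = "cst (1 / \<eta>) * sY lam"
    have r: "com sX (sY lam) = cst 2 * sT" "com (cst 2 * sT) sX = cst 2 * sX"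
      "com (cst 2 * sT) (sY lam) = - (cst 2 * sY lam)"
      "cst 2 * (sY lam * sX) + cst (1/2) * ((cst 2 * sT) * (cst 2 * sT)) + (cst 2 * sT) = cst ((lam\<^sup>2 - 1) / 2)"
      using sl2_rel_sgen[of lam] by (simp_all add: sl2_rel_def)
    have cc: "cst \<eta> * (cst (1 / \<eta>) * a) = a" "cst (1 / \<eta>) * (cst \<eta> * a) = a" for a
      using that by (simp_all flip: mult.assoc cst_mult)
    have "?y * ?x = sY lam * sX"
      by (simp add: mult.assoc cst_left_commute[of "sY lam"] cc)
    then have "sl2_rel lam ?x (cst 2 * sT) ?y"
      unfolding sl2_rel_def com_cst_right[of _ "1 / \<eta>"] com_cst_left[of \<eta>] com_cst_right[of _ \<eta>] cc
      using r by (simp add: cst_left_commute[of "cst 2"])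
    then obtain \<phi> where \<phi>: "B_hom lam \<phi>" "\<phi> sX = ?x" "\<phi> (cst 2 * sT) = cst 2 * sT"
      using B_hom_exists B_mult B_cst B_gens by metis
    have "\<phi> sT = \<phi> (cst (1/2) * (cst 2 * sT))" by (simp flip: mult.assoc cst_mult)
    also have "\<dots> = sT" using B_homD(5)[OF \<phi>(1), of "cst 2 * sT" "1/2"] \<phi>(3)
      by (simp add: B_mult B_cst B_gens flip: mult.assoc cst_mult)
    finally show ?thesis using \<phi> by blast
  qed
  obtain \<phi> where \<phi>: "B_hom lam \<phi>" "\<phi> sX = cst \<eta> * sX" "\<phi> sT = sT" using hom[OF assms] by blast
  obtain \<psi> where \<psi>: "B_hom lam \<psi>" "\<psi> sX = cst (1 / \<eta>) * sX" "\<psi> sT = sT" using hom[of "1 / \<eta>"] assms by auto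
  have "\<phi> (\<psi> a) = a" if "a \<in> B lam" for a
    by (rule B_hom_fix[OF B_hom_comp[OF \<phi>(1) \<psi>(1)] _ _ that])
      (simp_all add: \<phi> \<psi> B_homD[OF \<phi>(1)] B_gens assms flip: mult.assoc cst_mult)
  moreover have "\<psi> (\<phi> a) = a" if "a \<in> B lam" for a
    by (rule B_hom_fix[OF B_hom_comp[OF \<psi>(1) \<phi>(1)] _ _ that])
      (simp_all add: \<phi> \<psi> B_homD[OF \<psi>(1)] B_gens assms flip: mult.assoc cst_mult)
  ultimately have "B_aut lam \<phi>" unfolding B_aut_def using \<phi>(1) \<psi>(1) by blast
  then show ?thesis using that \<phi> by blast
qed

lemma coef_com_constant:
  assumes "\<And>k. degree (coef X k) = 0"
  shows "coef (com a X) n = (\<Sum>l | coef X l \<noteq> 0. (shift l (coef a (n - l)) - coef a (n - l)) * coef X l)"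
proof -
  have cs: "com a (sum f A) = (\<Sum>l\<in>A. com a (f l))" for f and A :: "int set"
    by (induction A rule: infinite_finite_induct) (simp_all add: com_add_right)
  have "coef (com a (tmon l (coef X l))) n = (shift l (coef a (n - l)) - coef a (n - l)) * coef X l" for l
  proof -
    obtain c where "coef X l = [:c:]" using assms degree_eq_zeroE by blast
    then show ?thesis
      by (simp add: com_def coef_mult_tmon_left coef_mult_tmon_right smult_diff_right)
  qed
  then show ?thesis by (subst skew_expand[of X]) (simp only: cs coef_sum)
qed

lemma lo_com: "lo n a \<Longrightarrow> lo m b \<Longrightarrow> lo (n + m) (com a b)"
  using lo_mult[of n a m b] lo_mult[of m b n a] by (simp add: com_def lo_def add.commute)

text \<open>Two brackets with X kill H and three kill Y, so H is at most linear and Y at most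
  quadratic in theta. The cone then bounds their exponents of T below by 0 and -1. For x(T) = X and
  c(T) the theta-coefficient of H, the relation [H, X] = 2X reads c T x' = 2 x. Comparing top terms
  makes c constant, and then x is a monomial.\<close>

lemma sl2_triple_constant:
  assumes B: "X \<in> B lam" "H \<in> B lam" "Y \<in> B lam" and X0: "X \<noteq> 0"
    and X: "\<And>k. degree (coef X k) = 0"
    and rel: "com X Y = H" "com H X = cst 2 * X"
  obtains \<eta> where "\<eta> \<noteq> 0" "X = cst \<eta> * sX"
    "\<And>k. k \<noteq> 0 \<Longrightarrow> degree (coef H k) = 0" "\<And>k. k < 0 \<Longrightarrow> coef H k = 0" "coeff (coef H 0) 1 = 2" "degree (coef H 0) \<le> 1"
proof -
  have pos: "k \<ge> 0" if "coef X k \<noteq> 0" for k using B_degree[OF B(1) that] X[of k] by simp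
  have comXH: "com X H = - (cst 2 * X)" using rel(2) by (simp add: com_def algebra_simps)
  have comXX: "com X (cst c * X) = 0" for c by (simp add: com_cst_right) (simp add: com_def)
  have comX2X: "com X (- (cst 2 * X)) = 0" using comXX[of "-2"] by (simp add: cst_uminus)
  have ne: "{k. coef X k \<noteq> 0} \<noteq> {}" using X0 skew_eqI[of X 0] by auto
  define M where "M = nat (Max {k. coef X k \<noteq> 0})"
  have "Max {k. coef X k \<noteq> 0} \<in> {k. coef X k \<noteq> 0}" using ne by (intro Max_in) auto
  then have M: "coef X (int M) \<noteq> 0" using pos by (simp add: M_def)
  have Mmax: "k \<le> int M" if "coef X k \<noteq> 0" for k
  proof -
    have "k \<le> Max {k. coef X k \<noteq> 0}" using that by simp
    moreover have "\<dots> \<le> int M" by (simp add: M_def)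
    ultimately show ?thesis by linarith
  qed
  have "M > 0"
  proof (rule ccontr)
    assume "\<not> M > 0"
    then have only0: "k = 0" if "coef X k \<noteq> 0" for k using pos[OF that] Mmax[OF that] by simp
    have "coef (com H X) 0 = 0"
      unfolding coef_com_constant[OF X] by (rule sum.neutral) (use only0 in force)
    then have "coef X 0 = 0" using rel(2) by simp
    then show False using M \<open>\<not> M > 0\<close> by simp
  qed
  note dle = degree_le_of_com_nilpotent[OF X Mmax M \<open>M > 0\<close>]
  have H2: "com X (com X H) = 0" by (simp only: comXH comX2X)
  have dH: "degree (coef H k) \<le> 1" for k
    using dle[of "Suc 0" H k] H2 by simp
  have dY: "degree (coef Y k) \<le> 2" for k
    using dle[of "Suc (Suc 0)" Y k] H2 rel(1) by simp
  have loH: "lo 0 H"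
    unfolding lo_def
  proof (intro allI impI)
    fix k :: int assume "k < 0"
    then show "coef H k = 0" using B_degree[OF B(2), of k] dH[of k] by force
  qed
  have loY: "lo (- 1) Y"
    unfolding lo_def
  proof (intro allI impI)
    fix k :: int assume "k < - 1"
    then show "coef Y k = 0" using B_degree[OF B(3), of k] dY[of k] by force
  qed
  have loX: "lo 0 X" using pos by (force simp: lo_def)
  have eq: "smult 2 (coef X n) = (\<Sum>l | coef X l \<noteq> 0. (shift l (coef H (n - l)) - coef H (n - l)) * coef X l)" for n
    using coef_com_constant[OF X, of H n] rel(2) by simp
  have x0: "coef X 0 = 0"
  proof -
    have "(shift l (coef H (0 - l)) - coef H (0 - l)) * coef X l = 0" if "coef X l \<noteq> 0" for l
      using pos[OF that] loH by (cases "l = 0") (simp_all add: lo_def)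
    then show ?thesis using eq[of 0] by simp
  qed
  \<comment> \<open>Otherwise X starts at T^2 or later and H = [X, Y] at T or later, so 2X = [H, X]
    pushes the lowest exponent of X upwards without end.\<close>
  have x1: "coef X 1 \<noteq> 0"
  proof
    assume x1: "coef X 1 = 0"
    have "lo 2 X"
      unfolding lo_def
    proof (intro allI impI)
      fix k :: int assume "k < 2"
      then consider "k < 0" | "k = 0" | "k = 1" by linarith
      then show "coef X k = 0" using x0 x1 pos[of k] by cases auto
    qed
    then have H1: "lo 1 H" using lo_com[OF \<open>lo 2 X\<close> loY] rel(1) by simp
    have step: "lo (int n) X" for n
    proof (induction n)
      case 0
      then show ?case using loX by simp
    next
      case (Suc n)
      have "lo (1 + int n) (cst 2 * X)" using lo_com[OF H1 Suc] rel(2) by simp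
      then show ?case by (simp add: lo_def)
    qed
    show False using step[of "Suc M"] M by (simp add: lo_def)
  qed
  define c where "c k = coeff (coef H k) 1" for k
  have sh: "shift l (coef H k) - coef H k = [:of_int l * c k:]" for l k
  proof -
    have "coef H k = [:coeff (coef H k) 0, c k:]"
      unfolding c_def using dH[of k]
      by (intro poly_eqI) (auto simp: coeff_pCons coeff_eq_0 split: nat.splits)
    then obtain e where e: "coef H k = [:e, c k:]" by metis
    show ?thesis unfolding e by (rule poly_ext) (simp add: algebra_simps)
  qed
  have eq': "2 * coeff (coef X n) 0 = (\<Sum>l | coef X l \<noteq> 0. of_int l * c (n - l) * coeff (coef X l) 0)" for n
    using arg_cong[OF eq[of n], of "\<lambda>p. coeff p 0"] by (simp add: sh coeff_sum)
  have fin: "finite {k. c k \<noteq> 0}"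
    by (rule finite_subset[OF _ finite_coef[of H]]) (auto simp: c_def)
  have cn: "{k. c k \<noteq> 0} \<noteq> {}"
  proof
    assume "{k. c k \<noteq> 0} = {}"
    then have "coeff (coef X 1) 0 = 0" using eq'[of 1] by simp
    then show False using x1 X by (metis leading_coeff_0_iff)
  qed
  define K where "K = Max {k. c k \<noteq> 0}"
  have K: "c K \<noteq> 0" using Max_in[OF fin cn] by (simp add: K_def)
  have Kmax: "k \<le> K" if "c k \<noteq> 0" for k using Max_ge[OF fin, of k] that by (simp add: K_def)
  have cM: "coeff (coef X (int M)) 0 \<noteq> 0" using M X by (metis leading_coeff_0_iff)
  \<comment> \<open>At the exponent K + M only l = M contributes. The resulting nonzero coefficient
    puts K + M into the support of \<open>X\<close>, whence K \<le> 0.\<close>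
  have "2 * coeff (coef X (K + int M)) 0 = of_int (int M) * c K * coeff (coef X (int M)) 0"
  proof -
    have "(\<Sum>l | coef X l \<noteq> 0. of_int l * c (K + int M - l) * coeff (coef X l) 0)
      = (\<Sum>l | coef X l \<noteq> 0. if l = int M then of_int (int M) * c K * coeff (coef X (int M)) 0 else 0)"
    proof (rule sum.cong)
      fix l assume "l \<in> {l. coef X l \<noteq> 0}"
      then have "l \<le> int M" using Mmax by simp
      then have "c (K + int M - l) = 0" if "l \<noteq> int M" using Kmax[of "K + int M - l"] that by force
      then show "of_int l * c (K + int M - l) * coeff (coef X l) 0
          = (if l = int M then of_int (int M) * c K * coeff (coef X (int M)) 0 else 0)" by auto
    qed simp
    then show ?thesis unfolding eq' using M by simp
  qed
  then have "coef X (K + int M) \<noteq> 0" using K cM \<open>M > 0\<close> by auto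
  then have "K \<le> 0" using Mmax by fastforce
  then have c0: "c k = 0" if "k \<noteq> 0" for k
    using Kmax[of k] loH that by (cases "k < 0") (auto simp: c_def lo_def)
  have eq2: "2 * coeff (coef X n) 0 = of_int n * c 0 * coeff (coef X n) 0" for n
  proof -
    have "(\<Sum>l | coef X l \<noteq> 0. of_int l * c (n - l) * coeff (coef X l) 0)
      = (\<Sum>l | coef X l \<noteq> 0. if l = n then of_int n * c 0 * coeff (coef X n) 0 else 0)"
      by (rule sum.cong) (auto simp: c0)
    then show ?thesis unfolding eq' by (cases "coef X n = 0") simp_all
  qed
  have cx1: "coeff (coef X 1) 0 \<noteq> 0" using x1 X by (metis leading_coeff_0_iff)
  then have c2: "c 0 = 2" using eq2[of 1] by simp
  have other: "coef X n = 0" if "n \<noteq> 1" for n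
  proof -
    have "(of_int n - 1) * coeff (coef X n) 0 = 0" using eq2[of n] c2 by (simp add: algebra_simps)
    moreover have "of_int n - (1::complex) \<noteq> 0" using that by (metis eq_iff_diff_eq_0 of_int_1 of_int_eq_iff)
    ultimately have "coeff (coef X n) 0 = 0" by simp
    then show ?thesis using X by (metis leading_coeff_0_iff)
  qed
  obtain \<eta> where \<eta>: "coef X 1 = [:\<eta>:]" using X degree_eq_zeroE by blast
  show ?thesis
  proof (rule that[of \<eta>])
    show "\<eta> \<noteq> 0" using x1 \<eta> by auto
    show "X = cst \<eta> * sX" by (rule skew_eqI) (auto simp: sX_def cst_tmon coef_tmon other \<eta>)
    show "degree (coef H k) = 0" if "k \<noteq> 0" for k
    proof (rule ccontr)
      assume "degree (coef H k) \<noteq> 0"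
      then have "degree (coef H k) = 1" using dH[of k] by linarith
      then show False using c0[OF that] unfolding c_def
        by (metis degree_0 leading_coeff_0_iff zero_neq_one)
    qed
    show "coef H k = 0" if "k < 0" for k using loH that by (simp add: lo_def)
    show "coeff (coef H 0) 1 = 2" using c2 by (simp add: c_def)
    show "degree (coef H 0) \<le> 1" by (rule dH)
  qed
qed

text \<open>Only the brackets of the triple are assumed. The Casimir relation follows in the end,
  because membership of y in B allows only multiples of q as its coefficient.\<close>

lemma sl2_normalize:
  assumes x: "ad_nilpotent lam x" "x \<noteq> 0" and B: "h \<in> B lam" "y \<in> B lam"
    and rel: "com x y = h" "com h x = cst 2 * x" "com h y = - (cst 2 * y)"
  obtains \<Psi> where "B_aut lam \<Psi>" "\<Psi> x = sX" "\<Psi> h = cst 2 * sT" "\<Psi> y = sY lam"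
proof -
  have xB: "x \<in> B lam" using x(1) by (simp add: ad_nilpotent_def)
  obtain \<phi> where \<phi>: "B_aut lam \<phi>" "\<And>k. degree (coef (\<phi> x) k) = 0"
    using ad_nilpotent_conjugate[OF x(1)] by blast
  note \<phi>h = B_aut_hom[OF \<phi>(1)]
  have "\<phi> x \<noteq> 0" using B_aut_eq_0[OF \<phi>(1) xB] x(2) by blast
  have r\<phi>: "com (\<phi> x) (\<phi> y) = \<phi> h" "com (\<phi> h) (\<phi> x) = cst 2 * \<phi> x"
    using B_hom_com[OF \<phi>h xB B(2)] B_hom_com[OF \<phi>h B(1) xB] rel B_homD(5)[OF \<phi>h xB] by simp_all
  obtain \<eta> where \<eta>: "\<eta> \<noteq> 0" "\<phi> x = cst \<eta> * sX"
    and H: "\<And>k. k \<noteq> 0 \<Longrightarrow> degree (coef (\<phi> h) k) = 0" "\<And>k. k < 0 \<Longrightarrow> coef (\<phi> h) k = 0"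
      "coeff (coef (\<phi> h) 0) 1 = 2" "degree (coef (\<phi> h) 0) \<le> 1"
    using sl2_triple_constant[OF B_homD(1)[OF \<phi>h xB] B_homD(1)[OF \<phi>h B(1)] B_homD(1)[OF \<phi>h B(2)]
        \<open>\<phi> x \<noteq> 0\<close> \<phi>(2) r\<phi>] by blast
  define e where "e i = coeff (coef (\<phi> h) (int i)) 0" for i
  have "finite (nat ` {k. coef (\<phi> h) k \<noteq> 0})" by simp
  then obtain R where R: "\<forall>i\<in>nat ` {k. coef (\<phi> h) k \<noteq> 0}. i \<le> R"
    using finite_nat_set_iff_bounded_le by blast
  have eR: "e i = 0" if "i > R" for i
  proof (rule ccontr)
    assume "e i \<noteq> 0"
    then have "coef (\<phi> h) (int i) \<noteq> 0" by (auto simp: e_def)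
    then have "nat (int i) \<le> R" using R by blast
    then show False using that by simp
  qed
  have hE: "\<phi> h = cst 2 * sT + (\<Sum>i\<le>R. cst (e i) * sX ^ i)"
  proof (rule skew_eqI)
    fix k
    have "coef (\<Sum>i\<le>R. cst (e i) * sX ^ i) k = (\<Sum>i\<le>R. if k = int i then [:e i:] else 0)"
      unfolding coef_sum by (rule sum.cong) (auto simp: sX_power coef_tmon)
    also have "\<dots> = (if k \<ge> 0 then [:e (nat k):] else 0)"
    proof (cases "k \<ge> 0")
      case True
      then have "(\<Sum>i\<le>R. if k = int i then [:e i:] else 0) = (\<Sum>i\<le>R. if i = nat k then [:e (nat k):] else 0)"
        by (intro sum.cong) auto
      then show ?thesis using True eR[of "nat k"] by simp
    qed (auto intro!: sum.neutral)
    finally have sum: "coef (\<Sum>i\<le>R. cst (e i) * sX ^ i) k = (if k \<ge> 0 then [:e (nat k):] else 0)" .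
    consider "k < 0" | "k = 0" | "k > 0" by linarith
    then show "coef (\<phi> h) k = coef (cst 2 * sT + (\<Sum>i\<le>R. cst (e i) * sX ^ i)) k"
    proof cases
      case 1
      then show ?thesis using H(2) by (simp add: sum sT_def coef_tmon)
    next
      case 2
      have "coef (\<phi> h) 0 = [:e 0, 2:]"
      proof (rule poly_eqI)
        fix n
        show "coeff (coef (\<phi> h) 0) n = coeff [:e 0, 2:] n"
          using H(3,4) by (cases n rule: nat.exhaust; cases "n = 1") (auto simp: e_def coeff_pCons coeff_eq_0 split: nat.splits)
      qed
      then show ?thesis using sum unfolding 2 by (simp add: sT_def coef_tmon)
    next
      case 3
      then obtain c where c: "coef (\<phi> h) k = [:c:]" using H(1)[of k] degree_eq_zeroE by blast
      then have "e (nat k) = c" using 3 by (simp add: e_def)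
      then show ?thesis using 3 c by (simp add: sum sT_def coef_tmon)
    qed
  qed
  \<comment> \<open>The index is shifted because of the extra factor X, and the half comes from H =
    2 theta. The constant term \<open>e 0\<close> cannot be removed by such a translation and is
    dealt with through y.\<close>
  obtain \<chi> where \<chi>: "B_aut lam \<chi>" "\<chi> sX = sX"
    "\<chi> sT = sT + sX * (\<Sum>i\<in>{..<R}. cst (- e (Suc i) / 2) * sX ^ i)"
    using translate_aut[where A = "{..<R}" and c = "\<lambda>i. - e (Suc i) / 2"] .
  note \<chi>h = B_aut_hom[OF \<chi>(1)]
  have \<chi>H: "\<chi> (\<phi> h) = cst 2 * sT + cst (e 0)"
  proof -
    have "\<chi> (\<Sum>i\<le>R. cst (e i) * sX ^ i) = (\<Sum>i\<le>R. cst (e i) * sX ^ i)"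
      using \<chi>(2) by (simp add: B_hom_sum[OF \<chi>h] B_homD[OF \<chi>h] B_mult B_cst B_power B_gens
          B_hom_power[OF \<chi>h] B_hom_cst[OF \<chi>h])
    moreover have "(\<Sum>i\<le>R. cst (e i) * sX ^ i) = cst (e 0) + (\<Sum>i<R. cst (e (Suc i)) * sX ^ Suc i)"
      by (subst sum.atMost_shift) simp
    moreover have "cst 2 * (sX * (\<Sum>i<R. cst (- e (Suc i) / 2) * sX ^ i)) = - (\<Sum>i<R. cst (e (Suc i)) * sX ^ Suc i)"
    proof -
      have "cst 2 * (sX * (cst (- e (Suc i) / 2) * sX ^ i)) = - (cst (e (Suc i)) * sX ^ Suc i)" for i
      proof -
        have "cst 2 * (sX * (cst (- e (Suc i) / 2) * sX ^ i)) = cst (2 * (- e (Suc i) / 2)) * sX ^ Suc i"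
          unfolding cst_mult by (simp only: cst_left_commute[of sX] mult.assoc power_Suc)
        then show ?thesis by (simp add: cst_uminus)
      qed
      then show ?thesis by (simp only: sum_distrib_left sum_negf)
    qed
    moreover have "\<chi> (cst 2 * sT + (\<Sum>i\<le>R. cst (e i) * sX ^ i)) = cst 2 * \<chi> sT + \<chi> (\<Sum>i\<le>R. cst (e i) * sX ^ i)"
      using B_homD(3)[OF \<chi>h, of "cst 2 * sT" "\<Sum>i\<le>R. cst (e i) * sX ^ i"] B_homD(5)[OF \<chi>h B_gens(2)]
      by (simp add: B_mult B_cst B_gens B_sum B_power)
    ultimately show ?thesis unfolding hE \<chi>(3) distrib_left by simp
  qed
  have "1 / \<eta> \<noteq> 0" using \<eta>(1) by simp
  then obtain \<tau> where \<tau>: "B_aut lam \<tau>" "\<tau> sX = cst (1 / \<eta>) * sX" "\<tau> sT = sT" by (rule scale_aut)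
  note \<tau>h = B_aut_hom[OF \<tau>(1)]
  define \<Psi> where "\<Psi> a = \<tau> (\<chi> (\<phi> a))" for a
  have \<Psi>: "B_aut lam \<Psi>" unfolding \<Psi>_def by (rule B_aut_comp[OF \<tau>(1) B_aut_comp[OF \<chi>(1) \<phi>(1)]])
  note \<Psi>h = B_aut_hom[OF \<Psi>]
  have \<Psi>x: "\<Psi> x = sX"
    using \<eta>(1) by (simp add: \<Psi>_def \<eta>(2) B_homD[OF \<chi>h] B_homD[OF \<tau>h] \<chi>(2) \<tau>(2) B_gens flip: mult.assoc cst_mult)
  have \<Psi>H: "\<Psi> h = cst 2 * sT + cst (e 0)"
    by (simp add: \<Psi>_def \<chi>H B_homD[OF \<tau>h] B_mult B_cst B_gens B_hom_cst[OF \<tau>h] \<tau>(3))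
  have r1: "com sX (\<Psi> y) = cst 2 * sT + cst (e 0)"
    using B_hom_com[OF \<Psi>h xB B(2)] rel(1) \<Psi>x \<Psi>H by simp
  have cc: "com (cst c) a = 0" for c a by (simp add: com_def cst_commute)
  have r2: "com sT (\<Psi> y) = - \<Psi> y"
  proof -
    have "com (cst 2 * sT + cst (e 0)) (\<Psi> y) = - (cst 2 * \<Psi> y)"
      using B_hom_com[OF \<Psi>h B] rel(3) \<Psi>H B_hom_uminus[OF \<Psi>h, of "cst 2 * y"] B_homD(5)[OF \<Psi>h B(2)]
      by (simp add: B_mult B_cst B)
    then have "cst 2 * com sT (\<Psi> y) = - (cst 2 * \<Psi> y)" by (simp add: com_add_left com_cst_left cc)
    then have "cst (1/2) * (cst 2 * com sT (\<Psi> y)) = cst (1/2) * (cst 2 * (- \<Psi> y))" by simp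
    then show ?thesis by (simp flip: mult.assoc cst_mult)
  qed
  define u where "u = coef (\<Psi> y) (- 1)"
  have other: "coef (\<Psi> y) k = 0" if "k \<noteq> - 1" for k
  proof -
    have "smult (of_int k) (coef (\<Psi> y) k) = - coef (\<Psi> y) k"
      using coef_com_sT[of "\<Psi> y" k] r2 by simp
    then have "smult (of_int k + 1) (coef (\<Psi> y) k) = 0" by (simp add: smult_add_left)
    moreover have "of_int k + (1::complex) \<noteq> 0"
      using that by (metis add_eq_0_iff2 of_int_1 of_int_eq_iff of_int_minus)
    ultimately show ?thesis by simp
  qed
  have yu: "\<Psi> y = tmon (- 1) u" by (rule skew_eqI) (simp add: coef_tmon other u_def)
  have du: "u - shift 1 u = [:e 0, 2:]"
  proof -
    have "coef (com sX (\<Psi> y)) 0 = u - shift 1 u"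
      unfolding sX_def coef_com_tmon_left by (simp add: u_def)
    then show ?thesis unfolding r1 by (simp add: sT_def cst_def coef_tmon tmon_mult)
  qed
  have "degree u \<le> 2"
    unfolding u_def
  proof (rule degree_le_of_com_nilpotent[of sX 1])
    have "com sX sT = - sX" by (simp add: com_def sT_sX)
    moreover have "com sX (cst c) = 0" for c by (simp add: com_def cst_commute)
    moreover have "com sX sX = 0" by (simp add: com_def)
    ultimately have "com sX (com sX (cst 2 * sT + cst (e 0))) = 0"
      using com_cst_right[of sX "-2" sX] by (simp add: com_add_right com_cst_right cst_uminus)
    then show "(com sX ^^ Suc 2) (\<Psi> y) = 0" by (simp add: r1 numeral_2_eq_2)
  qed (auto simp: sX_def coef_tmon split: if_splits)
  \<comment> \<open>Degree at most 2 and divisibility by q leave u = \<rho> q. In \<open>du\<close>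
    the value at 0 gives e 0 = 0, because q(0) = q(1), and the value at 1 gives \<rho> = 1, because
    q(1) - q(2) = 2.\<close>
  moreover have "qpoly lam dvd u"
    using B_dvd[OF B_homD(1)[OF \<Psi>h B(2)], of 1] by (simp add: u_def)
  then obtain r where r: "u = qpoly lam * r" by (elim dvdE)
  have u0: "u \<noteq> 0" using du by auto
  ultimately have "degree r = 0" using degree_mult_eq[of "qpoly lam" r] r degree_qpoly[of lam] by auto
  then obtain \<rho> where "r = [:\<rho>:]" using degree_eq_zeroE by blast
  then have ur: "u = smult \<rho> (qpoly lam)" using r by simp
  have "e 0 = 0" using arg_cong[OF du, of "\<lambda>p. poly p 0"] by (simp add: ur qpoly_def)
  moreover have "\<rho> = 1" using arg_cong[OF du, of "\<lambda>p. poly p 1"] \<open>e 0 = 0\<close>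
    by (simp add: ur qpoly_def algebra_simps)
  ultimately show ?thesis using that[OF \<Psi>] \<Psi>x \<Psi>H yu ur by (simp add: sY_def)
qed

text \<open>On coefficients ad X is a difference operator followed by a shift of the exponent of T,
  so it lowers the theta-degree.\<close>

lemma ad_nilpotent_sX: "ad_nilpotent lam sX"
proof -
  have "\<exists>n. (com sX ^^ n) b = 0" for b
  proof -
    \<comment> \<open>Subtraction of naturals stops at 0, so vanishing after more than N brackets is
      carried as a separate conjunct.\<close>
    have d: "degree (coef ((com sX ^^ n) b) k) \<le> N - n \<and> (n > N \<longrightarrow> coef ((com sX ^^ n) b) k = 0)"
      if N: "\<And>k. degree (coef b k) \<le> N" for n N k
    proof (induction n arbitrary: k)
      case 0
      then show ?case using N by simp
    next
      case (Suc n)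
      let ?p = "coef ((com sX ^^ n) b) (k - 1)"
      have eq: "coef ((com sX ^^ Suc n) b) k = ?p - shift 1 ?p"
        unfolding sX_def by (simp add: coef_com_tmon_left)
      show ?case
      proof (cases "degree ?p = 0")
        case True
        then obtain c where "?p = [:c:]" using degree_eq_zeroE by blast
        then show ?thesis unfolding eq by simp
      next
        case False
        have "coeff (?p - shift 1 ?p) (degree ?p) = 0"
          using lead_coeff_comp[of "[:1, 1:]" ?p] by (simp add: shift_def degree_pcompose)
        moreover have "degree (?p - shift 1 ?p) \<le> degree ?p" by (intro degree_diff_le) auto
        ultimately have "degree (?p - shift 1 ?p) < degree ?p"
          using False by (metis degree_0 leading_coeff_0_iff le_neq_implies_less not_gr_zero)
        then show ?thesis unfolding eq using Suc[of "k - 1"] False by auto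
      qed
    qed
    obtain N where "\<And>k. degree (coef b k) \<le> N" using degree_coef_bounded by blast
    from d[OF this] have "(com sX ^^ Suc N) b = 0" by (intro skew_eqI) (metis coef_0 lessI)
    then show ?thesis by blast
  qed
  then show ?thesis by (simp add: ad_nilpotent_def B_gens)
qed

section \<open>Transport to the quotient algebra\<close>

lemma no_antilinear_involution_B:
  assumes \<omega>: "antilinear_lie lam \<omega>" and inv: "\<And>a. a \<in> B lam \<Longrightarrow> \<omega> (\<omega> a) = a"
  shows "lam\<^sup>2 \<in> \<real>"
proof -
  have \<omega>B: "\<omega> a \<in> B lam" if "a \<in> B lam" for a using \<omega> that by (simp add: antilinear_lie_def)
  have com: "\<omega> (com a b) = com (\<omega> a) (\<omega> b)" if "a \<in> B lam" "b \<in> B lam" for a b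
    using \<omega> that by (simp add: antilinear_lie_def)
  have sc: "\<omega> (cst c * a) = cst (cnj c) * \<omega> a" if "a \<in> B lam" for a c
    using \<omega> that by (simp add: antilinear_lie_def)
  have inj: "\<omega> a = 0 \<Longrightarrow> a = 0" if "a \<in> B lam" for a
    using \<omega> that by (simp add: antilinear_lie_def)
  \<comment> \<open>Involutivity makes every \<open>b\<close> the image of \<omega> b, so local
    nilpotency passes from ad X to ad (\<omega> X).\<close>
  have "\<exists>n. (com (\<omega> sX) ^^ n) b = 0" if b: "b \<in> B lam" for b
  proof -
    have "(com (\<omega> sX) ^^ n) b = \<omega> ((com sX ^^ n) (\<omega> b))" for n
      using inv[OF b] by (induction n) (simp_all add: com B_gens B_com_iterate \<omega>B b)
    moreover obtain n where "(com sX ^^ n) (\<omega> b) = 0"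
      using ad_nilpotent_sX \<omega>B[OF b] by (rule ad_nilpotentD)
    ultimately have "(com (\<omega> sX) ^^ n) b = 0" using sc[OF B_0, of 0] by simp
    then show ?thesis ..
  qed
  then have nil: "ad_nilpotent lam (\<omega> sX)" by (simp add: ad_nilpotent_def \<omega>B B_gens)
  have "sX \<noteq> 0" by (simp add: sX_def tmon_eq_0_iff)
  then have "\<omega> sX \<noteq> 0" using inj[OF B_gens(1)] by blast
  have hB: "cst 2 * sT \<in> B lam" by (simp add: B_mult B_cst B_gens)
  \<comment> \<open>The sign in the third relation is moved into the scalar so that antilinearity
    applies to it directly.\<close>
  have "com sX (sY lam) = cst 2 * sT" "com (cst 2 * sT) sX = cst 2 * sX"
    "com (cst 2 * sT) (sY lam) = cst (- 2) * sY lam"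
    using sl2_rel_sgen[of lam] by (simp_all add: sl2_rel_def cst_uminus)
  then have rel: "com (\<omega> sX) (\<omega> (sY lam)) = \<omega> (cst 2 * sT)"
    "com (\<omega> (cst 2 * sT)) (\<omega> sX) = cst 2 * \<omega> sX"
    "com (\<omega> (cst 2 * sT)) (\<omega> (sY lam)) = - (cst 2 * \<omega> (sY lam))"
    using com[OF B_gens(1) B_gens(3)] com[OF hB B_gens(1)] com[OF hB B_gens(3)]
      sc[OF B_gens(1), of 2] sc[OF B_gens(3), of "- 2"] by (simp_all add: cst_uminus)
  obtain \<Psi> where \<Psi>: "B_aut lam \<Psi>" "\<Psi> (\<omega> sX) = sX" "\<Psi> (\<omega> (cst 2 * sT)) = cst 2 * sT"
    "\<Psi> (\<omega> (sY lam)) = sY lam"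
    using sl2_normalize[OF nil \<open>\<omega> sX \<noteq> 0\<close> \<omega>B[OF hB] \<omega>B[OF B_gens(3)] rel] .
  note hom = B_aut_hom[OF \<Psi>(1)]
  have "antilinear_lie lam (\<lambda>a. \<Psi> (\<omega> a))"
    unfolding antilinear_lie_def
  proof (intro conjI ballI allI impI)
    fix a assume a: "a \<in> B lam"
    show "\<Psi> (\<omega> a) \<in> B lam" using a by (simp add: \<omega>B B_homD(1)[OF hom])
    show "\<Psi> (\<omega> (cst c * a)) = cst (cnj c) * \<Psi> (\<omega> a)" for c
      using a by (simp add: sc \<omega>B B_homD(5)[OF hom])
    show "a = 0" if "\<Psi> (\<omega> a) = 0" using that a B_aut_eq_0[OF \<Psi>(1)] inj \<omega>B by blast
    fix b assume b: "b \<in> B lam"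
    have "\<omega> (a + b) = \<omega> a + \<omega> b" using \<omega> a b by (simp add: antilinear_lie_def)
    then show "\<Psi> (\<omega> (a + b)) = \<Psi> (\<omega> a) + \<Psi> (\<omega> b)" using a b by (simp add: \<omega>B B_homD(3)[OF hom])
    show "\<Psi> (\<omega> (com a b)) = com (\<Psi> (\<omega> a)) (\<Psi> (\<omega> b))"
      using a b by (simp add: com \<omega>B B_hom_com[OF hom])
  qed
  then show ?thesis using antilinear_lie_fixing_sl2 \<Psi> by blast
qed

section \<open>Congruence classes as fibres of the evaluation\<close>

definition Ev :: "complex \<Rightarrow> fa \<Rightarrow> skew" where "Ev lam p = evs lam (Abs_nc p)"

lemma Ev_fadd: "p \<in> FA \<Longrightarrow> q \<in> FA \<Longrightarrow> Ev lam (fadd p q) = Ev lam p + Ev lam q"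
  and Ev_fsub: "p \<in> FA \<Longrightarrow> q \<in> FA \<Longrightarrow> Ev lam (fsub p q) = Ev lam p - Ev lam q"
  and Ev_fmul: "p \<in> FA \<Longrightarrow> q \<in> FA \<Longrightarrow> Ev lam (fmul p q) = Ev lam p * Ev lam q"
  and Ev_fsc: "p \<in> FA \<Longrightarrow> Ev lam (fsc c p) = cst c * Ev lam p"
proof -
  have "Abs_nc (fadd p q) = Abs_nc p + Abs_nc q" "Abs_nc (fsub p q) = Abs_nc p - Abs_nc q"
    "Abs_nc (fmul p q) = Abs_nc p * Abs_nc q" if "p \<in> FA" "q \<in> FA" for p q
    using that by (simp_all add: plus_ncpoly_def minus_ncpoly_def times_ncpoly_def Abs_nc_inverse)
  then show "p \<in> FA \<Longrightarrow> q \<in> FA \<Longrightarrow> Ev lam (fadd p q) = Ev lam p + Ev lam q"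
    "p \<in> FA \<Longrightarrow> q \<in> FA \<Longrightarrow> Ev lam (fsub p q) = Ev lam p - Ev lam q"
    "p \<in> FA \<Longrightarrow> q \<in> FA \<Longrightarrow> Ev lam (fmul p q) = Ev lam p * Ev lam q"
    by (simp_all add: Ev_def evs_def ev_add ev_diff ev_mult)
  have "p \<in> FA \<Longrightarrow> Abs_nc (fsc c p) = nsc c (Abs_nc p)"
    by (simp add: nsc_def Abs_nc_inverse)
  then show "p \<in> FA \<Longrightarrow> Ev lam (fsc c p) = cst c * Ev lam p"
    by (simp add: Ev_def evs_def ev_nsc)
qed

lemma Ev_eq_0_iff: "p \<in> FA \<Longrightarrow> Ev lam p = 0 \<longleftrightarrow> p \<in> ideal_gen lam"
  by (simp add: Ev_def evs_eq_0_iff Jid_def Abs_nc_inverse)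

lemma B_Ev: "B lam = Ev lam ` FA"
proof
  have "evs lam x = Ev lam (nco x)" for x by (simp add: Ev_def nco_inverse)
  then show "B lam \<subseteq> Ev lam ` FA" unfolding B_def using nco by auto
  show "Ev lam ` FA \<subseteq> B lam" by (auto simp: B_def Ev_def)
qed

lemma cls_Ev: "p \<in> FA \<Longrightarrow> cls lam p = {q \<in> FA. Ev lam q = Ev lam p}"
  unfolding cls_def using Ev_eq_0_iff[OF FA_fsub, of _ p lam] Ev_fsub[of _ p lam] by auto

definition fibre :: "complex \<Rightarrow> skew \<Rightarrow> fa set" where "fibre lam b = {q \<in> FA. Ev lam q = b}"

lemma cls_fibre: "p \<in> FA \<Longrightarrow> cls lam p = fibre lam (Ev lam p)"
  by (simp add: fibre_def cls_Ev)

lemma Alg_fibre: "Alg lam = fibre lam ` B lam"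
  unfolding Alg_def B_Ev using cls_fibre[of _ lam] by blast

text \<open>The chosen representative is arbitrary, but its evaluation depends only on the class.
  This turns the operations on classes into the ring operations of \<open>B lam\<close>.\<close>

lemma rep_fibre:
  assumes "b \<in> B lam"
  shows "rep (fibre lam b) \<in> FA" "Ev lam (rep (fibre lam b)) = b"
proof -
  obtain p where "p \<in> fibre lam b" using assms unfolding B_Ev fibre_def by auto
  then have "rep (fibre lam b) \<in> fibre lam b" unfolding rep_def by (rule someI[where P = "\<lambda>p. p \<in> fibre lam b"])
  then show "rep (fibre lam b) \<in> FA" "Ev lam (rep (fibre lam b)) = b" by (auto simp: fibre_def)
qed

lemma A_ops_fibre:
  assumes "a \<in> B lam" "b \<in> B lam"
  shows "A_add lam (fibre lam a) (fibre lam b) = fibre lam (a + b)"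
    "A_sc lam c (fibre lam a) = fibre lam (cst c * a)"
    "A_bracket lam (fibre lam a) (fibre lam b) = fibre lam (com a b)"
  using rep_fibre[OF assms(1)] rep_fibre[OF assms(2)]
  by (simp_all add: A_add_def A_sc_def A_bracket_def fcomm_def com_def cls_fibre
      FA_fadd FA_fsc FA_fsub FA_fmul Ev_fadd Ev_fsc Ev_fsub Ev_fmul)

theorem theorem6p2:
  fixes lam :: complex
  assumes "lam^2 \<notin> \<real>"
  shows "\<not> (\<exists>\<omega> :: fa set \<Rightarrow> fa set.
            (\<forall>a\<in>Alg lam. \<omega> a \<in> Alg lam) \<and>
            (\<forall>a\<in>Alg lam. \<forall>b\<in>Alg lam. \<omega> (A_add lam a b) = A_add lam (\<omega> a) (\<omega> b)) \<and>
            (\<forall>c. \<forall>a\<in>Alg lam. \<omega> (A_sc lam c a) = A_sc lam (cnj c) (\<omega> a)) \<and>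
            (\<forall>a\<in>Alg lam. \<forall>b\<in>Alg lam.
                \<omega> (A_bracket lam a b) = A_bracket lam (\<omega> a) (\<omega> b)) \<and>
            (\<forall>a\<in>Alg lam. \<omega> (\<omega> a) = a))"
proof (rule notI, elim exE conjE)
  fix \<omega> :: "fa set \<Rightarrow> fa set"
  assume "\<forall>a\<in>Alg lam. \<omega> a \<in> Alg lam"
    and "\<forall>a\<in>Alg lam. \<forall>b\<in>Alg lam. \<omega> (A_add lam a b) = A_add lam (\<omega> a) (\<omega> b)"
    and "\<forall>c. \<forall>a\<in>Alg lam. \<omega> (A_sc lam c a) = A_sc lam (cnj c) (\<omega> a)"
    and "\<forall>a\<in>Alg lam. \<forall>b\<in>Alg lam. \<omega> (A_bracket lam a b) = A_bracket lam (\<omega> a) (\<omega> b)"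
    and "\<forall>a\<in>Alg lam. \<omega> (\<omega> a) = a"
  note \<omega> = this[rule_format]
  \<comment> \<open>The given map is transported to \<open>B lam\<close> along the bijection between
    values of the evaluation and their fibres.\<close>
  define \<theta> where "\<theta> b = Ev lam (rep (\<omega> (fibre lam b)))" for b
  have fA: "fibre lam b \<in> Alg lam" if "b \<in> B lam" for b using that by (simp add: Alg_fibre)
  have \<theta>: "\<theta> b \<in> B lam" "\<omega> (fibre lam b) = fibre lam (\<theta> b)" if b: "b \<in> B lam" for b
  proof -
    obtain c where "c \<in> B lam" "\<omega> (fibre lam b) = fibre lam c"
      using \<omega>(1)[OF fA[OF b]] by (auto simp: Alg_fibre)
    then show "\<theta> b \<in> B lam" "\<omega> (fibre lam b) = fibre lam (\<theta> b)" by (simp_all add: \<theta>_def rep_fibre)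
  qed
  have inj: "a = b" if "a \<in> B lam" "b \<in> B lam" "fibre lam a = fibre lam b" for a b
    by (rule trans[OF rep_fibre(2)[OF that(1), symmetric]]) (simp add: that(3) rep_fibre(2)[OF that(2)])
  have inv: "\<theta> (\<theta> b) = b" if b: "b \<in> B lam" for b
  proof (rule inj)
    show "fibre lam (\<theta> (\<theta> b)) = fibre lam b"
      using \<omega>(5)[OF fA[OF b]] by (simp only: \<theta> b)
  qed (simp_all add: \<theta> b)
  have sc: "\<theta> (cst c * a) = cst (cnj c) * \<theta> a" if a: "a \<in> B lam" for a c
  proof (rule inj)
    show "fibre lam (\<theta> (cst c * a)) = fibre lam (cst (cnj c) * \<theta> a)"
      using \<omega>(3)[OF fA[OF a], of c] by (simp only: A_ops_fibre(2)[OF a a] A_ops_fibre(2)[OF \<theta>(1)[OF a] \<theta>(1)[OF a]] \<theta> a B_mult B_cst)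
  qed (simp_all add: \<theta> a B_mult B_cst)
  have add: "\<theta> (a + b) = \<theta> a + \<theta> b" if ab: "a \<in> B lam" "b \<in> B lam" for a b
  proof (rule inj)
    show "fibre lam (\<theta> (a + b)) = fibre lam (\<theta> a + \<theta> b)"
      using \<omega>(2)[OF fA[OF ab(1)] fA[OF ab(2)]] by (simp only: A_ops_fibre \<theta> ab B_add)
  qed (simp_all add: \<theta> ab B_add)
  have com: "\<theta> (com a b) = com (\<theta> a) (\<theta> b)" if ab: "a \<in> B lam" "b \<in> B lam" for a b
  proof (rule inj)
    show "fibre lam (\<theta> (com a b)) = fibre lam (com (\<theta> a) (\<theta> b))"
      using \<omega>(4)[OF fA[OF ab(1)] fA[OF ab(2)]] by (simp only: A_ops_fibre \<theta> ab B_com)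
  qed (simp_all add: \<theta> ab B_com)
  have zero: "a = 0" if "a \<in> B lam" "\<theta> a = 0" for a
    using inv[OF that(1)] that(2) sc[OF B_0, of 0] by simp
  have "antilinear_lie lam \<theta>"
    unfolding antilinear_lie_def by (intro conjI ballI allI impI) (simp_all only: \<theta> sc add com zero)
  then have "lam\<^sup>2 \<in> \<real>" using inv by (rule no_antilinear_involution_B)
  then show False using assms by simp
qed

end
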